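(* Let $\mathcal{X},\mathcal{Y}$ be finite sets with at least two elements, $k_x=|\mathcal{X}|$, and let $1\le p\le 2$. For each alphabet $\mathcal{A}\in\{\mathcal{X},\mathcal{Y}\}$ let $(\hat q^*_{n})_{n\ge 0}=(\hat q^{*,\mathcal{A}}_{n})_{n\ge0}$, $\hat q^{*,\mathcal{A}}_n:\mathcal{A}^n\to\Delta_{\mathcal{A}}$, be a family of estimators that is first-order minimax optimal for $r^p_n(\mathcal{A})$, and let $C_p$ denote the first-order constant for the alphabet $\mathcal{Y}$, i.e. $$\max_{p_Y\in\Delta_{\mathcal{Y}}}\mathbb{E}\,\|p_Y-\hat q^{*,\mathcal{Y}}_n\|_p^p\;\simeq\;\min_{\hat q}\max_{p_Y\in\Delta_{\mathcal{Y}}}\mathbb{E}\,\|p_Y-\hat q\|_p^p\;\simeq\;\frac{C_p}{n^{p/2}}\qquad(n\to\infty).$$ Then, in the regime $m\to\infty$, $n=n(m)$ with $m=o(n)$, the joint composition $\hat q^{*,m,n}_{XY}$ based on this family is first-order minimax optimal for $R^p_{m,n}$: $$\max_{p_{XY}\in\Delta_{\mathcal{X}\times\mathcal{Y}}}\mathbb{E}_{U^n,L^m}\big[\|p_{XY}-\hat q^{*,m,n}_{XY}(U^n,L^m)\|_p^p\big]=R^p_{m,n}+o(R^p_{m,n}).$$ Furthermore, $$R^p_{m,n}=k_x^{\,1-\frac p2}\,\frac{C_p}{m^{p/2}}+o\!\left(\frac1{m^{p/2}}\right).$$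
   Context: $\Delta_{\mathcal{A}}$ is the set of probability mass functions on a finite set $\mathcal{A}$; $\|v\|_p^p=\sum_a|v(a)|^p$; $a_n\simeq b_n$ means $a_n=(1+o(1))b_n$. Min and max are understood as inf and sup where necessary. Univariate problem: $r^p_n(\mathcal{A})=\min_{\hat q}\max_{p_A\in\Delta_{\mathcal{A}}}\mathbb{E}\|p_A-\hat q(A_1,\dots,A_n)\|_p^p$, where $A_1,\dots,A_n$ are i.i.d. from $p_A$ and the minimum is over all estimators $\hat q:\mathcal{A}^n\to\Delta_{\mathcal{A}}$. It is known that $r^p_n(\mathcal{A})=(1+o(1))C_p n^{-p/2}$ as $n\to\infty$, where the constant $C_p>0$ depends on $p$ and $|\mathcal{A}|$. A family $(\hat q_n)_{n\ge0}$ is first-order minimax optimal for $r^p_n(\mathcal{A})$ if its worst-case risk is $r^p_n(\mathcal{A})(1+o(1))$ as $n\to\infty$. Semi-supervised problem: given $p_{XY}$ on $\mathcal{X}\times\mathcal{Y}$ with $X$-marginal $p_X$, one observes independent samples $L^m=((x'_i,y'_i))_{i=1}^m$ i.i.d. from $p_{XY}$ and $U^n=(x_j)_{j=1}^n$ i.i.d. from $p_X$, and $$R^p_{m,n}=\min_{\hat q_{XY}}\max_{p_{XY}\in\Delta_{\mathcal{X}\times\mathcal{Y}}}\mathbb{E}_{U^n,L^m}\|p_{XY}-\hat q_{XY}(U^n,L^m)\|_p^p ,$$ the minimum being over all maps $\hat q_{XY}$ from $(U^n,L^m)$ to $\Delta_{\mathcal{X}\times\mathcal{Y}}$. Conditional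 composition: for $x\in\mathcal{X}$ let $T_x=\#\{i\le m: x'_i=x\}$ and let $Y^{(x)}$ be the sequence, of length $T_x$, of those $y'_i$ with $x'_i=x$. The conditional composition based on $(\hat q^{*}_n)$ is $\hat q^{*,m}_{Y|X=x}(L^m)=\hat q^{*,\mathcal{Y}}_{T_x}(Y^{(x)})$, $x\in\mathcal{X}$. Joint composition: $\hat q^{*,m,n}_{XY}(x,y)=\hat q^{*,\mathcal{X}}_n(U^n)(x)\;\hat q^{*,m}_{Y|X=x}(L^m)(y)$. *)

theory Defs
  imports "HOL-Probability.Probability" "HOL-Library.Landau_Symbols"
begin

text \<open>
  A finite alphabet is a type of class \<open>finite\<close>, and the probability mass functions on it
  are the elements of the type \<open>pmf\<close>. An estimator from samples of size \<open>n\<close> is a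
  function on lists; its risk at sample size \<open>n\<close> depends only on its values on lists
  of length \<open>n\<close>.
\<close>

definition lp_loss :: "real \<Rightarrow> 'a::finite pmf \<Rightarrow> 'a pmf \<Rightarrow> real" where
  "lp_loss p P Q = (\<Sum>a\<in>UNIV. \<bar>pmf P a - pmf Q a\<bar> powr p)"

lemma lp_loss_nonneg: "0 \<le> lp_loss p P Q"
  by (simp add: lp_loss_def sum_nonneg)

lemma lp_loss_le_card:
  fixes P Q :: "'a::finite pmf"
  assumes "0 \<le> p"
  shows "lp_loss p P Q \<le> real CARD('a)"
proof -
  have "\<bar>pmf P a - pmf Q a\<bar> powr p \<le> 1" for a
  proof -
    have "\<bar>pmf P a - pmf Q a\<bar> \<le> 1"
      using pmf_nonneg[of P a] pmf_nonneg[of Q a] pmf_le_1[of P a] pmf_le_1[of Q a] by linarith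
    then show ?thesis
      using assms by (intro powr_le1) auto
  qed
  then have "lp_loss p P Q \<le> (\<Sum>a\<in>(UNIV :: 'a set). 1)"
    unfolding lp_loss_def by (intro sum_mono)
  then show ?thesis by simp
qed


text \<open>
  By the two bounds above, for \<open>p \<ge> 0\<close> the real-valued suprema and infima below range over
  nonempty bounded sets, so they are genuine suprema and infima.
\<close>

definition risk :: "real \<Rightarrow> nat \<Rightarrow> 'a::finite pmf \<Rightarrow> ('a list \<Rightarrow> 'a pmf) \<Rightarrow> real" where
  "risk p n P q = measure_pmf.expectation (replicate_pmf n P) (\<lambda>s. lp_loss p P (q s))"

definition worst_risk :: "real \<Rightarrow> nat \<Rightarrow> ('a::finite list \<Rightarrow> 'a pmf) \<Rightarrow> real" where
  "worst_risk p n q = (SUP P. risk p n P q)"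

definition minimax_risk :: "'a::finite itself \<Rightarrow> real \<Rightarrow> nat \<Rightarrow> real" where
  "minimax_risk _ p n = (INF q :: 'a list \<Rightarrow> 'a pmf. worst_risk p n q)"

definition first_order_minimax_optimal ::
    "real \<Rightarrow> (nat \<Rightarrow> 'a::finite list \<Rightarrow> 'a pmf) \<Rightarrow> bool" where
  "first_order_minimax_optimal p q \<longleftrightarrow>
     (\<lambda>n. worst_risk p n (q n)) \<sim>[at_top] minimax_risk TYPE('a) p"


text \<open>
  Estimators of a joint distribution take the unlabelled sample first and the labelled sample
  second; the unlabelled sample is drawn from the first marginal \<open>map_pmf fst P\<close>.
\<close>

definition joint_risk ::
    "real \<Rightarrow> nat \<Rightarrow> nat \<Rightarrow> ('x::finite \<times> 'y::finite) pmf \<Rightarrow>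
     ('x list \<Rightarrow> ('x \<times> 'y) list \<Rightarrow> ('x \<times> 'y) pmf) \<Rightarrow> real" where
  "joint_risk p m n P q =
     measure_pmf.expectation
       (pair_pmf (replicate_pmf n (map_pmf fst P)) (replicate_pmf m P))
       (\<lambda>(u, l). lp_loss p P (q u l))"

definition joint_worst_risk ::
    "real \<Rightarrow> nat \<Rightarrow> nat \<Rightarrow> ('x::finite list \<Rightarrow> ('x \<times> 'y::finite) list \<Rightarrow> ('x \<times> 'y) pmf) \<Rightarrow> real" where
  "joint_worst_risk p m n q = (SUP P. joint_risk p m n P q)"

definition joint_minimax_risk ::
    "'x::finite itself \<Rightarrow> 'y::finite itself \<Rightarrow> real \<Rightarrow> nat \<Rightarrow> nat \<Rightarrow> real" where
  "joint_minimax_risk _ _ p m n =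
     (INF q :: 'x list \<Rightarrow> ('x \<times> 'y) list \<Rightarrow> ('x \<times> 'y) pmf. joint_worst_risk p m n q)"


definition labels_of :: "'x \<Rightarrow> ('x \<times> 'y) list \<Rightarrow> 'y list" where
  "labels_of x l = map snd (filter (\<lambda>z. fst z = x) l)"

definition conditional_composition ::
    "(nat \<Rightarrow> 'y list \<Rightarrow> 'y pmf) \<Rightarrow> ('x \<times> 'y) list \<Rightarrow> 'x \<Rightarrow> 'y pmf" where
  "conditional_composition qY l x = qY (length (labels_of x l)) (labels_of x l)"

definition joint_composition ::
    "(nat \<Rightarrow> 'x list \<Rightarrow> 'x pmf) \<Rightarrow> (nat \<Rightarrow> 'y list \<Rightarrow> 'y pmf) \<Rightarrow> nat \<Rightarrow>
     'x list \<Rightarrow> ('x \<times> 'y) list \<Rightarrow> ('x \<times> 'y) pmf" where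
  "joint_composition qX qY n u l =
     bind_pmf (qX n u) (\<lambda>x. map_pmf (Pair x) (conditional_composition qY l x))"

lemma pmf_joint_composition:
  fixes qX :: "nat \<Rightarrow> 'x::finite list \<Rightarrow> 'x pmf"
  shows "pmf (joint_composition qX qY n u l) (x, y) =
    pmf (qX n u) x * pmf (conditional_composition qY l x) y"
proof -
  have *: "pmf (map_pmf (Pair x') (conditional_composition qY l x')) (x, y) =
      (if x' = x then pmf (conditional_composition qY l x) y else 0)" for x'
  proof (cases "x' = x")
    case True
    then show ?thesis
      using pmf_map_inj'[of "Pair x" "conditional_composition qY l x" y]
      by (simp add: inj_on_def)
  next
    case False
    then show ?thesis
      by (auto simp: pmf_eq_0_set_pmf)
  qed
  show ?thesis
    unfolding joint_composition_def pmf_bind *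
    by (subst integral_measure_pmf[of UNIV]) (auto simp: if_distrib sum.delta cong: if_cong)
qed

end

theory Submission
  imports Defs
begin

text \<open>
  Upper bound. The error \<open>p(x) p(y|x) - q(x) q(y|x)\<close> splits into \<open>p(x) (p(y|x) - q(y|x))\<close> and
  \<open>q(y|x) (p(x) - q(x))\<close>; the second part has order \<open>n powr (-p/2)\<close>, which is negligible since
  \<open>m = o(n)\<close>. Given its number \<open>T\<close> of occurrences, the labels of \<open>x\<close> are i.i.d., so the first part
  is at most the sum of \<open>p(x) powr p * C * E (T powr (-p/2))\<close>, that is, of
  \<open>C * (p(x) / m) powr (p/2)\<close> up to lower order, and concavity of the power \<open>p/2\<close> shows that
  the uniform marginal is the worst.

  Lower bound. A joint estimator need not have the correct marginal on \<open>X\<close>, so its rows are not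
  normalised, and it is not enough to invoke the univariate minimax risk. Instead the constant is
  identified: \<open>C\<close> is at most the worst Gaussian limit risk of the empirical distribution, attained
  at the uniform distribution, and this value is a lower bound for arbitrary real-valued
  coordinatewise estimators. For the latter the marginal on \<open>X\<close> is uniform and known and the rows
  are independent symmetric Dirichlet distributions, whose parameter tends to infinity more slowly
  than \<open>m\<close>. The posterior of each row is again a Dirichlet distribution, realised by normalised
  gamma variables \<open>g\<close> with sum \<open>S\<close>; its \<open>p\<close>-th deviation from \<open>q\<close> is governed by \<open>g y - q * S\<close>.

  Both comparisons with the Gaussian moment use, for \<open>p < 2\<close>, that \<open>\<bar>x\<bar> powr p\<close> is proportional to
  the integral of \<open>(1 - cos (t * x)) * t powr (-1-p)\<close> over \<open>t > 0\<close>. Absolute moments are thereby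
  functions of characteristic functions, and bounding the modulus of the characteristic function
  covers every centre \<open>q\<close> at once.
\<close>

text \<open>The constant: with a uniform marginal each of the k rows receives about m / k labels and
  its entries carry the factor 1 / k, so the risk is about k * k powr (-p) * C * (m / k) powr (-p/2)
  = k powr (1 - p/2) * C * m powr (-p/2). The obstacle is uniformity. The upper bound has to cover
  all distributions, nearly degenerate ones included, and the lower bound all centres q; hence
  explicit inequalities between characteristic functions instead of weak limits. Above, an additive
  error that does not depend on the law is enough, because only the maximum matters; below, the
  error is multiplicative and holds once the posterior variance exceeds a threshold. The Dirichlet
  parameter must tend to infinity so that the rows concentrate at the uniform row, where the
  Gaussian limit risk is largest, and must be o(m) so that the sample determines the posterior
  variance. Posterior statements are kept unnormalised, likelihood times loss against likelihood, so
  that no conditional distribution has to be constructed.\<close>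

section \<open>Absolute moments and characteristic functions\<close>

text \<open>For 0 < p < 2 this is, up to a constant, the Levy measure of a symmetric
  \<open>p\<close>-stable law, kept on the positive half-line because cosines are even. Its mass
  near 0 is infinite, so integrands must vanish there to an order exceeding
  \<open>p\<close>.\<close>

definition stable_levy :: "real \<Rightarrow> real measure" where
  "stable_levy p = density lborel (\<lambda>t. ennreal (t powr (-1-p)) * indicator {0<..} t)"

lemma sets_stable_levy [measurable_cong, simp]: "sets (stable_levy p) = sets borel"
  by (simp add: stable_levy_def)

lemma space_stable_levy [simp]: "space (stable_levy p) = UNIV"
  by (simp add: stable_levy_def)

lemma nn_integral_stable_levy:
  assumes [measurable]: "f \<in> borel_measurable borel"
  shows "(\<integral>\<^sup>+t. f t \<partial>stable_levy p) = (\<integral>\<^sup>+t. ennreal (t powr (-1-p)) * indicator {0<..} t * f t \<partial>lborel)"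
  unfolding stable_levy_def by (subst nn_integral_density) auto

lemma AE_stable_levy: "AE t in stable_levy p. t > 0"
  unfolding stable_levy_def by (subst AE_density) (auto simp: indicator_def)

lemma sigma_finite_stable_levy: "sigma_finite_measure (stable_levy p)"
  unfolding stable_levy_def
  by (subst sigma_finite_measure.sigma_finite_iff_density_finite[OF lborel.sigma_finite_measure_axioms]) (auto simp: indicator_def ennreal_mult_eq_top_iff)

text \<open>Substitution of \<open>c * t\<close>: the density is homogeneous of degree -1-p, and one
  factor \<open>c\<close> comes from the differential. This is the source of the exponent
  \<open>p\<close> in all moments below.\<close>

lemma nn_integral_stable_levy_scale:
  assumes [measurable]: "f \<in> borel_measurable borel" and c: "c > 0"
  shows "(\<integral>\<^sup>+t. f (c * t) \<partial>stable_levy p) = ennreal (c powr p) * (\<integral>\<^sup>+t. f t \<partial>stable_levy p)"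
proof -
  have "(\<integral>\<^sup>+t. f t \<partial>stable_levy p) =
      ennreal c * (\<integral>\<^sup>+t. ennreal ((c * t) powr (-1-p)) * indicator {0<..} (c * t) * f (c * t) \<partial>lborel)"
    using nn_integral_real_affine[of "\<lambda>t. ennreal (t powr (-1-p)) * indicator {0<..} t * f t" c 0] c
    by (simp add: nn_integral_stable_levy)
  also have "\<dots> = ennreal c * (\<integral>\<^sup>+t. ennreal (c powr (-1-p)) *
      (ennreal (t powr (-1-p)) * indicator {0<..} t * f (c * t)) \<partial>lborel)"
    using c by (intro arg_cong[where f="\<lambda>x. _ * x"] nn_integral_cong)
      (simp add: powr_mult indicator_def zero_less_mult_iff ennreal_mult mult_ac)
  also have "\<dots> = ennreal c * ennreal (c powr (-1-p)) * (\<integral>\<^sup>+t. f (c * t) \<partial>stable_levy p)"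
    by (subst nn_integral_cmult) (simp_all add: nn_integral_stable_levy mult_ac)
  also have "ennreal c * ennreal (c powr (-1-p)) = ennreal (c powr (-p))"
    using c by (simp add: ennreal_mult[symmetric] powr_mult_base[of c "-1-p"])
  finally have "ennreal (c powr p) * (\<integral>\<^sup>+t. f t \<partial>stable_levy p) =
     (ennreal (c powr p) * ennreal (c powr (-p))) * (\<integral>\<^sup>+t. f (c * t) \<partial>stable_levy p)"
    by (simp add: mult_ac)
  also have "ennreal (c powr p) * ennreal (c powr (-p)) = 1"
    using c by (simp add: ennreal_mult[symmetric] powr_add[symmetric])
  finally show ?thesis by simp
qed

lemma nn_integral_stable_levy_finite:
  fixes a c p :: real and k :: nat
  assumes p: "0 < p" "p < real k" and ac: "0 \<le> a" "0 \<le> c"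
  shows "(\<integral>\<^sup>+t. ennreal (min a (c * t ^ k)) \<partial>stable_levy p) < \<infinity>"
proof -
  have "(\<integral>\<^sup>+t. ennreal (min a (c * t ^ k)) \<partial>stable_levy p) \<le>
     (\<integral>\<^sup>+t. ennreal c * (ennreal (t powr (real k - 1 - p)) * indicator {0..1} t) +
       ennreal a * (ennreal (t powr (-1-p)) * indicator {1..} t) \<partial>lborel)"
  proof (subst nn_integral_stable_levy)
    show "(\<integral>\<^sup>+t. ennreal (t powr (-1-p)) * indicator {0<..} t * ennreal (min a (c * t ^ k)) \<partial>lborel)
      \<le> (\<integral>\<^sup>+t. ennreal c * (ennreal (t powr (real k - 1 - p)) * indicator {0..1} t) +
       ennreal a * (ennreal (t powr (-1-p)) * indicator {1..} t) \<partial>lborel)"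
    proof (intro nn_integral_mono)
      fix t :: real
      consider "t \<le> 0" | "0 < t" "t < 1" | "t \<ge> 1" by linarith
      then show "ennreal (t powr (-1-p)) * indicator {0<..} t * ennreal (min a (c * t ^ k)) \<le>
         ennreal c * (ennreal (t powr (real k - 1 - p)) * indicator {0..1} t) +
         ennreal a * (ennreal (t powr (-1-p)) * indicator {1..} t)"
      proof cases
        case 2
        have "t powr (-1-p) * min a (c * t ^ k) \<le> t powr (-1-p) * (c * t powr real k)"
          using 2 by (intro mult_left_mono) (auto simp: powr_realpow)
        also have "\<dots> = c * t powr (real k - 1 - p)"
          using 2 by (simp add: powr_add[symmetric] mult.left_commute algebra_simps)
        finally show ?thesis using 2 ac
          by (simp add: ennreal_mult[symmetric] ennreal_leI)
      next
        case 3
        have "ennreal (t powr (-1-p) * min a (c * t ^ k)) \<le> ennreal (a * t powr (-1-p))"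
          using 3 ac by (intro ennreal_leI) (simp add: mult.commute mult_left_mono)
        also have "\<dots> \<le> ennreal c * (ennreal (t powr (real k - 1 - p)) * indicator {0..1} t) + ennreal (a * t powr (-1-p))"
          by simp
        finally show ?thesis using 3 ac by (simp add: ennreal_mult)
      qed auto
    qed
  qed auto
  also have "\<dots> = ennreal c * (\<integral>\<^sup>+t. ennreal (t powr (real k - 1 - p)) * indicator {0..1} t \<partial>lborel) +
       ennreal a * (\<integral>\<^sup>+t. ennreal (t powr (-1-p)) * indicator {1..} t \<partial>lborel)"
    by (subst nn_integral_add) (auto simp: nn_integral_cmult)
  also have "\<dots> < \<infinity>"
    using nn_integral_has_integral_lebesgue'[OF _ has_integral_powr_from_0[of "real k - 1 - p" 1]]
      nn_integral_has_integral_lebesgue'[OF _ has_integral_powr_to_inf[of "-1-p" 1]] p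
    by (simp add: ennreal_mult_less_top)
  finally show ?thesis .
qed

text \<open>The factor between an absolute moment and an integral of a characteristic function. It
  is valued in \<open>ennreal\<close> because it is infinite at \<open>p = 2\<close>; it enters
  through positivity and, for \<open>p < 2\<close>, finiteness.\<close>

definition cos_const :: "real \<Rightarrow> ennreal" where
  "cos_const p = (\<integral>\<^sup>+t. ennreal (1 - cos t) \<partial>stable_levy p)"

lemma one_minus_cos_le: "1 - cos x \<le> min 2 (x^2 / 2)" for x :: real
  using cos_ge_minus_one[of x] abs_sin_le_one[of "x/2"] abs_square_le_1[of "sin (x/2)"] cos_squared_eq[of "x/2"] cos_double_sin[of "x/2"] sin_x_le_x[of "\<bar>x\<bar>/2"]
    abs_sin_x_le_abs_x[of "x/2"] abs_le_square_iff[of "sin (x/2)" "x/2"]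
  by (simp add: power_divide)

lemma cos_const_finite: "0 < p \<Longrightarrow> p < 2 \<Longrightarrow> cos_const p < \<infinity>"
  unfolding cos_const_def using one_minus_cos_le
  by (intro le_less_trans[OF nn_integral_mono nn_integral_stable_levy_finite[of p 2 2 "1/2"]])
    (auto intro!: ennreal_leI)

lemma nn_integral_stable_levy_pos:
  assumes [measurable]: "f \<in> borel_measurable borel" and "0 < b"
    and f: "\<And>t. 0 < t \<Longrightarrow> t < b \<Longrightarrow> f t > 0"
  shows "(\<integral>\<^sup>+t. f t \<partial>stable_levy p) > 0"
proof (rule ccontr)
  assume "\<not> ?thesis"
  then have "(\<integral>\<^sup>+t. ennreal (t powr (-1-p)) * indicator {0<..} t * f t \<partial>lborel) = 0"
    by (simp add: nn_integral_stable_levy)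
  then have "AE t in lborel. ennreal (t powr (-1-p)) * indicator {0<..} t * f t = 0"
    by (subst (asm) nn_integral_0_iff_AE) auto
  then have "AE t in lborel. t \<notin> {0<..<b}"
    by eventually_elim (use f in \<open>force simp: indicator_def\<close>)
  then have "emeasure lborel {0<..<b} = 0"
    by (subst (asm) AE_iff_measurable[of "{0<..<b}"]) auto
  then show False using \<open>0 < b\<close> by simp
qed

lemma cos_const_pos: "cos_const p > 0"
  unfolding cos_const_def
proof (rule nn_integral_stable_levy_pos[of _ 1])
  fix t :: real assume "0 < t" "t < 1"
  then have "cos t < cos 0" using pi_gt3 by (intro cos_monotone_0_pi) auto
  then show "0 < ennreal (1 - cos t)" by simp
qed auto

text \<open>The scaling rule with the factor |x|, as the cosine is even. At \<open>x = 0\<close>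
  both sides vanish, even where the constant is infinite.\<close>

lemma powr_abs_eq_cos_integral:
  "ennreal (\<bar>x\<bar> powr p) * cos_const p = (\<integral>\<^sup>+t. ennreal (1 - cos (t * x)) \<partial>stable_levy p)"
proof (cases "x = 0")
  case False
  have "(\<integral>\<^sup>+t. ennreal (1 - cos (t * x)) \<partial>stable_levy p) = (\<integral>\<^sup>+t. ennreal (1 - cos (\<bar>x\<bar> * t)) \<partial>stable_levy p)"
    by (intro nn_integral_cong) (auto simp: abs_if mult.commute)
  then show ?thesis
    using False by (simp add: cos_const_def nn_integral_stable_levy_scale[of "\<lambda>t. ennreal (1 - cos t)"])
qed simp

lemma nn_integral_one_minus_cos:
  fixes Z :: "'w \<Rightarrow> real"
  assumes "prob_space M" and [measurable]: "Z \<in> borel_measurable M"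
  shows "(\<integral>\<^sup>+w. ennreal (1 - cos (t * Z w)) \<partial>M) = ennreal (1 - Re (CLINT w|M. iexp (t * Z w)))"
proof -
  interpret prob_space M by fact
  have int: "integrable M (\<lambda>w. iexp (t * Z w))"
    by (rule integrable_iexp) auto
  have int_cos: "integrable M (\<lambda>w. cos (t * Z w))"
    by (rule integrable_const_bound[of _ 1]) auto
  have "(\<integral>\<^sup>+w. ennreal (1 - cos (t * Z w)) \<partial>M) = ennreal (\<integral>w. 1 - cos (t * Z w) \<partial>M)"
    using int_cos by (intro nn_integral_eq_integral) auto
  also have "(\<integral>w. 1 - cos (t * Z w) \<partial>M) = 1 - (\<integral>w. cos (t * Z w) \<partial>M)"
    using int_cos by (simp add: prob_space)
  also have "(\<integral>w. cos (t * Z w) \<partial>M) = Re (CLINT w|M. iexp (t * Z w))"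
    using int by (subst integral_Re[symmetric]) (auto simp: Re_exp)
  finally show ?thesis .
qed

text \<open>Tonelli for the cosine representation. All integrands are nonnegative, so the identity
  also covers infinite moments, and moments can be compared by comparing characteristic functions
  pointwise in \<open>t\<close>.\<close>

lemma nn_integral_powr_eq_char:
  fixes Z :: "'w \<Rightarrow> real"
  assumes "prob_space M" and [measurable]: "Z \<in> borel_measurable M"
  shows "(\<integral>\<^sup>+w. ennreal (\<bar>Z w\<bar> powr p) \<partial>M) * cos_const p =
    (\<integral>\<^sup>+t. ennreal (1 - Re (CLINT w|M. iexp (t * Z w))) \<partial>stable_levy p)"
proof -
  interpret prob_space M by fact
  interpret S: sigma_finite_measure "stable_levy p" by (rule sigma_finite_stable_levy)
  interpret pair_sigma_finite M "stable_levy p" ..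
  have "(\<integral>\<^sup>+w. ennreal (\<bar>Z w\<bar> powr p) \<partial>M) * cos_const p =
     (\<integral>\<^sup>+w. ennreal (\<bar>Z w\<bar> powr p) * cos_const p \<partial>M)"
    by (subst nn_integral_multc) auto
  also have "\<dots> = (\<integral>\<^sup>+w. (\<integral>\<^sup>+t. ennreal (1 - cos (t * Z w)) \<partial>stable_levy p) \<partial>M)"
    by (simp add: powr_abs_eq_cos_integral)
  also have "\<dots> = (\<integral>\<^sup>+t. (\<integral>\<^sup>+w. ennreal (1 - cos (t * Z w)) \<partial>M) \<partial>stable_levy p)"
    by (rule Fubini'[symmetric]) measurable
  also have "\<dots> = (\<integral>\<^sup>+t. ennreal (1 - Re (CLINT w|M. iexp (t * Z w))) \<partial>stable_levy p)"
    by (intro nn_integral_cong nn_integral_one_minus_cos assms)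
  finally show ?thesis .
qed

section \<open>Uniform normal approximation for sums of i.i.d. letters\<close>

lemma finite_set_replicate_pmf [simp]: "finite (set_pmf (replicate_pmf n (P :: 'a::finite pmf)))"
  using finite_lists_length_eq[of "UNIV :: 'a set" n]
  by (rule rev_finite_subset) (auto simp: set_replicate_pmf)

lemma integrable_replicate_pmf [simp]:
  fixes h :: "'a::finite list \<Rightarrow> 'b::{banach, second_countable_topology}"
  shows "integrable (measure_pmf (replicate_pmf n P)) h"
  by (rule integrable_measure_pmf_finite) simp

lemma expectation_pmf_eq_sum:
  fixes h :: "'a::finite \<Rightarrow> 'b::{banach, second_countable_topology}"
  shows "measure_pmf.expectation P h = (\<Sum>a\<in>UNIV. pmf P a *\<^sub>R h a)"
  by (subst integral_measure_pmf[of UNIV]) auto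

lemma sum_pmf_UNIV: "(\<Sum>a\<in>UNIV. pmf (P :: 'a::finite pmf) a) = 1"
  by (rule sum_pmf_eq_1) auto

lemma expectation_replicate_pmf_Suc:
  fixes h :: "'a::finite list \<Rightarrow> 'b::{banach, second_countable_topology}"
  shows "measure_pmf.expectation (replicate_pmf (Suc n) P) h =
    (\<Sum>a\<in>UNIV. pmf P a *\<^sub>R measure_pmf.expectation (replicate_pmf n P) (\<lambda>s. h (a # s)))"
proof -
  have "replicate_pmf (Suc n) P = P \<bind> (\<lambda>a. map_pmf ((#) a) (replicate_pmf n P))"
    by (simp add: map_pmf_def)
  then show ?thesis
    by (simp add: pmf_expectation_bind[of UNIV])
qed

lemma expectation_replicate_pmf_prod_list:
  fixes f :: "'a::finite \<Rightarrow> complex"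
  shows "measure_pmf.expectation (replicate_pmf n P) (\<lambda>s. prod_list (map f s)) =
    measure_pmf.expectation P f ^ n"
proof (induction n)
  case (Suc n)
  show ?case
    by (subst expectation_replicate_pmf_Suc)
      (simp add: Suc expectation_pmf_eq_sum[of P f] sum_distrib_right)
qed simp

lemma iexp_sum_list: "iexp (t * (\<Sum>z\<leftarrow>s. f z)) = prod_list (map (\<lambda>z. iexp (t * f z)) s)"
  by (induction s) (auto simp: ring_distribs exp_add)

text \<open>The integral of \<open>nn_integral_powr_eq_char\<close> for a standard normal variable,
  whose characteristic function is exp (- t^2 / 2); division by \<open>cos_const\<close> gives its
  absolute moment.\<close>

definition gauss_const :: "real \<Rightarrow> ennreal" where
  "gauss_const p = (\<integral>\<^sup>+t. ennreal (1 - exp (- (t^2) / 2)) \<partial>stable_levy p)"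

lemma one_minus_exp_le: "0 \<le> x \<Longrightarrow> 1 - exp (-x) \<le> min 2 x" for x :: real
  using exp_ge_add_one_self[of "-x"] exp_ge_zero[of "-x"] by linarith

lemma gauss_const_finite: "0 < p \<Longrightarrow> p < 2 \<Longrightarrow> gauss_const p < \<infinity>"
  unfolding gauss_const_def using one_minus_exp_le[of "t^2/2" for t]
  by (intro le_less_trans[OF nn_integral_mono nn_integral_stable_levy_finite[of p 2 2 "1/2"]])
    (auto intro!: ennreal_leI)

lemma gauss_const_pos: "gauss_const p > 0"
  unfolding gauss_const_def by (rule nn_integral_stable_levy_pos[of _ 1]) auto

lemma nn_integral_one_minus_exp_stable_levy:
  assumes "0 \<le> v"
  shows "(\<integral>\<^sup>+t. ennreal (1 - exp (- (v * t^2) / 2)) \<partial>stable_levy p) = ennreal (v powr (p/2)) * gauss_const p"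
proof (cases "v = 0")
  case False
  then have "(\<integral>\<^sup>+t. ennreal (1 - exp (- (v * t^2) / 2)) \<partial>stable_levy p) =
      (\<integral>\<^sup>+t. ennreal (1 - exp (- ((sqrt v * t)^2) / 2)) \<partial>stable_levy p)"
    using assms by (simp add: power_mult_distrib)
  also have "\<dots> = ennreal (sqrt v powr p) * gauss_const p"
    unfolding gauss_const_def using assms False
    by (subst nn_integral_stable_levy_scale[of "\<lambda>t. ennreal (1 - exp (- (t^2) / 2))"]) auto
  also have "sqrt v powr p = v powr (p/2)"
    using assms by (simp add: powr_half_sqrt[symmetric] powr_powr)
  finally show ?thesis .
qed simp

text \<open>The \<open>p\<close>-th absolute moment of the standard normal distribution; at \<open>p = 2\<close> both
  integrals diverge.\<close>

definition gauss_moment :: "real \<Rightarrow> real" where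
  "gauss_moment p = (if p = 2 then 1 else enn2real (gauss_const p) / enn2real (cos_const p))"

lemma gauss_moment_pos: "1 \<le> p \<Longrightarrow> p \<le> 2 \<Longrightarrow> gauss_moment p > 0"
  using gauss_const_pos[of p] gauss_const_finite[of p] cos_const_pos[of p] cos_const_finite[of p]
  by (auto simp: gauss_moment_def enn2real_positive_iff)

text \<open>Integrates a bound for the distance between the characteristic function of a normalised
  sum and the normal one: 2 for any two points of the unit disc, the cubic term for small
  \<open>t\<close>. No law enters, so the error is uniform over all distributions.\<close>

definition clt_error :: "real \<Rightarrow> nat \<Rightarrow> real" where
  "clt_error p n = enn2real (\<integral>\<^sup>+t. ennreal (min 2 (2 / sqrt n * t^3)) \<partial>stable_levy p) / enn2real (cos_const p)"

lemma clt_error_nonneg: "clt_error p n \<ge> 0"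
  by (simp add: clt_error_def)

text \<open>Dominated convergence; the dominating function \<open>min 2 (2 * t^3)\<close> is
  integrable because \<open>p\<close> < 3, which includes \<open>p = 2\<close>.\<close>

lemma clt_error_tendsto_0:
  assumes "1 \<le> p" "p \<le> 2"
  shows "clt_error p \<longlonglongrightarrow> 0"
proof -
  have "(\<lambda>n. \<integral>\<^sup>+t. ennreal (min 2 (2 / sqrt (real n) * t^3)) \<partial>stable_levy p) \<longlonglongrightarrow> (\<integral>\<^sup>+t. ennreal 0 \<partial>stable_levy p)"
  proof (rule nn_integral_dominated_convergence[where w="\<lambda>t. ennreal (min 2 (2 * t^3))"])
    show "(\<integral>\<^sup>+t. ennreal (min 2 (2 * t^3)) \<partial>stable_levy p) < \<infinity>"
      using nn_integral_stable_levy_finite[of p 3 2 2] assms by simp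
    fix n
    have le: "2 / sqrt (real n) * t^3 \<le> 2 * t^3" if "t > 0" for t
      using that by (cases "n = 0") (auto simp: field_simps)
    show "AE t in stable_levy p. ennreal (min 2 (2 / sqrt (real n) * t^3)) \<le> ennreal (min 2 (2 * t^3))"
      using AE_stable_levy[of p]
      by eventually_elim (intro ennreal_leI min.mono le order.refl)
  next
    have "(\<lambda>n. min 2 (2 / sqrt (real n) * t^3)) \<longlonglongrightarrow> min 2 (0 * t^3)" for t
      by (intro tendsto_intros real_tendsto_divide_at_top[OF tendsto_const]
          filterlim_compose[OF sqrt_at_top] filterlim_real_sequentially)
    then show "AE t in stable_levy p. (\<lambda>n. ennreal (min 2 (2 / sqrt (real n) * t^3))) \<longlonglongrightarrow> ennreal 0"
      by (intro AE_I2 tendsto_ennrealI) simp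
  qed auto
  then have "(\<lambda>n. enn2real (\<integral>\<^sup>+t. ennreal (min 2 (2 / sqrt (real n) * t^3)) \<partial>stable_levy p)) \<longlonglongrightarrow> enn2real 0"
    by (intro tendsto_enn2real) auto
  then show ?thesis
    unfolding clt_error_def[abs_def] by (auto intro!: tendsto_divide_zero)
qed

lemma exp_minus_le_quadratic:
  assumes "(w::real) \<ge> 0"
  shows "exp (-w) \<le> 1 - w + w^2"
proof -
  have "exp (-w) \<le> 1 / (1 + w)"
    using exp_ge_add_one_self[of w] assms by (simp add: exp_minus field_simps)
  moreover have "1 / (1 + w) \<le> 1 - w + w^2"
  proof -
    have "(1 - w + w^2) * (1 + w) = 1 + w^3" by algebra
    then show ?thesis using assms by (simp add: divide_le_eq)
  qed
  ultimately show ?thesis by linarith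
qed

text \<open>For |u| <= 1 two errors add up: the Taylor remainder |u|^3 / 6, and w^2 <= u^4 <= |u|^3
  for replacing 1 - w by exp (-w). For larger \<open>u\<close>, two points of the unit disc are at
  most 2 apart. The variance is not bounded from below, so degenerate laws are covered.\<close>

lemma char_taylor_bound:
  fixes P :: "'a::finite pmf" and f :: "'a \<Rightarrow> real"
  assumes f: "\<And>a. \<bar>f a\<bar> \<le> 1" and mean: "measure_pmf.expectation P f = 0"
    and v: "measure_pmf.expectation P (\<lambda>a. f a ^ 2) = v"
  shows "norm ((CLINT a|measure_pmf P. iexp (u * f a)) - exp (- (v * u^2) / 2)) \<le> 2 * \<bar>u\<bar>^3"
proof -
  have int [simp]: "integrable (measure_pmf P) h" for h :: "'a \<Rightarrow> 'c::{banach, second_countable_topology}"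
    by (rule integrable_measure_pmf_finite) simp
  have v0: "0 \<le> v" "v \<le> 1"
  proof -
    show "0 \<le> v" unfolding v[symmetric] by simp
    have "f a ^ 2 \<le> 1" for a using f[of a] by (simp add: abs_square_le_1)
    then have "v \<le> measure_pmf.expectation P (\<lambda>a. 1)"
      unfolding v[symmetric] by (intro integral_mono) auto
    then show "v \<le> 1" by simp
  qed
  note P1 = sum_pmf_UNIV[of P]
  note E = expectation_pmf_eq_sum[of P]
  have A: "norm ((CLINT a|measure_pmf P. iexp (u * f a)) - (1 - of_real (v * u^2 / 2))) \<le> \<bar>u\<bar>^3 / 6"
  proof -
    have *: "(\<Sum>k\<le>2. (\<i> * complex_of_real (u * f a))^k / fact k) =
        1 + \<i> * (u * f a) - complex_of_real (u^2 * (f a)^2 / 2)" for a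
      by (simp add: numeral_2_eq_2 power_mult_distrib)
    have "(\<Sum>a\<in>UNIV. pmf P a *\<^sub>R (1 + \<i> * (u * f a) - complex_of_real (u^2 * (f a)^2 / 2))) =
       of_real (\<Sum>a\<in>UNIV. pmf P a) + \<i> * u * of_real (\<Sum>a\<in>UNIV. pmf P a * f a)
         - of_real (u^2 / 2) * of_real (\<Sum>a\<in>UNIV. pmf P a * (f a)^2)"
      by (simp add: scaleR_conv_of_real sum.distrib sum_subtractf sum_distrib_left ring_distribs mult_ac of_real_sum)
    also have "\<dots> = 1 - of_real (v * u^2 / 2)"
      using mean v by (simp add: E P1)
    finally have "(CLINT a|measure_pmf P. iexp (u * f a)) - (1 - of_real (v * u^2 / 2)) =
       (\<Sum>a\<in>UNIV. pmf P a *\<^sub>R (iexp (u * f a) - (\<Sum>k\<le>2. (\<i> * complex_of_real (u * f a))^k / fact k)))"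
      unfolding * E by (simp add: scaleR_diff_right sum_subtractf)
    also have "norm \<dots> \<le> (\<Sum>a\<in>UNIV. pmf P a * (\<bar>u\<bar>^3 / 6))"
    proof (intro sum_norm_le)
      fix a
      have "norm (iexp (u * f a) - (\<Sum>k\<le>2. (\<i> * complex_of_real (u * f a))^k / fact k)) \<le> \<bar>u * f a\<bar>^3 / 6"
        using iexp_approx1[of "u * f a" 2] by (simp add: fact_numeral eval_nat_numeral)
      also have "\<bar>u * f a\<bar>^3 \<le> \<bar>u\<bar>^3"
        using f[of a] by (intro power_mono) (auto simp: abs_mult mult_left_le)
      finally show "norm (pmf P a *\<^sub>R (iexp (u * f a) - (\<Sum>k\<le>2. (\<i> * complex_of_real (u * f a))^k / fact k)))
          \<le> pmf P a * (\<bar>u\<bar>^3 / 6)"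
        unfolding norm_scaleR abs_of_nonneg[OF pmf_nonneg] by (rule mult_left_mono) simp_all
    qed
    also have "\<dots> = \<bar>u\<bar>^3 / 6" by (simp add: sum_distrib_right[symmetric] P1 del: times_divide_eq_right)
    finally show ?thesis .
  qed
  have B: "norm ((1 - of_real (v * u^2 / 2)) - complex_of_real (exp (- (v * u^2) / 2))) \<le> \<bar>u\<bar>^3" if "\<bar>u\<bar> \<le> 1"
  proof -
    define w where "w = v * u^2 / 2"
    have w: "0 \<le> w" "w \<le> u^2" using v0 by (auto simp: w_def mult_left_le_one_le)
      (smt (verit) mult_left_le_one_le zero_le_power2)
    have "\<bar>exp (-w) - (1 - w)\<bar> \<le> w^2"
    proof -
      have "exp (-w) \<ge> 1 - w" using exp_ge_add_one_self[of "-w"] by simp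
      then show ?thesis using exp_minus_le_quadratic[OF w(1)] by linarith
    qed
    also have "w^2 \<le> (u^2)^2" using w by (intro power_mono) auto
    also have "\<dots> = \<bar>u\<bar>^4" by simp
    also have "\<dots> \<le> \<bar>u\<bar>^3" using that by (intro power_decreasing) auto
    finally have "\<bar>(1 - w) - exp (-w)\<bar> \<le> \<bar>u\<bar>^3" by (simp add: abs_minus_commute)
    moreover have "(1 - of_real (v * u^2 / 2)) - complex_of_real (exp (- (v * u^2) / 2)) = of_real ((1 - w) - exp (-w))"
      by (simp add: w_def)
    ultimately show ?thesis by (simp only: norm_of_real)
  qed
  have small: "norm ((CLINT a|measure_pmf P. iexp (u * f a)) - exp (- (v * u^2) / 2)) \<le> 2 * \<bar>u\<bar>^3" if "\<bar>u\<bar> \<le> 1"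
    by (rule order.trans[OF norm_diff_triangle_le[OF A B[OF that]]]) simp
  show ?thesis
  proof (cases "\<bar>u\<bar> \<le> 1")
    case False
    have "norm (CLINT a|measure_pmf P. iexp (u * f a)) \<le> 1"
      using integral_norm_bound[of "measure_pmf P" "\<lambda>a. iexp (u * f a)"] by simp
    then have "norm ((CLINT a|measure_pmf P. iexp (u * f a)) - exp (- (v * u^2) / 2)) \<le> 1 + 1"
      using v0 by (intro order.trans[OF norm_triangle_ineq4] add_mono) auto
    also have "\<dots> \<le> 2 * \<bar>u\<bar>^3" using False by simp
    finally show ?thesis .
  qed (use small in simp)
qed

lemma expectation_sum_list_power2:
  fixes P :: "'a::finite pmf" and f :: "'a \<Rightarrow> real"
  assumes mean: "measure_pmf.expectation P f = 0"
    and v: "measure_pmf.expectation P (\<lambda>a. f a ^ 2) = v"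
  shows "measure_pmf.expectation (replicate_pmf n P) (\<lambda>s. (\<Sum>z\<leftarrow>s. f z)^2) = n * v"
proof -
  note E = expectation_pmf_eq_sum[of P]
  note P1 = sum_pmf_UNIV[of P]
  have "measure_pmf.expectation (replicate_pmf n P) (\<lambda>s. (\<Sum>z\<leftarrow>s. f z)) = 0 \<and>
    measure_pmf.expectation (replicate_pmf n P) (\<lambda>s. (\<Sum>z\<leftarrow>s. f z)^2) = n * v"
  proof (induction n)
    case (Suc n)
    show ?case
      unfolding expectation_replicate_pmf_Suc power2_sum sum_list.Cons list.map
      using Suc mean v
      by (simp add: E P1 ring_distribs sum.distrib mult_ac sum_distrib_left[symmetric] sum_distrib_right[symmetric])
  qed simp
  then show ?thesis ..
qed

text \<open>A central limit theorem for absolute moments, as a one-sided inequality uniform in the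
  law. The error is additive: it dominates when \<open>v\<close> is small, which is harmless under a
  maximum over laws. At \<open>p = 2\<close> the exact variance replaces the characteristic
  functions.\<close>

theorem expectation_abs_sum_powr_le:
  fixes P :: "'a::finite pmf" and f :: "'a \<Rightarrow> real"
  assumes p: "1 \<le> p" "p \<le> 2" and n: "n \<ge> 1"
    and f: "\<And>a. \<bar>f a\<bar> \<le> 1" and mean: "measure_pmf.expectation P f = 0"
    and v: "measure_pmf.expectation P (\<lambda>a. f a ^ 2) = v"
  shows "measure_pmf.expectation (replicate_pmf n P) (\<lambda>s. \<bar>\<Sum>z\<leftarrow>s. f z\<bar> powr p) \<le>
    real n powr (p/2) * (gauss_moment p * v powr (p/2) + clt_error p n)"
proof (cases "p = 2")
  case True
  have v0: "0 \<le> v" unfolding v[symmetric] by simp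
  have "measure_pmf.expectation (replicate_pmf n P) (\<lambda>s. \<bar>\<Sum>z\<leftarrow>s. f z\<bar> powr p) = n * v"
    using True expectation_sum_list_power2[OF mean v, of n] by simp
  also have "\<dots> \<le> real n powr (p/2) * (gauss_moment p * v powr (p/2) + clt_error p n)"
    using True v0 n clt_error_nonneg[of 2 n] by (simp add: gauss_moment_def)
  finally show ?thesis .
next
  case False
  then have p': "0 < p" "p < 2" using p by auto
  have v0: "0 \<le> v" unfolding v[symmetric] by simp
  define S where "S s = (\<Sum>z\<leftarrow>s. f z) / sqrt n" for s
  define \<phi> where "\<phi> u = (CLINT a|measure_pmf P. iexp (u * f a))" for u
  let ?R = "replicate_pmf n P"
  have char: "(CLINT s|measure_pmf ?R. iexp (t * S s)) = \<phi> (t / sqrt n) ^ n" for t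
  proof -
    have "(CLINT s|measure_pmf ?R. iexp (t * S s)) =
        (CLINT s|measure_pmf ?R. prod_list (map (\<lambda>z. iexp (t / sqrt n * f z)) s))"
      by (simp only: iexp_sum_list[symmetric]) (simp add: S_def field_simps)
    then show ?thesis by (simp only: expectation_replicate_pmf_prod_list \<phi>_def)
  qed
  have n1: "norm (\<phi> u) \<le> 1" for u
    unfolding \<phi>_def using integral_norm_bound[of "measure_pmf P" "\<lambda>a. iexp (u * f a)"] by simp
  have close: "1 - Re (\<phi> (t / sqrt n) ^ n) \<le> (1 - exp (- (v * t^2) / 2)) + min 2 (2 / sqrt n * t^3)"
    if t: "t > 0" for t
  proof -
    \<comment> \<open>One of \<open>n\<close> equal factors of the normal characteristic function,
      so that the difference of the \<open>n\<close>-th powers is at most \<open>n\<close> times the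
      difference of the factors; \<open>n\<close> remainders of size 2 * |t / sqrt n|^3 give the
      cubic term of \<open>clt_error\<close>.\<close>
    define e where "e = complex_of_real (exp (- (v * (t / sqrt n)^2) / 2))"
    have e1: "norm e \<le> 1" using v0 by (simp add: e_def)
    have "e ^ n = exp (of_nat n * complex_of_real (- (v * (t / sqrt n)^2) / 2))"
      unfolding e_def by (simp only: exp_of_nat_mult exp_of_real)
    also have "of_nat n * complex_of_real (- (v * (t / sqrt n)^2) / 2) = of_real (- (v * t^2) / 2)"
      using n by (simp add: power_divide)
    finally have en: "e ^ n = of_real (exp (- (v * t^2) / 2))" by (simp only: exp_of_real)
    have "norm (\<phi> (t / sqrt n) ^ n - e ^ n) \<le> n * norm (\<phi> (t / sqrt n) - e)"
      by (rule norm_power_diff) (use n1 e1 in auto)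
    also have "\<dots> \<le> n * (2 * \<bar>t / sqrt n\<bar>^3)"
      unfolding \<phi>_def e_def by (intro mult_left_mono char_taylor_bound f mean v) auto
    also have "\<dots> = 2 / sqrt n * t^3"
    proof -
      have "real n = sqrt n ^ 2" by simp
      then have "real n / sqrt n ^ 3 = 1 / sqrt n" using n
        by (simp add: power3_eq_cube power2_eq_square del: real_sqrt_pow2 real_sqrt_mult_self)
      then have "real n * (2 * \<bar>t / sqrt n\<bar>^3) = 2 * t^3 * (1 / sqrt n)"
        using t unfolding \<open>real n / sqrt n ^ 3 = 1 / sqrt n\<close>[symmetric] by (simp add: power_divide)
      then show ?thesis by simp
    qed
    finally have "norm (\<phi> (t / sqrt n) ^ n - e ^ n) \<le> 2 / sqrt n * t^3" .
    moreover have "norm (\<phi> (t / sqrt n) ^ n - e ^ n) \<le> 1 + 1"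
      using n1 e1 by (intro order.trans[OF norm_triangle_ineq4] add_mono) (auto simp: norm_power intro!: power_le_one)
    moreover have "\<bar>Re (\<phi> (t / sqrt n) ^ n - e ^ n)\<bar> \<le> norm (\<phi> (t / sqrt n) ^ n - e ^ n)"
      by (rule abs_Re_le_cmod)
    ultimately show ?thesis unfolding en by simp
  qed
  let ?I = "\<integral>\<^sup>+t. ennreal (min 2 (2 / sqrt n * t^3)) \<partial>stable_levy p"
  have If: "?I < \<infinity>"
    using nn_integral_stable_levy_finite[of p 3 2 "2 / sqrt n"] p' by simp
  have "ennreal (measure_pmf.expectation ?R (\<lambda>s. \<bar>S s\<bar> powr p)) * cos_const p =
      (\<integral>\<^sup>+s. ennreal (\<bar>S s\<bar> powr p) \<partial>measure_pmf ?R) * cos_const p"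
    by (subst nn_integral_eq_integral) auto
  also have "\<dots> = (\<integral>\<^sup>+t. ennreal (1 - Re (\<phi> (t / sqrt n) ^ n)) \<partial>stable_levy p)"
    using nn_integral_powr_eq_char[OF measure_pmf.prob_space_axioms, of S ?R p] unfolding char by simp
  also have "\<dots> \<le> (\<integral>\<^sup>+t. ennreal (1 - exp (- (v * t^2) / 2)) + ennreal (min 2 (2 / sqrt n * t^3)) \<partial>stable_levy p)"
  proof (rule nn_integral_mono_AE)
    show "AE t in stable_levy p. ennreal (1 - Re (\<phi> (t / sqrt n) ^ n)) \<le>
        ennreal (1 - exp (- (v * t^2) / 2)) + ennreal (min 2 (2 / sqrt n * t^3))"
      using AE_stable_levy[of p]
    proof eventually_elim
      case (elim t)
      have "ennreal (1 - Re (\<phi> (t / sqrt n) ^ n)) \<le>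
          ennreal ((1 - exp (- (v * t^2) / 2)) + min 2 (2 / sqrt n * t^3))"
        by (rule ennreal_leI[OF close[OF elim]])
      also have "\<dots> = ennreal (1 - exp (- (v * t^2) / 2)) + ennreal (min 2 (2 / sqrt n * t^3))"
        using v0 elim by (intro ennreal_plus) auto
      finally show ?case .
    qed
  qed
  also have "\<dots> = ennreal (v powr (p/2)) * gauss_const p + ?I"
    unfolding nn_integral_one_minus_exp_stable_levy[OF v0, symmetric] by (rule nn_integral_add) auto
  finally have le: "ennreal (measure_pmf.expectation ?R (\<lambda>s. \<bar>S s\<bar> powr p)) * cos_const p \<le>
    ennreal (v powr (p/2)) * gauss_const p + ?I" .
  define K G where "K = enn2real (cos_const p)" and "G = enn2real (gauss_const p)"
  have KG: "cos_const p = ennreal K" "gauss_const p = ennreal G" "?I = ennreal (enn2real ?I)"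
    using cos_const_finite[OF p'] gauss_const_finite[OF p'] If by (simp_all add: K_def G_def)
  have K: "K > 0" using cos_const_pos[of p] cos_const_finite[OF p'] by (simp add: K_def enn2real_positive_iff)
  have G: "G \<ge> 0" by (simp add: G_def)
  have "measure_pmf.expectation ?R (\<lambda>s. \<bar>S s\<bar> powr p) * K \<le> v powr (p/2) * G + enn2real ?I"
  proof -
    have "ennreal (measure_pmf.expectation ?R (\<lambda>s. \<bar>S s\<bar> powr p) * K) \<le> ennreal (v powr (p/2) * G + enn2real ?I)"
      using le K G unfolding KG(1,2) by (subst (asm) KG(3)) (simp add: ennreal_mult ennreal_plus)
    then show ?thesis using G by (subst (asm) ennreal_le_iff) auto
  qed
  then have *: "measure_pmf.expectation ?R (\<lambda>s. \<bar>S s\<bar> powr p) \<le> gauss_moment p * v powr (p/2) + clt_error p n"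
    using K False by (simp add: gauss_moment_def clt_error_def K_def[symmetric] G_def[symmetric] field_simps)
  have "\<bar>\<Sum>z\<leftarrow>s. f z\<bar> powr p = real n powr (p/2) * (\<bar>S s\<bar> powr p)" for s
  proof -
    have "\<bar>\<Sum>z\<leftarrow>s. f z\<bar> = sqrt n * \<bar>S s\<bar>" using n by (simp add: S_def abs_mult)
    then show ?thesis by (simp add: powr_mult powr_half_sqrt[symmetric] powr_powr)
  qed
  then have "measure_pmf.expectation ?R (\<lambda>s. \<bar>\<Sum>z\<leftarrow>s. f z\<bar> powr p) =
     real n powr (p/2) * measure_pmf.expectation ?R (\<lambda>s. \<bar>S s\<bar> powr p)" by simp
  then show ?thesis using * by (simp add: mult_left_mono)
qed

section \<open>Gamma variables and Dirichlet posteriors\<close>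

definition gvol :: "('y::finite \<Rightarrow> real) measure" where
  "gvol = Pi\<^sub>M UNIV (\<lambda>_. lborel)"

text \<open>Independent gamma variables with shapes \<open>a b + 1\<close>; the shift follows \<^const>\<open>erlang_density\<close>.\<close>

definition edens :: "('y::finite \<Rightarrow> nat) \<Rightarrow> ('y \<Rightarrow> real) \<Rightarrow> real" where
  "edens a g = (\<Prod>b\<in>UNIV. erlang_density (a b) 1 (g b))"

definition coord_sum :: "('y::finite \<Rightarrow> real) \<Rightarrow> real" where
  "coord_sum g = (\<Sum>b\<in>UNIV. g b)"

definition shape_sum :: "('y::finite \<Rightarrow> nat) \<Rightarrow> real" where
  "shape_sum a = (\<Sum>b\<in>UNIV. real (a b) + 1)"

lemma space_gvol [simp]: "space gvol = UNIV"
  by (simp add: gvol_def space_PiM)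

lemma measurable_gvol_component: "(\<lambda>g. g b) \<in> borel_measurable gvol"
  unfolding gvol_def by measurable

lemma measurable_coord_sum [measurable]: "coord_sum \<in> borel_measurable gvol"
  using measurable_gvol_component [measurable] unfolding coord_sum_def[abs_def] by measurable

lemma measurable_edens [measurable]: "edens a \<in> borel_measurable gvol"
  using measurable_gvol_component [measurable] unfolding edens_def[abs_def] by measurable

lemma sigma_finite_gvol: "sigma_finite_measure (gvol :: ('y::finite \<Rightarrow> real) measure)"
proof -
  interpret finite_product_sigma_finite "\<lambda>_::'y. lborel :: real measure" UNIV
    by standard auto
  show ?thesis unfolding gvol_def by (rule sigma_finite_measure_axioms)
qed

lemma edens_nonneg: "edens a g \<ge> 0"
  by (simp add: edens_def prod_nonneg)

text \<open>With every exponent at least 1 the density vanishes on the whole boundary of the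
  positive orthant, not only outside it. Hence \<open>coord_sum\<close> is positive wherever the
  density is nonzero, and divisions by it need no null sets.\<close>

lemma edens_zero:
  assumes "\<And>b. a b \<ge> 1" "g b \<le> 0"
  shows "edens a g = 0"
proof -
  have "erlang_density (a b) 1 (g b) = 0"
    using assms(1)[of b] assms(2) by (auto simp: erlang_density_def)
  then show ?thesis unfolding edens_def by (intro prod_zero) auto
qed

lemma nn_integral_edens: "(\<integral>\<^sup>+g. ennreal (edens a g) \<partial>gvol) = 1"
proof -
  interpret product_sigma_finite "\<lambda>_. lborel :: real measure" ..
  have "(\<integral>\<^sup>+g. ennreal (edens a g) \<partial>gvol) = (\<integral>\<^sup>+g. (\<Prod>b\<in>UNIV. ennreal (erlang_density (a b) 1 (g b))) \<partial>gvol)"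
    by (intro nn_integral_cong) (simp add: edens_def prod_ennreal)
  also have "\<dots> = (\<Prod>b\<in>UNIV. (\<integral>\<^sup>+x. ennreal (erlang_density (a b) 1 x) \<partial>lborel))"
    unfolding gvol_def by (rule product_nn_integral_prod) auto
  also have "\<dots> = 1"
    using nn_integral_erlang_ith_moment[of 1 "a b" 0 for b] by simp
  finally show ?thesis .
qed

text \<open>The Jacobian of a dilation. The rescaled image measure is identified with the product
  measure on boxes, coordinate by coordinate.\<close>

lemma nn_integral_gvol_scale:
  fixes f :: "('y::finite \<Rightarrow> real) \<Rightarrow> ennreal"
  assumes c: "c > 0" and [measurable]: "f \<in> borel_measurable gvol"
  shows "(\<integral>\<^sup>+g. f g \<partial>gvol) = ennreal (c ^ CARD('y)) * (\<integral>\<^sup>+g. f (\<lambda>b. c * g b) \<partial>gvol)"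
proof -
  interpret product_sigma_finite "\<lambda>_. lborel :: real measure" ..
  let ?h = "\<lambda>(g :: 'y \<Rightarrow> real) b. c * g b"
  have "(\<lambda>g :: 'y \<Rightarrow> real. c * g b) \<in> borel_measurable gvol" for b
    using measurable_gvol_component [measurable] by measurable
  then have [measurable]: "?h \<in> measurable gvol gvol"
    unfolding gvol_def by (intro measurable_PiM_single') (auto simp: space_PiM)
  have "density (distr gvol gvol ?h) (\<lambda>_. ennreal (c ^ CARD('y))) = gvol"
    unfolding gvol_def
  proof (rule PiM_eqI)
    fix A :: "'y \<Rightarrow> real set" assume A: "\<And>i. i \<in> UNIV \<Longrightarrow> A i \<in> sets lborel"
    then have AM: "Pi\<^sub>E UNIV A \<in> sets gvol"
      unfolding gvol_def by (intro sets_PiM_I_finite) auto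
    have "?h -` Pi\<^sub>E UNIV A \<inter> space gvol = Pi\<^sub>E UNIV (\<lambda>b. (\<lambda>x. c * x) -` A b)"
      by (auto simp: PiE_def Pi_def)
    moreover have sc: "(\<lambda>x. c * x) -` A b \<in> sets lborel" for b
      using A[of b] measurable_sets[of "\<lambda>x. c * x" borel borel "A b"] by simp
    ultimately have "emeasure (distr gvol gvol ?h) (Pi\<^sub>E UNIV A) = (\<Prod>b\<in>UNIV. emeasure lborel ((\<lambda>x. c * x) -` A b))"
      using AM by (subst emeasure_distr) (measurable, simp_all add: gvol_def emeasure_PiM)
    moreover have "ennreal c * emeasure lborel ((\<lambda>x. c * x) -` A b) = emeasure lborel (A b)" for b
      using nn_integral_real_affine[of "indicator (A b)" c 0] c A[of b] sc[of b]
      by (simp add: nn_integral_indicator[symmetric] indicator_vimage del: nn_integral_indicator)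
    ultimately have "emeasure (density (distr gvol gvol ?h) (\<lambda>_. ennreal (c ^ CARD('y)))) (Pi\<^sub>E UNIV A) = (\<Prod>b\<in>UNIV. emeasure lborel (A b))"
      using c AM prod.distrib[of "\<lambda>_. ennreal c" "\<lambda>b. emeasure lborel ((\<lambda>x. c * x) -` A b)" "UNIV :: 'y set"]
      by (subst emeasure_density_const) (simp_all add: ennreal_power)
    then show "emeasure (density (distr (Pi\<^sub>M UNIV (\<lambda>_. lborel)) (Pi\<^sub>M UNIV (\<lambda>_. lborel)) ?h) (\<lambda>_. ennreal (c ^ CARD('y)))) (Pi\<^sub>E UNIV A) = (\<Prod>b\<in>UNIV. emeasure lborel (A b))"
      by (simp add: gvol_def)
  qed auto
  then have "(\<integral>\<^sup>+g. f g \<partial>gvol) = (\<integral>\<^sup>+g. f g \<partial>density (distr gvol gvol ?h) (\<lambda>_. ennreal (c ^ CARD('y))))"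
    by simp
  also have "\<dots> = ennreal (c ^ CARD('y)) * (\<integral>\<^sup>+g. f (?h g) \<partial>gvol)"
    by (simp add: nn_integral_density nn_integral_cmult nn_integral_distr)
  finally show ?thesis .
qed

text \<open>Degree \<open>p\<close> occurs for |g y - q * coord_sum g| powr p, degree 0 for
  functions of the proportions alone.\<close>

definition homogeneous :: "real \<Rightarrow> (('y::finite \<Rightarrow> real) \<Rightarrow> ennreal) \<Rightarrow> bool" where
  "homogeneous h F \<longleftrightarrow> (\<forall>c>0. \<forall>g. F (\<lambda>b. c * g b) = ennreal (c powr h) * F g)"

text \<open>An exponential tilt of gamma densities is a dilation, by the substitution of (1 + c) *
  g. The exponent collects the powers \<open>a b\<close> and one per coordinate from the Jacobian,
  together \<open>shape_sum a\<close>, and the degree \<open>h\<close> of \<open>F\<close>.\<close>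

lemma nn_integral_edens_exp:
  fixes F :: "('y::finite \<Rightarrow> real) \<Rightarrow> ennreal"
  assumes [measurable]: "F \<in> borel_measurable gvol" and F: "homogeneous h F" and c: "c \<ge> 0"
  shows "(\<integral>\<^sup>+g. ennreal (edens a g * exp (- c * coord_sum g)) * F g \<partial>gvol) =
    ennreal ((1 + c) powr (- (shape_sum a + h))) * (\<integral>\<^sup>+g. ennreal (edens a g) * F g \<partial>gvol)"
proof -
  define s where "s = 1 + c"
  have s: "s > 0" using c by (simp add: s_def)
  define E where "E = s powr (shape_sum a + h)"
  have E: "E > 0" using s by (simp add: E_def)
  have ed: "edens a (\<lambda>b. s * g b) = s powr (\<Sum>b\<in>UNIV. real (a b)) * (edens a g * exp (- c * coord_sum g))" for g
  proof -
    have "erlang_density (a b) 1 (s * g b) = s powr real (a b) * (erlang_density (a b) 1 (g b) * exp (- c * g b))" for b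
    proof -
      have "- (s * g b) = - g b + - c * g b" by (simp add: s_def algebra_simps)
      then have "exp (- (s * g b)) = exp (- g b) * exp (- c * g b)" by (simp only: exp_add)
      then show ?thesis
        using s by (simp add: erlang_density_def mult_less_0_iff power_mult_distrib powr_realpow)
    qed
    moreover have "exp (- c * coord_sum g) = (\<Prod>b\<in>UNIV. exp (- c * g b))"
      by (simp add: coord_sum_def exp_sum[symmetric] sum_distrib_left sum_negf)
    ultimately show ?thesis
      using s by (simp add: edens_def prod.distrib powr_sum)
  qed
  have "(\<integral>\<^sup>+g. ennreal (edens a g) * F g \<partial>gvol) = ennreal (s ^ CARD('y)) *
      (\<integral>\<^sup>+g. ennreal (edens a (\<lambda>b. s * g b)) * F (\<lambda>b. s * g b) \<partial>gvol)"
    using s by (rule nn_integral_gvol_scale) measurable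
  also have "(\<integral>\<^sup>+g. ennreal (edens a (\<lambda>b. s * g b)) * F (\<lambda>b. s * g b) \<partial>gvol) =
      (\<integral>\<^sup>+g. ennreal (s powr (\<Sum>b\<in>UNIV. real (a b)) * s powr h) * (ennreal (edens a g * exp (- c * coord_sum g)) * F g) \<partial>gvol)"
    using F s by (intro nn_integral_cong) (simp add: ed homogeneous_def ennreal_mult edens_nonneg mult_ac)
  also have "\<dots> = ennreal (s powr (\<Sum>b\<in>UNIV. real (a b)) * s powr h) * (\<integral>\<^sup>+g. ennreal (edens a g * exp (- c * coord_sum g)) * F g \<partial>gvol)"
    by (rule nn_integral_cmult) measurable
  also have "ennreal (s ^ CARD('y)) * (ennreal (s powr (\<Sum>b\<in>UNIV. real (a b)) * s powr h) * (\<integral>\<^sup>+g. ennreal (edens a g * exp (- c * coord_sum g)) * F g \<partial>gvol))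
     = ennreal E * (\<integral>\<^sup>+g. ennreal (edens a g * exp (- c * coord_sum g)) * F g \<partial>gvol)"
    using s by (simp add: E_def shape_sum_def sum.distrib powr_add powr_realpow ennreal_mult mult_ac)
  finally have "ennreal (inverse E) * (\<integral>\<^sup>+g. ennreal (edens a g) * F g \<partial>gvol) =
     (ennreal (inverse E) * ennreal E) * (\<integral>\<^sup>+g. ennreal (edens a g * exp (- c * coord_sum g)) * F g \<partial>gvol)"
    by (simp add: mult_ac)
  also have "ennreal (inverse E) * ennreal E = 1"
    using E by (simp add: ennreal_mult[symmetric])
  finally show ?thesis by (simp only: E_def powr_minus s_def mult_1)
qed

lemma nn_integral_Gamma_scaled:
  assumes s: "s > 0" and S: "S > 0"
  shows "(\<integral>\<^sup>+c. ennreal (c powr (s - 1) * exp (- c * S)) * indicator {0<..} c \<partial>lborel) = ennreal (Gamma s * S powr (-s))"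
proof -
  have "(\<integral>\<^sup>+c. ennreal (c powr (s - 1) / exp c) * indicator {0<..} c \<partial>lborel) =
      (\<integral>\<^sup>+c. ennreal (c powr (s - 1) / exp c) * indicator {0..} c \<partial>lborel)"
    by (rule nn_integral_cong_AE) (use AE_lborel_singleton[of 0] in eventually_elim, auto simp: indicator_def)
  also have "\<dots> = ennreal (Gamma s)"
    using Gamma_integral_real[OF s] by (intro nn_integral_has_integral_lebesgue') auto
  also have "(\<integral>\<^sup>+c. ennreal (c powr (s - 1) / exp c) * indicator {0<..} c \<partial>lborel) =
     ennreal S * (\<integral>\<^sup>+c. ennreal ((S * c) powr (s - 1) / exp (S * c)) * indicator {0<..} (S * c) \<partial>lborel)"
    using nn_integral_real_affine[of "\<lambda>c. ennreal (c powr (s - 1) / exp c) * indicator {0<..} c" S 0] S by simp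
  also have "(\<integral>\<^sup>+c. ennreal ((S * c) powr (s - 1) / exp (S * c)) * indicator {0<..} (S * c) \<partial>lborel) =
      (\<integral>\<^sup>+c. ennreal (S powr (s - 1)) * (ennreal (c powr (s - 1) * exp (- c * S)) * indicator {0<..} c) \<partial>lborel)"
    using S by (intro nn_integral_cong)
      (simp add: indicator_def powr_mult exp_minus field_simps zero_less_mult_iff ennreal_mult[symmetric])
  also have "\<dots> = ennreal (S powr (s - 1)) * (\<integral>\<^sup>+c. ennreal (c powr (s - 1) * exp (- c * S)) * indicator {0<..} c \<partial>lborel)"
    by (rule nn_integral_cmult) measurable
  finally have *: "ennreal (Gamma s) = ennreal S * (ennreal (S powr (s - 1)) *
      (\<integral>\<^sup>+c. ennreal (c powr (s - 1) * exp (- c * S)) * indicator {0<..} c \<partial>lborel))" by simp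
  have "ennreal (Gamma s * S powr (-s)) = ennreal (S powr (-s)) * ennreal (Gamma s)"
    using s by (simp add: ennreal_mult[symmetric] mult.commute)
  also have "\<dots> = (ennreal (S powr (-s)) * (ennreal S * ennreal (S powr (s - 1)))) *
      (\<integral>\<^sup>+c. ennreal (c powr (s - 1) * exp (- c * S)) * indicator {0<..} c \<partial>lborel)"
    unfolding * by (simp add: mult_ac)
  also have "ennreal (S powr (-s)) * (ennreal S * ennreal (S powr (s - 1))) = 1"
    using S by (simp add: ennreal_mult[symmetric] powr_mult_base powr_add[symmetric])
  finally show ?thesis by simp
qed

text \<open>For 0 < s < E this is the Beta function at s and E - s, written with the beta prime
  density. It serves both as a quantity bounded from below and as part of an unspecified
  constant.\<close>

definition beta_prime :: "real \<Rightarrow> real \<Rightarrow> ennreal" where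
  "beta_prime s E = (\<integral>\<^sup>+c. ennreal (c powr (s - 1) * (1 + c) powr (-E)) * indicator {0<..} c \<partial>lborel)"

text \<open>From ln (1 + c) <= c, that is (1 + c) powr (-E) >= exp (- c * E), and the Gamma
  integral. For large \<open>E\<close> the bound is asymptotically exact, so nothing is lost to
  first order.\<close>

lemma beta_prime_ge:
  assumes "s > 0" "E > 0"
  shows "beta_prime s E \<ge> ennreal (Gamma s * E powr (-s))"
  unfolding beta_prime_def nn_integral_Gamma_scaled[OF assms, symmetric]
proof (intro nn_integral_mono)
  fix c :: real
  have "exp (- c * E) \<le> (1 + c) powr (-E)" if "c > 0"
    using that assms ln_add_one_self_le_self[of c] by (simp add: powr_def mult.commute)
  then show "ennreal (c powr (s - 1) * exp (- c * E)) * indicator {0<..} c \<le>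
      ennreal (c powr (s - 1) * (1 + c) powr (-E)) * indicator {0<..} c"
    by (auto simp: indicator_def intro!: ennreal_leI mult_left_mono)
qed

text \<open>Writing a negative power of the sum as a Laplace transform turns it into a rescaling; this
  replaces the independence of the sum and the Dirichlet-distributed proportions.\<close>

lemma nn_integral_edens_coord_sum_powr:
  fixes F :: "('y::finite \<Rightarrow> real) \<Rightarrow> ennreal"
  assumes [measurable]: "F \<in> borel_measurable gvol" and F: "homogeneous h F" and s: "s > 0"
    and a: "\<And>b. a b \<ge> 1"
  shows "ennreal (Gamma s) * (\<integral>\<^sup>+g. ennreal (edens a g) * (ennreal (coord_sum g powr (-s)) * F g) \<partial>gvol) =
    beta_prime s (shape_sum a + h) * (\<integral>\<^sup>+g. ennreal (edens a g) * F g \<partial>gvol)"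
proof -
  interpret G: sigma_finite_measure "gvol :: ('y \<Rightarrow> real) measure" by (rule sigma_finite_gvol)
  interpret pair_sigma_finite "gvol :: ('y \<Rightarrow> real) measure" "lborel :: real measure" ..
  let ?J = "\<lambda>c g. ennreal (c powr (s - 1) * exp (- c * coord_sum g)) * indicator {0<..} c * (ennreal (edens a g) * F g)"
  have tot: "coord_sum g > 0" if "edens a g \<noteq> 0" for g
  proof -
    have "g b > 0" for b using edens_zero[of a g b] a that by force
    then show ?thesis unfolding coord_sum_def by (intro sum_pos) auto
  qed
  have "ennreal (Gamma s) * (\<integral>\<^sup>+g. ennreal (edens a g) * (ennreal (coord_sum g powr (-s)) * F g) \<partial>gvol) =
     (\<integral>\<^sup>+g. ennreal (Gamma s) * (ennreal (edens a g) * (ennreal (coord_sum g powr (-s)) * F g)) \<partial>gvol)"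
    by (rule nn_integral_cmult[symmetric]) measurable
  also have "\<dots> = (\<integral>\<^sup>+g. (\<integral>\<^sup>+c. ?J c g \<partial>lborel) \<partial>gvol)"
  proof (intro nn_integral_cong)
    fix g :: "'y \<Rightarrow> real"
    show "ennreal (Gamma s) * (ennreal (edens a g) * (ennreal (coord_sum g powr (-s)) * F g)) = (\<integral>\<^sup>+c. ?J c g \<partial>lborel)"
    proof (cases "edens a g = 0")
      case False
      have "(\<integral>\<^sup>+c. ?J c g \<partial>lborel) = (\<integral>\<^sup>+c. ennreal (c powr (s - 1) * exp (- c * coord_sum g)) * indicator {0<..} c \<partial>lborel) * (ennreal (edens a g) * F g)"
        by (rule nn_integral_multc) measurable
      also have "\<dots> = ennreal (Gamma s * coord_sum g powr (-s)) * (ennreal (edens a g) * F g)"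
        unfolding nn_integral_Gamma_scaled[OF s tot[OF False]] ..
      finally show ?thesis using s by (simp add: ennreal_mult mult_ac)
    qed simp
  qed
  also have "\<dots> = (\<integral>\<^sup>+c. (\<integral>\<^sup>+g. ?J c g \<partial>gvol) \<partial>lborel)"
    by (rule Fubini'[symmetric]) measurable
  also have "\<dots> = (\<integral>\<^sup>+c. (ennreal (c powr (s - 1) * (1 + c) powr (-(shape_sum a + h))) * indicator {0<..} c) * (\<integral>\<^sup>+g. ennreal (edens a g) * F g \<partial>gvol) \<partial>lborel)"
  proof (intro nn_integral_cong)
    fix c :: real
    show "(\<integral>\<^sup>+g. ?J c g \<partial>gvol) = (ennreal (c powr (s - 1) * (1 + c) powr (-(shape_sum a + h))) * indicator {0<..} c) * (\<integral>\<^sup>+g. ennreal (edens a g) * F g \<partial>gvol)"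
    proof (cases "c > 0")
      case True
      have "(\<integral>\<^sup>+g. ?J c g \<partial>gvol) = (\<integral>\<^sup>+g. ennreal (c powr (s - 1)) * (ennreal (edens a g * exp (- c * coord_sum g)) * F g) \<partial>gvol)"
        using True by (intro nn_integral_cong) (simp add: ennreal_mult edens_nonneg mult_ac)
      also have "\<dots> = ennreal (c powr (s - 1)) * (\<integral>\<^sup>+g. ennreal (edens a g * exp (- c * coord_sum g)) * F g \<partial>gvol)"
        by (rule nn_integral_cmult) measurable
      finally show ?thesis
        using True F by (subst (asm) nn_integral_edens_exp[where h=h]) (simp_all add: ennreal_mult mult_ac)
    qed simp
  qed
  also have "\<dots> = beta_prime s (shape_sum a + h) * (\<integral>\<^sup>+g. ennreal (edens a g) * F g \<partial>gvol)"
    unfolding beta_prime_def by (rule nn_integral_multc) measurable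
  finally show ?thesis .
qed

text \<open>Replaces the ratio by the linear form \<open>g y - q * coord_sum g\<close>, a sum of
  independent variables with an explicit characteristic function. The \<open>p\<close> added to
  \<open>shape_sum a\<close> is the degree of homogeneity of the integrand.\<close>

lemma nn_integral_edens_ratio_ge:
  fixes a :: "'y::finite \<Rightarrow> nat"
  assumes p: "p > 0" and a: "\<And>b. a b \<ge> 1"
  shows "ennreal ((shape_sum a + p) powr (-p)) * (\<integral>\<^sup>+g. ennreal (edens a g * \<bar>g y - q * coord_sum g\<bar> powr p) \<partial>gvol)
    \<le> (\<integral>\<^sup>+g. ennreal (edens a g * \<bar>g y / coord_sum g - q\<bar> powr p) \<partial>gvol)"
proof -
  let ?F = "\<lambda>g. ennreal (\<bar>g y - q * coord_sum g\<bar> powr p)"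
  have hom: "homogeneous p ?F"
    unfolding homogeneous_def coord_sum_def
  proof (intro allI impI)
    fix c :: real and g :: "'y \<Rightarrow> real" assume c: "c > 0"
    have "c * g y - q * (\<Sum>b\<in>UNIV. c * g b) = c * (g y - q * (\<Sum>b\<in>UNIV. g b))"
      by (simp add: sum_distrib_left[symmetric] algebra_simps)
    then show "ennreal (\<bar>c * g y - q * (\<Sum>b\<in>UNIV. c * g b)\<bar> powr p) = ennreal (c powr p) * ennreal (\<bar>g y - q * (\<Sum>b\<in>UNIV. g b)\<bar> powr p)"
      using c by (simp add: abs_mult powr_mult ennreal_mult)
  qed
  note measurable_gvol_component[measurable]
  have D: "shape_sum a > 0" unfolding shape_sum_def by (intro sum_pos) auto
  have "ennreal (Gamma p) * (ennreal ((shape_sum a + p) powr (-p)) * (\<integral>\<^sup>+g. ennreal (edens a g * \<bar>g y - q * coord_sum g\<bar> powr p) \<partial>gvol))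
    \<le> beta_prime p (shape_sum a + p) * (\<integral>\<^sup>+g. ennreal (edens a g) * ?F g \<partial>gvol)"
    unfolding mult.assoc[symmetric] using beta_prime_ge[of p "shape_sum a + p"] p D
    by (intro mult_mono) (auto simp: ennreal_mult edens_nonneg)
  also have "\<dots> = ennreal (Gamma p) * (\<integral>\<^sup>+g. ennreal (edens a g) * (ennreal (coord_sum g powr (-p)) * ?F g) \<partial>gvol)"
    by (rule nn_integral_edens_coord_sum_powr[symmetric]) (use hom p a in auto)
  also have "(\<integral>\<^sup>+g. ennreal (edens a g) * (ennreal (coord_sum g powr (-p)) * ?F g) \<partial>gvol) =
     (\<integral>\<^sup>+g. ennreal (edens a g * \<bar>g y / coord_sum g - q\<bar> powr p) \<partial>gvol)"
  proof (intro nn_integral_cong)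
    fix g :: "'y \<Rightarrow> real"
    show "ennreal (edens a g) * (ennreal (coord_sum g powr (-p)) * ?F g) = ennreal (edens a g * \<bar>g y / coord_sum g - q\<bar> powr p)"
    proof (cases "edens a g = 0")
      case False
      have "g b > 0" for b using edens_zero[of a g b] a False by force
      then have t: "coord_sum g > 0" unfolding coord_sum_def by (intro sum_pos) auto
      then have "\<bar>g y / coord_sum g - q\<bar> = \<bar>g y - q * coord_sum g\<bar> * inverse (coord_sum g)"
        by (simp add: field_simps abs_mult)
      then show ?thesis using t by (simp add: ennreal_mult[symmetric] edens_nonneg powr_mult powr_minus inverse_powr mult_ac)
    qed simp
  qed
  finally show ?thesis
    using Gamma_real_pos[OF p] by (subst (asm) ennreal_mult_le_mult_iff) (auto simp: ennreal_eq_0_iff not_le)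
qed

text \<open>Conjugacy of the Dirichlet prior: the monomials raise the shapes, and the remaining
  power of \<open>coord_sum\<close> acts on functions of degree 0 as a constant. The constant is the
  same for all \<open>F\<close>, which allows posterior losses to be compared with the marginal
  likelihood.\<close>

lemma nn_integral_edens_posterior:
  fixes a N :: "'y::finite \<Rightarrow> nat"
  assumes a: "\<And>b. a b \<ge> 1"
  obtains \<zeta> :: ennreal where "\<And>F. F \<in> borel_measurable gvol \<Longrightarrow> homogeneous 0 F \<Longrightarrow>
    (\<integral>\<^sup>+g. ennreal (edens a g * (\<Prod>b\<in>UNIV. (g b / coord_sum g) ^ N b)) * F g \<partial>gvol) =
    \<zeta> * (\<integral>\<^sup>+g. ennreal (edens (\<lambda>b. a b + N b) g) * F g \<partial>gvol)"
proof -
  define T where "T = (\<Sum>b\<in>UNIV. N b)"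
  define a' where "a' = (\<lambda>b. a b + N b)"
  define c where "c = (\<Prod>b\<in>UNIV. fact (a b + N b) / fact (a b) :: real)"
  have c: "c \<ge> 0" unfolding c_def by (intro prod_nonneg) auto
  have a': "a' b \<ge> 1" for b using a[of b] by (simp add: a'_def)
  have ed: "edens a g * (\<Prod>b\<in>UNIV. (g b / coord_sum g) ^ N b) = c * (edens a' g * coord_sum g powr (- real T))" for g
  proof (cases "\<forall>b. g b > 0")
    case True
    then have t: "coord_sum g > 0" unfolding coord_sum_def by (intro sum_pos) auto
    have "(\<Prod>b\<in>UNIV. (g b / coord_sum g) ^ N b) = (\<Prod>b\<in>UNIV. g b ^ N b) * coord_sum g powr (- real T)"
      using t by (simp add: power_divide prod_dividef powr_minus_divide powr_realpow T_def power_sum[symmetric] del: of_nat_sum)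
    moreover have "edens a g * (\<Prod>b\<in>UNIV. g b ^ N b) = c * edens a' g"
      unfolding edens_def c_def a'_def prod.distrib[symmetric]
      using True by (intro prod.cong) (auto simp: erlang_density_def power_add)
    ultimately show ?thesis by (metis mult.assoc)
  next
    case False
    then obtain b where "g b \<le> 0" by (auto simp: not_less)
    then show ?thesis using edens_zero[of a g b] edens_zero[of a' g b] a a' by simp
  qed
  show ?thesis
  proof (cases "T = 0")
    \<comment> \<open>Without observations there is no power of the sum to remove, and the Laplace
      representation with exponent 0 would diverge.\<close>
    case True
    then have "N = (\<lambda>_. 0)" by (auto simp: T_def)
    then show ?thesis by (intro that[of 1]) simp
  next
    case False
    then have G: "Gamma (real T) > 0" by (intro Gamma_real_pos) auto
    show ?thesis
    proof (rule that[of "ennreal (c / Gamma (real T)) * beta_prime (real T) (shape_sum a')"])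
      fix F :: "('y \<Rightarrow> real) \<Rightarrow> ennreal" assume [measurable]: "F \<in> borel_measurable gvol" and F: "homogeneous 0 F"
      let ?I = "\<integral>\<^sup>+g. ennreal (edens a' g) * (ennreal (coord_sum g powr (- real T)) * F g) \<partial>gvol"
      have "(\<integral>\<^sup>+g. ennreal (edens a g * (\<Prod>b\<in>UNIV. (g b / coord_sum g) ^ N b)) * F g \<partial>gvol) =
         (\<integral>\<^sup>+g. ennreal c * (ennreal (edens a' g) * (ennreal (coord_sum g powr (- real T)) * F g)) \<partial>gvol)"
        using c by (intro nn_integral_cong) (simp add: ed ennreal_mult edens_nonneg mult_ac)
      also have "\<dots> = ennreal c * ?I"
        by (rule nn_integral_cmult) measurable
      also have "ennreal c = ennreal (c / Gamma (real T)) * ennreal (Gamma (real T))"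
        using G c by (simp add: ennreal_mult[symmetric])
      also have "\<dots> * ?I = ennreal (c / Gamma (real T)) * (ennreal (Gamma (real T)) * ?I)"
        by (simp add: mult_ac)
      also have "ennreal (Gamma (real T)) * ?I = beta_prime (real T) (shape_sum a' + 0) * (\<integral>\<^sup>+g. ennreal (edens a' g) * F g \<partial>gvol)"
        by (rule nn_integral_edens_coord_sum_powr) (use F a' False in auto)
      finally show "(\<integral>\<^sup>+g. ennreal (edens a g * (\<Prod>b\<in>UNIV. (g b / coord_sum g) ^ N b)) * F g \<partial>gvol) =
        ennreal (c / Gamma (real T)) * beta_prime (real T) (shape_sum a') * (\<integral>\<^sup>+g. ennreal (edens (\<lambda>b. a b + N b) g) * F g \<partial>gvol)"
        by (simp add: a'_def mult_ac)
    qed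
  qed
qed

section \<open>Characteristic functions of gamma variables\<close>

primrec erlang_antideriv :: "complex \<Rightarrow> nat \<Rightarrow> real \<Rightarrow> complex" where
  "erlang_antideriv z 0 x = - exp (- (z * of_real x)) / z"
| "erlang_antideriv z (Suc k) x =
    (erlang_antideriv z k x - of_real (x ^ Suc k / fact (Suc k)) * exp (- (z * of_real x))) / z"

text \<open>The recursion is integration by parts, once for each power of \<open>x\<close>: the
  derivative of the boundary term is the integrand for \<open>k\<close> minus \<open>z\<close> times
  the one for \<open>Suc k\<close>.\<close>

lemma erlang_antideriv_deriv:
  assumes "z \<noteq> 0"
  shows "(erlang_antideriv z k has_vector_derivative of_real (x ^ k / fact k) * exp (- (z * of_real x))) (at x)"
proof (induction k)
  case 0
  have "((\<lambda>w. - exp (- (z * w)) / z) has_field_derivative exp (- (z * of_real x))) (at (of_real x))"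
    using assms by (auto intro!: derivative_eq_intros)
  from has_vector_derivative_real_field[OF this] show ?case by simp
next
  case (Suc k)
  have "((\<lambda>w. w ^ Suc k / fact (Suc k)) has_field_derivative of_nat (Suc k) * of_real x ^ k / fact (Suc k)) (at (complex_of_real x))"
  proof (rule DERIV_cdivide)
    show "((\<lambda>w. w ^ Suc k) has_field_derivative of_nat (Suc k) * of_real x ^ k) (at (complex_of_real x))"
      using DERIV_power[OF DERIV_ident, where n="Suc k"] by simp
  qed
  also have "of_nat (Suc k) * of_real x ^ k / fact (Suc k) = complex_of_real x ^ k / fact k"
    by (simp del: of_nat_Suc)
  finally have P: "((\<lambda>w. w ^ Suc k / fact (Suc k)) has_field_derivative of_real x ^ k / fact k) (at (complex_of_real x))" .
  have Q: "((\<lambda>w. exp (- (z * w))) has_field_derivative - z * exp (- (z * of_real x))) (at (complex_of_real x))"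
    by (auto intro!: derivative_eq_intros)
  have "((\<lambda>w. w ^ Suc k / fact (Suc k) * exp (- (z * w))) has_field_derivative
      (of_real x ^ k / fact k) * exp (- (z * of_real x)) - z * (of_real x ^ Suc k / fact (Suc k) * exp (- (z * of_real x)))) (at (of_real x))"
    using DERIV_mult[OF P Q] by (simp add: algebra_simps del: fact_Suc)
  from has_vector_derivative_real_field[OF this]
  have D: "((\<lambda>x. of_real (x ^ Suc k / fact (Suc k)) * exp (- (z * of_real x))) has_vector_derivative
      (of_real x ^ k / fact k) * exp (- (z * of_real x)) - z * (of_real x ^ Suc k / fact (Suc k) * exp (- (z * of_real x)))) (at x)"
    by (simp del: fact_Suc)
  have "((\<lambda>x. (erlang_antideriv z k x - of_real (x ^ Suc k / fact (Suc k)) * exp (- (z * of_real x))) / z) has_vector_derivative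
     (of_real (x ^ k / fact k) * exp (- (z * of_real x)) - ((of_real x ^ k / fact k) * exp (- (z * of_real x)) - z * (of_real x ^ Suc k / fact (Suc k) * exp (- (z * of_real x))))) / z) (at x)"
    by (intro has_vector_derivative_divide has_vector_derivative_diff Suc D)
  then show ?case using assms by (simp del: fact_Suc)
qed

lemma tendsto_power_exp_at_top:
  assumes "Re z = 1"
  shows "((\<lambda>x. of_real (x ^ k / fact k) * exp (- (z * of_real x))) \<longlongrightarrow> 0) at_top"
proof -
  have lim: "((\<lambda>x::real. x ^ k / exp x / fact k) \<longlongrightarrow> 0) at_top"
    by (intro tendsto_divide_zero tendsto_power_div_exp_0)
  have "((\<lambda>x. norm (of_real (x ^ k / fact k) * exp (- (z * of_real x)))) \<longlongrightarrow> 0) at_top"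
  proof (rule Lim_transform_eventually[OF lim])
    show "\<forall>\<^sub>F x in at_top. x ^ k / exp x / fact k = norm (of_real (x ^ k / fact k) * exp (- (z * of_real x)))"
      using eventually_ge_at_top[of 0]
      by eventually_elim (use assms in \<open>simp add: norm_mult exp_minus norm_divide norm_power field_simps\<close>)
  qed
  then show ?thesis by (rule tendsto_norm_zero_cancel)
qed

lemma erlang_antideriv_at_top:
  assumes "Re z = 1"
  shows "(erlang_antideriv z k \<longlongrightarrow> 0) at_top"
proof (induction k)
  case 0
  then show ?case using tendsto_divide_zero[OF tendsto_power_exp_at_top[OF assms, of 0], of "- z"] by simp
next
  case (Suc k)
  have "((\<lambda>x. (erlang_antideriv z k x - of_real (x ^ Suc k / fact (Suc k)) * exp (- (z * of_real x))) / z) \<longlongrightarrow> 0) at_top"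
    using tendsto_diff[OF Suc tendsto_power_exp_at_top[OF assms, of "Suc k"]] by (intro tendsto_divide_zero) (simp del: fact_Suc)
  then show ?case by simp
qed

lemma erlang_antideriv_0: "z \<noteq> 0 \<Longrightarrow> erlang_antideriv z k 0 = - (1 / z ^ Suc k)"
  by (induction k) auto

lemma integrable_erlang_density: "integrable lborel (erlang_density k 1)"
  using nn_integral_erlang_ith_moment[of 1 k 0] by (intro integrableI_nonneg) auto

text \<open>With \<open>z\<close> = 1 - i u the integrand is the derivative of
  \<open>erlang_antideriv\<close>, which tends to 0 at infinity because the real part of
  \<open>z\<close> is 1, and equals -1 / z ^ Suc k at 0.\<close>

lemma char_erlang:
  "(CLINT x|lborel. erlang_density k 1 x *\<^sub>R iexp (u * x)) = 1 / (1 - \<i> * of_real u) ^ Suc k"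
proof -
  define z where "z = 1 - \<i> * of_real u"
  have z: "Re z = 1" "z \<noteq> 0" by (auto simp: z_def complex_eq_iff)
  have eq: "erlang_density k 1 x *\<^sub>R iexp (u * x) = of_real (x ^ k / fact k) * exp (- (z * of_real x))" if "x \<ge> 0" for x
  proof -
    have "- (z * of_real x) = of_real (- x) + \<i> * of_real (u * x)" by (simp add: z_def algebra_simps)
    then have "exp (- (z * of_real x)) = of_real (exp (- x)) * iexp (u * x)"
      by (simp only: exp_add exp_of_real)
    then show ?thesis using that by (simp add: erlang_density_def scaleR_conv_of_real)
  qed
  have int: "integrable lborel (\<lambda>x. erlang_density k 1 x *\<^sub>R iexp (u * x))"
    by (rule Bochner_Integration.integrable_bound[OF integrable_erlang_density[of k]]) auto
  have "(CLINT x|lborel. erlang_density k 1 x *\<^sub>R iexp (u * x)) =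
     (CLBINT x:{0<..}. erlang_density k 1 x *\<^sub>R iexp (u * x))"
    unfolding set_lebesgue_integral_def
    by (rule integral_cong_AE) (use AE_lborel_singleton[of 0] in \<open>auto elim!: eventually_mono simp: indicator_def erlang_density_def\<close>)
  also have "\<dots> = (CLBINT x:{0<..}. of_real (x ^ k / fact k) * exp (- (z * of_real x)))"
    by (intro set_lebesgue_integral_cong allI impI eq) auto
  also have "\<dots> = (CLBINT x=0..\<infinity>. of_real (x ^ k / fact k) * exp (- (z * of_real x)))"
    by (simp add: interval_integral_to_infinity_eq zero_ereal_def)
  also have "\<dots> = 0 - erlang_antideriv z k 0"
  proof (rule interval_integral_FTC_integrable)
    show "set_integrable lborel (einterval 0 \<infinity>) (\<lambda>x. of_real (x ^ k / fact k) * exp (- (z * of_real x)))"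
    proof -
      have "set_integrable lborel {0<..} (\<lambda>x. erlang_density k 1 x *\<^sub>R iexp (u * x))"
        using integrable_mult_indicator[OF _ int, of "{0<..}"] by (simp add: set_integrable_def)
      then have "set_integrable lborel {0<..} (\<lambda>x. of_real (x ^ k / fact k) * exp (- (z * of_real x)))"
        by (subst (asm) set_integrable_cong[OF refl refl eq]) auto
      then show ?thesis by (simp add: zero_ereal_def)
    qed
    have "isCont (erlang_antideriv z k) 0"
      using erlang_antideriv_deriv[OF z(2), of k 0] by (rule has_vector_derivative_continuous)
    then have "(erlang_antideriv z k \<longlongrightarrow> erlang_antideriv z k 0) (at_right 0)"
      unfolding isCont_def by (rule filterlim_mono) (auto intro: at_le)
    then show "((erlang_antideriv z k \<circ> real_of_ereal) \<longlongrightarrow> erlang_antideriv z k 0) (at_right 0)"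
      by (simp add: zero_ereal_def ereal_tendsto_simps)
    show "((erlang_antideriv z k \<circ> real_of_ereal) \<longlongrightarrow> 0) (at_left \<infinity>)"
      using erlang_antideriv_at_top[OF z(1)] by (simp add: ereal_tendsto_simps)
  qed (use erlang_antideriv_deriv[OF z(2)] in \<open>auto intro!: continuous_intros\<close>)
  also have "\<dots> = 1 / (1 - \<i> * of_real u) ^ Suc k"
    using erlang_antideriv_0[OF z(2), of k] by (simp add: z_def)
  finally show ?thesis .
qed

text \<open>Since |1 - i u|^2 = 1 + u^2 and ln (1 + u^2) >= u^2 - u^4, the modulus obeys the normal
  bound up to a factor 1 - u^2 in the exponent. Weakening this to 1 - t^2 gives all coordinates the
  same factor, so that their exponents can be added.\<close>

lemma norm_char_erlang_le:
  assumes t: "\<bar>u\<bar> \<le> t" "t \<le> 1"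
  shows "norm (CLINT x|lborel. erlang_density k 1 x *\<^sub>R iexp (u * x)) \<le> exp (- (real k + 1) * (u^2 * (1 - t^2)) / 2)"
proof -
  have u2: "u^2 \<le> t^2" using t by (simp add: abs_le_square_iff[symmetric])
  have t2: "t^2 \<le> 1" using t by (simp add: abs_square_le_1)
  have "norm (1 - \<i> * of_real u) = sqrt (1 + u^2)"
    by (simp add: cmod_def)
  also have "\<dots> = exp (ln (1 + u^2) / 2)"
  proof -
    have p: "1 + u^2 > 0" by (simp add: add_pos_nonneg)
    have "exp (ln (1 + u^2) / 2) = (1 + u^2) powr (1/2)" using p by (simp add: powr_def)
    then show ?thesis using p by (simp add: powr_half_sqrt)
  qed
  also have "\<dots> \<ge> exp (u^2 * (1 - t^2) / 2)"
  proof -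
    have "u^2 * (1 - t^2) \<le> u^2 * (1 - u^2)" using u2 by (intro mult_left_mono) auto
    also have "\<dots> = u^2 - (u^2)^2" by (simp add: power2_eq_square algebra_simps)
    also have "\<dots> \<le> ln (1 + u^2)" using u2 t2 by (intro ln_one_plus_pos_lower_bound) auto
    finally show ?thesis by simp
  qed
  finally have *: "exp (u^2 * (1 - t^2) / 2) \<le> norm (1 - \<i> * of_real u)" .
  have "norm (CLINT x|lborel. erlang_density k 1 x *\<^sub>R iexp (u * x)) = inverse (norm (1 - \<i> * of_real u) ^ Suc k)"
    unfolding char_erlang norm_divide norm_power by (simp add: divide_inverse)
  also have "\<dots> \<le> inverse (exp (u^2 * (1 - t^2) / 2) ^ Suc k)"
    using * by (intro le_imp_inverse_le power_mono) auto
  also have "\<dots> = exp (- (real k + 1) * (u^2 * (1 - t^2)) / 2)"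
  proof -
    have "inverse (exp (u^2 * (1 - t^2) / 2) ^ Suc k) = exp (- (real (Suc k) * (u^2 * (1 - t^2) / 2)))"
      by (simp only: exp_of_nat_mult exp_minus)
    also have "- (real (Suc k) * (u^2 * (1 - t^2) / 2)) = - (real k + 1) * (u^2 * (1 - t^2)) / 2"
      by (simp add: field_simps)
    finally show ?thesis .
  qed
  finally show ?thesis .
qed

text \<open>The minimum over \<open>q\<close> of the variance of \<open>g y - q * coord_sum g\<close>.\<close>

definition post_var :: "('y::finite \<Rightarrow> nat) \<Rightarrow> 'y \<Rightarrow> real" where
  "post_var a y = (real (a y) + 1) * (shape_sum a - (real (a y) + 1)) / shape_sum a"

lemma shape_sum_pos: "shape_sum a > 0"
  unfolding shape_sum_def by (intro sum_pos) auto

lemma shape_le_shape_sum: "real (a y) + 1 \<le> shape_sum a"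
  unfolding shape_sum_def by (rule member_le_sum) auto

lemma prob_space_edens: "prob_space (density gvol (\<lambda>g. ennreal (edens a g)))"
  using nn_integral_edens[of a] sets.top[of gvol]
  by (intro prob_spaceI, simp, subst emeasure_density) auto

text \<open>The linear form has coefficients 1 - q and -q, all at most 1 in modulus. Its
  characteristic function factors, and the exponents add up to its variance, which is at least
  \<open>post_var\<close> for every \<open>q\<close>. The modulus does not see the mean of the form,
  which is nonzero for most \<open>q\<close>.\<close>

lemma norm_char_edens_le:
  fixes a :: "'y::finite \<Rightarrow> nat"
  assumes q: "0 \<le> q" "q \<le> 1" and t: "0 \<le> t" "t \<le> 1"
  shows "norm (CLINT g|density gvol (\<lambda>g. ennreal (edens a g)). iexp (t * (g y - q * coord_sum g)))
    \<le> exp (- (post_var a y * (1 - t^2)) * t^2 / 2)"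
proof -
  interpret product_sigma_finite "\<lambda>_. lborel :: real measure" ..
  note measurable_gvol_component[measurable]
  define c where "c b = (if b = y then 1 - q else - q)" for b
  have lin: "g y - q * coord_sum g = (\<Sum>b\<in>UNIV. c b * g b)" for g
  proof -
    have "(\<Sum>b\<in>UNIV. c b * g b) = (\<Sum>b\<in>UNIV. (if b = y then g b else 0) - q * g b)"
      by (intro sum.cong) (auto simp: c_def algebra_simps)
    then show ?thesis by (simp add: sum_subtractf coord_sum_def sum_distrib_left)
  qed
  have "(CLINT g|density gvol (\<lambda>g. ennreal (edens a g)). iexp (t * (g y - q * coord_sum g))) =
      (CLINT g|gvol. edens a g *\<^sub>R iexp (t * (g y - q * coord_sum g)))"
    by (rule integral_density) (auto simp: edens_nonneg)
  also have "\<dots> = (CLINT g|gvol. (\<Prod>b\<in>UNIV. erlang_density (a b) 1 (g b) *\<^sub>R iexp ((t * c b) * g b)))"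
  proof (intro Bochner_Integration.integral_cong refl)
    fix g :: "'y \<Rightarrow> real"
    have "iexp (t * (g y - q * coord_sum g)) = (\<Prod>b\<in>UNIV. iexp ((t * c b) * g b))"
      unfolding lin by (simp add: exp_sum[symmetric] sum_distrib_left mult_ac)
    then show "edens a g *\<^sub>R iexp (t * (g y - q * coord_sum g)) = (\<Prod>b\<in>UNIV. erlang_density (a b) 1 (g b) *\<^sub>R iexp ((t * c b) * g b))"
      by (simp add: edens_def scaleR_conv_of_real prod.distrib del: of_real_mult)
  qed
  also have "\<dots> = (\<Prod>b\<in>UNIV. CLINT x|lborel. erlang_density (a b) 1 x *\<^sub>R iexp ((t * c b) * x))"
    unfolding gvol_def
    by (rule product_integral_prod)
      (auto intro!: Bochner_Integration.integrable_bound[OF integrable_erlang_density])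
  also have "norm \<dots> \<le> (\<Prod>b\<in>UNIV. exp (- (real (a b) + 1) * ((t * c b)^2 * (1 - t^2)) / 2))"
    unfolding prod_norm[symmetric] using q t
    by (intro prod_mono conjI norm_char_erlang_le) (auto simp: c_def abs_mult mult_left_le)
  also have "\<dots> = exp (- ((\<Sum>b\<in>UNIV. (real (a b) + 1) * (c b)^2) * (1 - t^2)) * t^2 / 2)"
  proof -
    have "- (real (a b) + 1) * ((t * c b)^2 * (1 - t^2)) / 2 = (real (a b) + 1) * (c b)^2 * (- (1 - t^2) * t^2 / 2)" for b
      by (simp add: power_mult_distrib field_simps)
    then have "(\<Prod>b\<in>UNIV. exp (- (real (a b) + 1) * ((t * c b)^2 * (1 - t^2)) / 2)) =
        exp ((\<Sum>b\<in>UNIV. (real (a b) + 1) * (c b)^2) * (- (1 - t^2) * t^2 / 2))"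
      unfolding sum_distrib_right by (simp only: exp_sum[symmetric] finite)
    also have "(\<Sum>b\<in>UNIV. (real (a b) + 1) * (c b)^2) * (- (1 - t^2) * t^2 / 2) =
        - ((\<Sum>b\<in>UNIV. (real (a b) + 1) * (c b)^2) * (1 - t^2)) * t^2 / 2"
      by (simp only: mult_minus_left mult_minus_right mult.assoc minus_divide_left times_divide_eq_right)
    finally show ?thesis .
  qed
  also have "\<dots> \<le> exp (- (post_var a y * (1 - t^2)) * t^2 / 2)"
  proof -
    let ?A = "real (a y) + 1" and ?D = "shape_sum a"
    have "(\<Sum>b\<in>UNIV. (real (a b) + 1) * (c b)^2) = (\<Sum>b\<in>UNIV. (if b = y then ?A * ((1 - q)^2 - q^2) else 0) + (real (a b) + 1) * q^2)"
      by (intro sum.cong) (auto simp: c_def algebra_simps)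
    also have "\<dots> = ?A * ((1 - q)^2 - q^2) + ?D * q^2"
      by (subst sum.distrib) (simp add: shape_sum_def sum_distrib_right)
    finally have S: "(\<Sum>b\<in>UNIV. (real (a b) + 1) * (c b)^2) = ?A * ((1 - q)^2 - q^2) + ?D * q^2" .
    \<comment> \<open>Completing the square: the variance is quadratic in \<open>q\<close>, with its
      minimum at \<open>?A / ?D\<close>, the mean proportion of \<open>y\<close>.\<close>
    have "?D * (?A * ((1 - q)^2 - q^2) + ?D * q^2) - ?A * (?D - ?A) = (?A - q * ?D)^2" by algebra
    then have "?A * (?D - ?A) \<le> ?D * (?A * ((1 - q)^2 - q^2) + ?D * q^2)"
      using zero_le_power2[of "?A - q * ?D"] by linarith
    then have "post_var a y \<le> (\<Sum>b\<in>UNIV. (real (a b) + 1) * (c b)^2)"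
      unfolding post_var_def S using shape_sum_pos[of a] by (simp add: divide_le_eq mult.commute)
    moreover have "t^2 \<le> 1" using t by (simp add: abs_square_le_1)
    ultimately show ?thesis by (simp add: mult_right_mono)
  qed
  finally show ?thesis .
qed

text \<open>The modulus bound for gamma variables is sharp only for small \<open>t\<close>. By
  monotone convergence a bounded range already carries all but a fraction \<delta> of the Gaussian
  integral.\<close>

lemma truncated_gauss_const:
  assumes p: "0 < p" "p < 2" and \<delta>: "0 < \<delta>" "\<delta> < 1"
  obtains R :: nat where "ennreal (1 - \<delta>) * gauss_const p \<le>
    (\<integral>\<^sup>+t. ennreal (1 - exp (- (t^2) / 2)) * indicator {..real R} t \<partial>stable_levy p)"
proof -
  let ?f = "\<lambda>t. ennreal (1 - exp (- (t^2) / 2))"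
  have "(SUP i. ?f t * indicator {..real i} t) = ?f t" for t
  proof (rule antisym)
    obtain i where "t \<le> real i" using real_arch_simple by blast
    then show "?f t \<le> (SUP i. ?f t * indicator {..real i} t)"
      by (intro SUP_upper2[of i]) (auto simp: indicator_def)
  qed (auto intro!: SUP_least simp: indicator_def)
  then have "gauss_const p = (\<integral>\<^sup>+t. (SUP i. ?f t * indicator {..real i} t) \<partial>stable_levy p)"
    by (simp add: gauss_const_def)
  also have "\<dots> = (SUP i. \<integral>\<^sup>+t. ?f t * indicator {..real i} t \<partial>stable_levy p)"
    by (rule nn_integral_monotone_convergence_SUP) (auto simp: incseq_def le_fun_def indicator_def)
  finally have SUP: "gauss_const p = (SUP i. \<integral>\<^sup>+t. ?f t * indicator {..real i} t \<partial>stable_levy p)" .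
  obtain G where G: "gauss_const p = ennreal G" "G > 0"
    using gauss_const_finite[OF p] gauss_const_pos[of p] by (cases "gauss_const p") auto
  have "ennreal (1 - \<delta>) * gauss_const p < gauss_const p"
    using G \<delta> by (simp add: ennreal_mult[symmetric] ennreal_less_iff)
  then obtain i where "ennreal (1 - \<delta>) * gauss_const p < (\<integral>\<^sup>+t. ?f t * indicator {..real i} t \<partial>stable_levy p)"
    by (subst (asm) (2) SUP) (auto simp: less_SUP_iff)
  then show thesis using that[of i] by simp
qed

text \<open>Named so that one threshold, valid for all shapes, letters and centres at once, can be
  passed on as a hypothesis; the Bayes argument needs this uniformity.\<close>

definition moment_threshold :: "'y::finite itself \<Rightarrow> real \<Rightarrow> real \<Rightarrow> real \<Rightarrow> bool" where
  "moment_threshold _ p \<epsilon> v0 \<longleftrightarrow> (\<forall>(a :: 'y \<Rightarrow> nat) y q. 0 \<le> q \<longrightarrow> q \<le> 1 \<longrightarrow> v0 \<le> post_var a y \<longrightarrow>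
    ennreal ((1 - \<epsilon>) * gauss_moment p * post_var a y powr (p/2)) \<le>
    (\<integral>\<^sup>+g. ennreal (edens a g * \<bar>g y - q * coord_sum g\<bar> powr p) \<partial>gvol))"

text \<open>The real part of a characteristic function is at most its modulus, whatever the centre.
  For \<open>p < 2\<close>, rescaling by the standard deviation leaves only frequencies of order R /
  sqrt v, which are small once \<open>post_var\<close> is large. At \<open>p = 2\<close> a single
  frequency and 1 - cos x <= x^2 / 2 suffice.\<close>

lemma edens_abs_moment_ge:
  assumes p: "1 \<le> p" "p \<le> 2" and \<epsilon>: "0 < \<epsilon>" "\<epsilon> < 1"
  obtains v0 where "moment_threshold TYPE('y::finite) p \<epsilon> v0"
proof -
  note measurable_gvol_component[measurable]
  \<comment> \<open>Two factors 1 - \<delta> are lost in either case, and their product is at least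
    1 - \<epsilon>.\<close>
  define \<delta> where "\<delta> = \<epsilon> / 2"
  have \<delta>: "0 < \<delta>" "\<delta> < 1" and \<delta>2: "1 - \<epsilon> \<le> (1 - \<delta>)^2"
    using \<epsilon> by (auto simp: \<delta>_def power2_eq_square algebra_simps)
  let ?M = "\<lambda>a :: 'y \<Rightarrow> nat. density gvol (\<lambda>g. ennreal (edens a g))"
  have dens: "(\<integral>\<^sup>+g. ennreal (h g) \<partial>?M a) = (\<integral>\<^sup>+g. ennreal (edens a g * h g) \<partial>gvol)"
    if [measurable]: "h \<in> borel_measurable gvol" for a :: "'y \<Rightarrow> nat" and h
    by (subst nn_integral_density) (auto simp: ennreal_mult' edens_nonneg)
  have char: "1 - exp (- (post_var a y * (1 - t^2)) * t^2 / 2) \<le>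
      1 - Re (CLINT g|?M a. iexp (t * (g y - q * coord_sum g)))"
    if "0 \<le> q" "q \<le> 1" "0 \<le> t" "t \<le> 1" for a :: "'y \<Rightarrow> nat" and y q t
    using norm_char_edens_le[of q t a y] complex_Re_le_cmod[of "CLINT g|?M a. iexp (t * (g y - q * coord_sum g))"] that
    by linarith
  show thesis
  proof (cases "p = 2")
    case True
    show thesis
    proof (rule that[of 1], unfold moment_threshold_def, intro allI impI)
      fix a :: "'y \<Rightarrow> nat" and y q assume q: "0 \<le> (q::real)" "q \<le> 1" and v: "1 \<le> post_var a y"
      define v where "v = post_var a y"
      \<comment> \<open>Then v * t^2 = \<delta>, small enough for 1 - exp (-x) to be close to x,
        while t^2 <= \<delta> keeps the correction 1 - t^2 close to 1.\<close>
      define t where "t = sqrt (\<delta> / v)"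
      have v1: "v \<ge> 1" using v by (simp add: v_def)
      have t2: "t^2 = \<delta> / v" using \<delta> v1 by (simp add: t_def)
      have tle: "t^2 \<le> \<delta>" unfolding t2 using \<delta> v1 by (simp add: divide_le_eq)
      have t: "0 < t" "t \<le> 1"
        using \<delta> v1 by (auto simp: t_def divide_le_eq)
      define x where "x = (v * (1 - t^2)) * t^2 / 2"
      have x: "0 \<le> x" "x \<le> \<delta>"
      proof -
        have "x = \<delta> * (1 - t^2) / 2" using v1 by (simp add: x_def t2)
        moreover have "0 \<le> \<delta> * (1 - t^2)" "\<delta> * (1 - t^2) \<le> \<delta> * 1"
          using tle \<delta> by (auto intro!: mult_nonneg_nonneg mult_left_mono)
        ultimately show "0 \<le> x" "x \<le> \<delta>" using \<delta> by linarith+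
      qed
      let ?I = "\<integral>\<^sup>+g. ennreal (edens a g * \<bar>g y - q * coord_sum g\<bar> powr p) \<partial>gvol"
      have "ennreal (x * (1 - \<delta>)) \<le> ennreal (1 - exp (- x))"
      proof (rule ennreal_leI)
        have "x * (1 - \<delta>) \<le> x - x^2"
          using x mult_left_mono[of x \<delta> x] by (simp add: power2_eq_square algebra_simps)
        then show "x * (1 - \<delta>) \<le> 1 - exp (- x)"
          using exp_minus_le_quadratic[OF x(1)] by simp
      qed
      also have "\<dots> \<le> ennreal (1 - Re (CLINT g|?M a. iexp (t * (g y - q * coord_sum g))))"
        using char[of q t a y] q t by (intro ennreal_leI) (simp add: x_def v_def)
      also have "\<dots> = (\<integral>\<^sup>+g. ennreal (1 - cos (t * (g y - q * coord_sum g))) \<partial>?M a)"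
        by (rule nn_integral_one_minus_cos[symmetric, OF prob_space_edens]) measurable
      also have "\<dots> = (\<integral>\<^sup>+g. ennreal (edens a g * (1 - cos (t * (g y - q * coord_sum g)))) \<partial>gvol)"
        by (rule dens) measurable
      also have "\<dots> \<le> (\<integral>\<^sup>+g. ennreal (t^2 / 2) * ennreal (edens a g * \<bar>g y - q * coord_sum g\<bar> powr p) \<partial>gvol)"
      proof (rule nn_integral_mono)
        fix g :: "'y \<Rightarrow> real"
        have "edens a g * (1 - cos (t * (g y - q * coord_sum g))) \<le> edens a g * ((t * (g y - q * coord_sum g))^2 / 2)"
          using one_minus_cos_le[of "t * (g y - q * coord_sum g)"] by (intro mult_left_mono) (auto simp: edens_nonneg)
        also have "\<dots> = t^2 / 2 * (edens a g * \<bar>g y - q * coord_sum g\<bar> powr p)"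
          using True by (simp add: power_mult_distrib)
        finally show "ennreal (edens a g * (1 - cos (t * (g y - q * coord_sum g)))) \<le>
            ennreal (t^2 / 2) * ennreal (edens a g * \<bar>g y - q * coord_sum g\<bar> powr p)"
          by (simp add: ennreal_mult[symmetric] edens_nonneg ennreal_leI)
      qed
      also have "\<dots> = ennreal (t^2 / 2) * ?I"
        by (rule nn_integral_cmult) measurable
      finally have "ennreal (t^2 / 2) * ennreal (v * (1 - t^2) * (1 - \<delta>)) \<le> ennreal (t^2 / 2) * ?I"
        using v1 \<delta> tle by (simp add: x_def ennreal_mult[symmetric] mult_ac)
      then have "ennreal (v * (1 - t^2) * (1 - \<delta>)) \<le> ?I"
        using t by (subst (asm) ennreal_mult_le_mult_iff) auto
      moreover have "(1 - \<epsilon>) * v \<le> v * (1 - t^2) * (1 - \<delta>)"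
      proof -
        have "(1 - \<epsilon>) * v \<le> (1 - \<delta>)^2 * v" using \<delta>2 v1 by (intro mult_right_mono) auto
        also have "\<dots> = v * (1 - \<delta>) * (1 - \<delta>)" by (simp add: power2_eq_square)
        also have "\<dots> \<le> v * (1 - t^2) * (1 - \<delta>)" using \<delta> v1 tle by (intro mult_right_mono mult_left_mono) auto
        finally show ?thesis .
      qed
      ultimately show "ennreal ((1 - \<epsilon>) * gauss_moment p * post_var a y powr (p/2)) \<le> ?I"
        using True v1 by (auto simp: gauss_moment_def v_def elim!: order.trans[rotated] intro!: ennreal_leI)
    qed
  next
    case False
    then have p': "0 < p" "p < 2" using p by auto
    obtain R :: nat where R: "ennreal (1 - \<delta>) * gauss_const p \<le>
      (\<integral>\<^sup>+t. ennreal (1 - exp (- (t^2) / 2)) * indicator {..real R} t \<partial>stable_levy p)"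
      using truncated_gauss_const[OF p' \<delta>] by blast
    \<comment> \<open>Ensures R <= sqrt \<delta> * sqrt w for w = v * (1 - \<delta>), so that every
      rescaled frequency up to \<open>R\<close> comes from some \<open>t\<close> with t^2 <=
      \<delta>.\<close>
    define v0 where "v0 = max 1 (real R ^ 2 / (\<delta> * (1 - \<delta>)))"
    show thesis
    proof (rule that[of v0], unfold moment_threshold_def, intro allI impI)
      fix a :: "'y \<Rightarrow> nat" and y q assume q: "0 \<le> (q::real)" "q \<le> 1" and v: "v0 \<le> post_var a y"
      define v where "v = post_var a y"
      define w where "w = v * (1 - \<delta>)"
      have v1: "v \<ge> 1" and vR: "real R ^ 2 / (\<delta> * (1 - \<delta>)) \<le> v" using v by (auto simp: v_def v0_def)
      have w: "w > 0" using v1 \<delta> by (simp add: w_def)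
      define c where "c = sqrt w"
      have c: "c > 0" using w by (simp add: c_def)
      have "real R ^ 2 \<le> (sqrt \<delta> * c)^2"
        using vR \<delta> v1 w by (simp add: power_mult_distrib c_def w_def divide_le_eq mult_ac)
      then have Rc: "real R \<le> sqrt \<delta> * c"
        by (rule power2_le_imp_le) (use c \<delta> in auto)
      let ?I = "\<integral>\<^sup>+g. ennreal (edens a g * \<bar>g y - q * coord_sum g\<bar> powr p) \<partial>gvol"
      let ?f = "\<lambda>s. ennreal (1 - exp (- (s^2) / 2)) * indicator {..real R} s"
      have cp: "c powr p = w powr (p/2)" using w by (simp add: c_def powr_half_sqrt[symmetric] powr_powr)
      have "ennreal (w powr (p/2)) * (ennreal (1 - \<delta>) * gauss_const p) \<le>
          ennreal (c powr p) * (\<integral>\<^sup>+s. ?f s \<partial>stable_levy p)"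
        unfolding cp using R by (rule mult_left_mono) simp
      also have "\<dots> = (\<integral>\<^sup>+t. ?f (c * t) \<partial>stable_levy p)"
        by (rule nn_integral_stable_levy_scale[symmetric]) (use c in auto)
      also have "\<dots> \<le> (\<integral>\<^sup>+t. ennreal (1 - Re (CLINT g|?M a. iexp (t * (g y - q * coord_sum g)))) \<partial>stable_levy p)"
      proof (rule nn_integral_mono_AE)
        show "AE t in stable_levy p. ?f (c * t) \<le> ennreal (1 - Re (CLINT g|?M a. iexp (t * (g y - q * coord_sum g))))"
          using AE_stable_levy[of p]
        proof eventually_elim
          case (elim t)
          show ?case
          proof (cases "c * t \<le> real R")
            case True
            then have "c * t \<le> c * sqrt \<delta>" using Rc by (simp add: mult.commute)
            then have "t \<le> sqrt \<delta>" using c by simp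
            then have "t^2 \<le> (sqrt \<delta>)^2" using elim by (intro power_mono) auto
            then have t2: "t^2 \<le> \<delta>" using \<delta> by simp
            have "sqrt \<delta> \<le> 1" using \<delta> by simp
            then have t1: "t \<le> 1" using \<open>t \<le> sqrt \<delta>\<close> by linarith
            have "1 - exp (- ((c * t)^2) / 2) \<le> 1 - exp (- (v * (1 - t^2)) * t^2 / 2)"
            proof -
              have "v * (1 - \<delta>) * t^2 \<le> v * (1 - t^2) * t^2"
                using v1 t2 by (intro mult_right_mono mult_left_mono) auto
              then show ?thesis using w by (simp add: power_mult_distrib c_def w_def)
            qed
            also have "\<dots> \<le> 1 - Re (CLINT g|?M a. iexp (t * (g y - q * coord_sum g)))"
              using char[of q t a y] q t1 elim by (simp add: v_def)
            finally show ?thesis using True by (simp add: ennreal_leI)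
          qed simp
        qed
      qed
      also have "\<dots> = (\<integral>\<^sup>+g. ennreal (\<bar>g y - q * coord_sum g\<bar> powr p) \<partial>?M a) * cos_const p"
        by (rule nn_integral_powr_eq_char[symmetric, OF prob_space_edens]) measurable
      also have "\<dots> = ?I * cos_const p"
        by (subst dens) auto
      finally have le: "ennreal (w powr (p/2)) * (ennreal (1 - \<delta>) * gauss_const p) \<le> ?I * cos_const p" .
      define K G where "K = enn2real (cos_const p)" and "G = enn2real (gauss_const p)"
      have KG: "cos_const p = ennreal K" "gauss_const p = ennreal G"
        using cos_const_finite[OF p'] gauss_const_finite[OF p'] by (simp_all add: K_def G_def)
      have K: "K > 0" using cos_const_pos[of p] cos_const_finite[OF p'] by (simp add: K_def enn2real_positive_iff)
      have G: "G \<ge> 0" by (simp add: G_def)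
      have mu: "gauss_moment p = G / K" using False by (simp add: gauss_moment_def K_def G_def)
      have "ennreal K * ennreal (w powr (p/2) * (1 - \<delta>) * (G / K)) \<le> ennreal K * ?I"
        using le \<delta> K G unfolding KG by (simp add: ennreal_mult[symmetric] mult_ac)
      then have "ennreal (w powr (p/2) * (1 - \<delta>) * (G / K)) \<le> ?I"
        using K by (subst (asm) ennreal_mult_le_mult_iff) auto
      moreover have "(1 - \<epsilon>) * (G / K) * v powr (p/2) \<le> w powr (p/2) * (1 - \<delta>) * (G / K)"
      proof -
        have "(1 - \<delta>) powr 1 \<le> (1 - \<delta>) powr (p/2)" using \<delta> p by (intro powr_mono') auto
        then have "1 - \<delta> \<le> (1 - \<delta>) powr (p/2)" using \<delta> by simp
        then have "(1 - \<delta>) * (1 - \<delta>) \<le> (1 - \<delta>) powr (p/2) * (1 - \<delta>)" using \<delta> by (intro mult_right_mono) auto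
        then have "1 - \<epsilon> \<le> (1 - \<delta>) powr (p/2) * (1 - \<delta>)" using \<delta>2 by (simp add: power2_eq_square)
        then have "(1 - \<epsilon>) * ((G / K) * v powr (p/2)) \<le> ((1 - \<delta>) powr (p/2) * (1 - \<delta>)) * ((G / K) * v powr (p/2))"
          using G K by (intro mult_right_mono) auto
        also have "\<dots> = w powr (p/2) * (1 - \<delta>) * (G / K)"
          using v1 \<delta> by (simp add: w_def powr_mult mult_ac)
        finally show ?thesis by (simp add: mult_ac)
      qed
      ultimately show "ennreal ((1 - \<epsilon>) * gauss_moment p * post_var a y powr (p/2)) \<le> ?I"
        unfolding mu v_def[symmetric] by (meson ennreal_leI order_trans)
    qed
  qed
qed

section \<open>The univariate problem\<close>

text \<open>Concavity of the power, from Young's inequality at \<open>z / z0\<close>. The tangent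
  turns Jensen's inequality into linearity, for finite sums and binomial expectations alike; its
  slope is positive, so an upper bound on the mean is enough.\<close>

lemma powr_le_tangent:
  fixes z z0 s :: real
  assumes "0 \<le> z" "0 < z0" "0 < s" "s \<le> 1"
  shows "z powr s \<le> z0 powr s + s * z0 powr (s - 1) * (z - z0)"
proof -
  have "(z / z0) powr s * 1 powr (1 - s) \<le> s * (z / z0) + (1 - s) * 1"
  proof (cases "z = 0")
    case False
    then show ?thesis
      using assms Youngs_inequality_0[of s "1 - s" "z / z0" 1] by simp
  qed (use assms in simp)
  then have "z powr s / z0 powr s \<le> 1 + s * (z - z0) / z0"
    using assms by (simp add: powr_divide field_simps)
  then have "z0 powr s * (z powr s / z0 powr s) \<le> z0 powr s * (1 + s * (z - z0) / z0)"
    by (rule mult_left_mono) simp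
  also have "z0 powr s * (1 + s * (z - z0) / z0) = z0 powr s + s * (z0 powr s / z0) * (z - z0)"
    by (simp add: algebra_simps)
  also have "z0 powr s / z0 = z0 powr (s - 1)"
    using assms by (simp add: powr_diff)
  finally show ?thesis using assms by simp
qed

lemma sum_powr_le:
  fixes z :: "'a \<Rightarrow> real"
  assumes "finite A" "\<And>i. i \<in> A \<Longrightarrow> 0 \<le> z i" "0 < z0" "0 < s" "s \<le> 1"
    and "(\<Sum>i\<in>A. z i) \<le> real (card A) * z0"
  shows "(\<Sum>i\<in>A. z i powr s) \<le> real (card A) * z0 powr s"
proof -
  have "(\<Sum>i\<in>A. z i powr s) \<le> (\<Sum>i\<in>A. z0 powr s + s * z0 powr (s - 1) * (z i - z0))"
    using assms by (intro sum_mono powr_le_tangent) auto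
  also have "\<dots> = real (card A) * z0 powr s + s * z0 powr (s - 1) * ((\<Sum>i\<in>A. z i) - real (card A) * z0)"
    by (simp add: sum.distrib sum_distrib_left[symmetric] sum_subtractf)
  also have "\<dots> \<le> real (card A) * z0 powr s"
    using assms by (simp add: mult_nonneg_nonpos)
  finally show ?thesis .
qed

lemma risk_nonneg: "0 \<le> risk p n P q"
  unfolding risk_def by (intro integral_nonneg_AE) (simp add: lp_loss_nonneg)

lemma risk_le_card:
  fixes P :: "'a::finite pmf"
  assumes "0 \<le> p"
  shows "risk p n P q \<le> real CARD('a)"
proof -
  have "risk p n P q \<le> measure_pmf.expectation (replicate_pmf n P) (\<lambda>_. real CARD('a))"
    unfolding risk_def by (intro integral_mono) (auto simp: lp_loss_le_card assms)
  then show ?thesis by simp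
qed

lemma risk_le_worst_risk:
  assumes "0 \<le> p"
  shows "risk p n P q \<le> worst_risk p n q"
  unfolding worst_risk_def using risk_le_card[OF assms]
  by (intro cSUP_upper) (auto intro!: bdd_aboveI2)

lemma worst_risk_nonneg: "0 \<le> p \<Longrightarrow> 0 \<le> worst_risk p n q"
  using risk_nonneg risk_le_worst_risk by (rule order.trans)

lemma worst_risk_le_card:
  fixes q :: "'a::finite list \<Rightarrow> 'a pmf"
  shows "0 \<le> p \<Longrightarrow> worst_risk p n q \<le> real CARD('a)"
  unfolding worst_risk_def by (intro cSUP_least risk_le_card) auto

lemma minimax_risk_le_worst_risk:
  fixes q :: "'a::finite list \<Rightarrow> 'a pmf"
  assumes "0 \<le> p"
  shows "minimax_risk TYPE('a) p n \<le> worst_risk p n q"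
  unfolding minimax_risk_def using worst_risk_nonneg[OF assms]
  by (intro cINF_lower) (auto intro!: bdd_belowI2)

text \<open>The Gaussian value of n powr (p/2) times the risk of the empirical distribution at the
  uniform law on d letters, where every coordinate has variance (1/d) * (1 - 1/d).\<close>

definition gauss_risk :: "'a::finite itself \<Rightarrow> real \<Rightarrow> real" where
  "gauss_risk _ p = gauss_moment p * (real CARD('a) * ((1 / real CARD('a)) * (1 - 1 / real CARD('a))) powr (p/2))"

lemma sum_list_map_diff_const:
  "(\<Sum>z\<leftarrow>s. of_bool (z = a) - c) = real (count (mset s) a) - real (length s) * c" for c :: real
  by (induction s) (auto simp: algebra_simps)

text \<open>Each coordinate is a normalised sum of centred indicators. Their variances sum to at
  most 1 - 1/d by Cauchy-Schwarz, and by concavity of the power p/2 the worst case is an equal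
  distribution of this total, attained at the uniform law.\<close>

lemma risk_empirical_le:
  fixes P :: "'a::finite pmf"
  assumes p: "1 \<le> p" "p \<le> 2" and n: "n \<ge> 1" and card: "CARD('a) \<ge> 2"
  shows "risk p n P (\<lambda>s. pmf_of_multiset (mset s)) \<le>
    real n powr (-(p/2)) * (gauss_risk TYPE('a) p + real CARD('a) * clt_error p n)"
proof -
  let ?R = "replicate_pmf n P"
  define v where "v a = pmf P a * (1 - pmf P a)" for a
  have v0: "v a \<ge> 0" for a by (simp add: v_def pmf_le_1)
  have coord: "measure_pmf.expectation ?R (\<lambda>s. \<bar>pmf P a - pmf (pmf_of_multiset (mset s)) a\<bar> powr p) \<le>
      real n powr (-(p/2)) * (gauss_moment p * v a powr (p/2) + clt_error p n)" for a
  proof -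
    define f where "f z = of_bool (z = a) - pmf P a" for z
    note E = expectation_pmf_eq_sum[of P]
    note P1 = sum_pmf_UNIV[of P]
    have mean: "measure_pmf.expectation P f = 0"
      by (simp add: E f_def right_diff_distrib sum_subtractf sum_distrib_right[symmetric] P1)
    have "(\<Sum>z\<in>UNIV. pmf P z * (f z)^2) = (\<Sum>z\<in>UNIV. pmf P z * of_bool (z = a) * (1 - 2 * pmf P a) + pmf P z * (pmf P a)^2)"
      by (intro sum.cong) (auto simp: f_def power2_eq_square algebra_simps)
    also have "\<dots> = pmf P a * (1 - 2 * pmf P a) + (pmf P a)^2"
      by (simp add: sum.distrib sum_distrib_right[symmetric] P1)
    also have "\<dots> = v a" by (simp add: v_def power2_eq_square algebra_simps)
    finally have var: "measure_pmf.expectation P (\<lambda>z. f z ^ 2) = v a" by (simp add: E)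
    have "measure_pmf.expectation ?R (\<lambda>s. \<bar>pmf P a - pmf (pmf_of_multiset (mset s)) a\<bar> powr p) =
        measure_pmf.expectation ?R (\<lambda>s. real n powr (-p) * (\<bar>\<Sum>z\<leftarrow>s. f z\<bar> powr p))"
    proof (intro integral_cong_AE AE_pmfI)
      fix s assume "s \<in> set_pmf ?R"
      then have len: "length s = n" by (simp add: set_replicate_pmf)
      with n have ne: "mset s \<noteq> {#}" by auto
      have "\<bar>pmf P a - pmf (pmf_of_multiset (mset s)) a\<bar> = \<bar>\<Sum>z\<leftarrow>s. f z\<bar> / real n"
        unfolding f_def sum_list_map_diff_const using n ne len
        by (simp add: pmf_of_multiset[OF ne] abs_minus_commute field_simps)
      then show "\<bar>pmf P a - pmf (pmf_of_multiset (mset s)) a\<bar> powr p = real n powr (-p) * (\<bar>\<Sum>z\<leftarrow>s. f z\<bar> powr p)"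
        by (simp add: powr_divide powr_minus_divide)
    qed auto
    also have "\<dots> \<le> real n powr (-p) * (real n powr (p/2) * (gauss_moment p * v a powr (p/2) + clt_error p n))"
    proof -
      have "\<bar>f z\<bar> \<le> 1" for z
        using pmf_le_1[of P a] pmf_nonneg[of P a] by (simp add: f_def)
      from expectation_abs_sum_powr_le[OF p n this mean var] show ?thesis
        by (simp add: mult_left_mono)
    qed
    also have "\<dots> = real n powr (-(p/2)) * (gauss_moment p * v a powr (p/2) + clt_error p n)"
      unfolding mult.assoc[symmetric] powr_add[symmetric] by simp
    finally show ?thesis .
  qed
  have "risk p n P (\<lambda>s. pmf_of_multiset (mset s)) =
     (\<Sum>a\<in>UNIV. measure_pmf.expectation ?R (\<lambda>s. \<bar>pmf P a - pmf (pmf_of_multiset (mset s)) a\<bar> powr p))"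
    by (simp add: risk_def lp_loss_def)
  also have "\<dots> \<le> (\<Sum>a\<in>UNIV. real n powr (-(p/2)) * (gauss_moment p * v a powr (p/2) + clt_error p n))"
    by (intro sum_mono coord)
  also have "\<dots> = real n powr (-(p/2)) * (gauss_moment p * (\<Sum>a\<in>UNIV. v a powr (p/2)) + real CARD('a) * clt_error p n)"
    by (simp add: sum_distrib_left[symmetric] sum.distrib)
  also have "\<dots> \<le> real n powr (-(p/2)) * (gauss_risk TYPE('a) p + real CARD('a) * clt_error p n)"
  proof -
    let ?d = "real CARD('a)"
    note P1 = sum_pmf_UNIV[of P]
    have S: "(\<Sum>a\<in>UNIV. v a) = 1 - (\<Sum>a\<in>UNIV. (pmf P a)^2)"
      by (simp add: v_def algebra_simps sum_subtractf P1 power2_eq_square)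
    have "(\<Sum>a\<in>UNIV. (pmf P a)^2) \<ge> 1 / ?d"
      using sum_squared_le_sum_of_squares[of "pmf P" UNIV] card by (simp add: P1 field_simps)
    then have "(\<Sum>a\<in>UNIV. v a) \<le> ?d * ((1 / ?d) * (1 - 1 / ?d))" using card S by simp
    then have "(\<Sum>a\<in>UNIV. v a powr (p/2)) \<le> ?d * ((1 / ?d) * (1 - 1 / ?d)) powr (p/2)"
      using card p by (intro sum_powr_le) (auto simp: v0)
    then show ?thesis
      using gauss_moment_pos[OF p] by (intro mult_left_mono add_mono) (auto simp: gauss_risk_def)
  qed
  finally show ?thesis .
qed

text \<open>Bounds the constant \<open>C\<close> from above and, for the alphabet \<open>'x\<close>,
  shows that estimating the marginal costs order n powr (-(p/2)).\<close>

lemma minimax_risk_le_gauss: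
  assumes "1 \<le> p" "p \<le> 2" "n \<ge> 1" "CARD('a::finite) \<ge> 2"
  shows "minimax_risk TYPE('a) p n \<le> real n powr (-(p/2)) * (gauss_risk TYPE('a) p + real CARD('a) * clt_error p n)"
proof -
  have "worst_risk p n (\<lambda>s :: 'a list. pmf_of_multiset (mset s)) \<le>
      real n powr (-(p/2)) * (gauss_risk TYPE('a) p + real CARD('a) * clt_error p n)"
    unfolding worst_risk_def using assms by (intro cSUP_least risk_empirical_le) auto
  then show ?thesis
    using minimax_risk_le_worst_risk[of p n "\<lambda>s :: 'a list. pmf_of_multiset (mset s)"] assms by simp
qed

section \<open>The risk of the joint composition\<close>

text \<open>An arbitrary pmf when \<open>x\<close> has probability zero.\<close>

definition cond_row :: "('x \<times> 'y) pmf \<Rightarrow> 'x \<Rightarrow> 'y pmf" where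
  "cond_row P x = (if set_pmf P \<inter> {z. fst z = x} = {} then return_pmf undefined
     else map_pmf snd (cond_pmf P {z. fst z = x}))"

lemma pmf_fst_times_cond_row:
  "pmf P (x, y) = pmf (map_pmf fst P) x * pmf (cond_row P x) y"
proof (cases "set_pmf P \<inter> {z. fst z = x} = {}")
  case True
  then have "(x, y) \<notin> set_pmf P" "x \<notin> fst ` set_pmf P" by force+
  then have "pmf P (x, y) = 0" "pmf (map_pmf fst P) x = 0"
    by (auto simp: pmf_eq_0_set_pmf)
  then show ?thesis by simp
next
  case False
  have "pmf (cond_row P x) y = measure_pmf.prob (cond_pmf P {z. fst z = x}) {z. snd z = y}"
    using False by (simp add: cond_row_def pmf_map vimage_def)
  also have "\<dots> = measure_pmf.prob (cond_pmf P {z. fst z = x}) {(x, y)}"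
    using False by (intro measure_prob_cong_0) (auto simp: pmf_cond)
  also have "\<dots> = pmf P (x, y) / measure_pmf.prob P {z. fst z = x}"
    using False by (simp add: measure_pmf_single pmf_cond)
  finally show ?thesis
    using measure_measure_pmf_not_zero[OF False] by (simp add: pmf_map vimage_def)
qed

lemma sum_pmf_row:
  fixes P :: "('x \<times> 'y::finite) pmf"
  shows "(\<Sum>y\<in>UNIV. pmf P (x, y)) = pmf (map_pmf fst P) x"
proof -
  have "(\<Sum>y\<in>UNIV. pmf (cond_row P x) y) = 1" by (rule sum_pmf_eq_1) auto
  then show ?thesis by (simp add: pmf_fst_times_cond_row[of P x] sum_distrib_left[symmetric])
qed

section \<open>Binomial sample sizes of the rows\<close>

lemma expectation_binomial_pmf_Suc:
  fixes h :: "nat \<Rightarrow> real"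
  assumes "a \<in> {0..1}"
  shows "measure_pmf.expectation (binomial_pmf (Suc m) a) h =
    a * measure_pmf.expectation (binomial_pmf m a) (\<lambda>t. h (Suc t)) + (1 - a) * measure_pmf.expectation (binomial_pmf m a) h"
proof -
  have "binomial_pmf (Suc m) a = bernoulli_pmf a \<bind> (\<lambda>b. map_pmf (\<lambda>t. (if b then 1 else 0) + t) (binomial_pmf m a))"
    using assms by (simp add: binomial_pmf_Suc map_pmf_def)
  then show ?thesis
    using assms by (simp only:) (subst pmf_expectation_bind[of UNIV], auto simp: UNIV_bool intro!: finite_imageI)
qed

text \<open>Induction on the sample for all \<open>h\<close> at once: a pair in row \<open>x\<close>
  prepends a label drawn from \<open>cond_row\<close>, any other pair changes nothing, and this is
  the Bernoulli recursion of the binomial law. For a row of probability zero the binomial law sits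
  at 0, so its arbitrary \<open>cond_row\<close> is never sampled.\<close>

lemma expectation_labels_of:
  fixes P :: "('x::finite \<times> 'y::finite) pmf" and h :: "'y list \<Rightarrow> real"
  defines "a x \<equiv> pmf (map_pmf fst P) x"
  shows "measure_pmf.expectation (replicate_pmf m P) (\<lambda>l. h (labels_of x l)) =
    measure_pmf.expectation (binomial_pmf m (a x)) (\<lambda>t. measure_pmf.expectation (replicate_pmf t (cond_row P x)) h)"
proof (induction m arbitrary: h)
  case 0
  then show ?case by (simp add: labels_of_def binomial_pmf_0 a_def pmf_le_1)
next
  case (Suc m)
  have a01: "a x \<in> {0..1}" by (simp add: a_def pmf_le_1)
  let ?E = "\<lambda>h. measure_pmf.expectation (replicate_pmf m P) (\<lambda>l. h (labels_of x l))"
  let ?B = "measure_pmf.expectation (binomial_pmf m (a x))"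
  have row: "pmf P (x, y) = a x * pmf (cond_row P x) y" for y
    unfolding a_def by (rule pmf_fst_times_cond_row)
  have "measure_pmf.expectation (replicate_pmf (Suc m) P) (\<lambda>l. h (labels_of x l)) =
     (\<Sum>z\<in>UNIV. pmf P z * (if fst z = x then ?E (\<lambda>s. h (snd z # s)) else ?E h))"
    unfolding expectation_replicate_pmf_Suc by (intro sum.cong) (auto simp: labels_of_def)
  also have "\<dots> = (\<Sum>x'\<in>UNIV. \<Sum>y\<in>UNIV. pmf P (x', y) * (if x' = x then ?E (\<lambda>s. h (y # s)) else ?E h))"
    by (simp add: sum.cartesian_product UNIV_Times_UNIV[symmetric] case_prod_unfold del: UNIV_Times_UNIV)
  also have "\<dots> = (\<Sum>x'\<in>UNIV. (if x' = x then \<Sum>y\<in>UNIV. pmf P (x, y) * ?E (\<lambda>s. h (y # s)) else 0) + (a x' - (if x' = x then a x else 0)) * ?E h)"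
    by (intro sum.cong refl) (auto simp: sum_distrib_right[symmetric] sum_pmf_row a_def)
  also have "\<dots> = (\<Sum>y\<in>UNIV. pmf P (x, y) * ?E (\<lambda>s. h (y # s))) + ((\<Sum>x'\<in>UNIV. a x') - a x) * ?E h"
    by (simp add: sum.distrib sum_distrib_right[symmetric] sum_subtractf)
  also have "(\<Sum>x'\<in>UNIV. a x') = 1" unfolding a_def by (rule sum_pmf_eq_1) auto
  also have "(\<Sum>y\<in>UNIV. pmf P (x, y) * ?E (\<lambda>s. h (y # s))) =
     a x * ?B (\<lambda>t. \<Sum>y\<in>UNIV. pmf (cond_row P x) y * measure_pmf.expectation (replicate_pmf t (cond_row P x)) (\<lambda>s. h (y # s)))"
    using a01 by (simp add: row Suc.IH[of "\<lambda>s. h (y # s)" for y] sum_distrib_left mult.assoc)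
  also have "(\<lambda>t. \<Sum>y\<in>UNIV. pmf (cond_row P x) y * measure_pmf.expectation (replicate_pmf t (cond_row P x)) (\<lambda>s. h (y # s))) =
      (\<lambda>t. measure_pmf.expectation (replicate_pmf (Suc t) (cond_row P x)) h)"
    unfolding expectation_replicate_pmf_Suc by simp
  finally show ?case using a01 by (simp add: expectation_binomial_pmf_Suc Suc.IH)
qed

text \<open>The absorption identity for binomial coefficients trades the factor 1 / (t + 1) for one
  more trial. The shifted variable misses the value 0, hence the default 0 there. A second
  application treats 1 / ((t + 1) * (t + 2)).\<close>

lemma expectation_binomial_inverse_Suc:
  assumes a: "a \<in> {0..1}"
  shows "a * real (Suc m) * measure_pmf.expectation (binomial_pmf m a) (\<lambda>t. h (Suc t) / real (Suc t)) =
    measure_pmf.expectation (binomial_pmf (Suc m) a) (\<lambda>t. if t = 0 then 0 else h t)"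
proof -
  have "measure_pmf.expectation (binomial_pmf (Suc m) a) (\<lambda>t. if t = 0 then 0 else h t) =
     (\<Sum>t\<le>m. real (Suc m choose Suc t) * a ^ Suc t * (1 - a) ^ (m - t) * h (Suc t))"
    using a by (simp add: expectation_binomial_pmf' sum.atMost_Suc_shift del: sum.atMost_Suc binomial_Suc_Suc)
  also have "\<dots> = (\<Sum>t\<le>m. a * real (Suc m) * (real (m choose t) * a ^ t * (1 - a) ^ (m - t) * (h (Suc t) / real (Suc t))))"
  proof (intro sum.cong refl)
    fix t
    have "real (Suc t) * real (Suc m choose Suc t) = real (Suc m) * real (m choose t)"
      by (metis Suc_times_binomial of_nat_mult)
    then have "real (Suc m choose Suc t) = real (Suc m) * real (m choose t) / real (Suc t)"
      by (simp add: field_simps del: binomial_Suc_Suc)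
    then show "real (Suc m choose Suc t) * a ^ Suc t * (1 - a) ^ (m - t) * h (Suc t) =
      a * real (Suc m) * (real (m choose t) * a ^ t * (1 - a) ^ (m - t) * (h (Suc t) / real (Suc t)))"
      by (simp add: mult_ac del: binomial_Suc_Suc of_nat_Suc)
  qed
  also have "\<dots> = a * real (Suc m) * measure_pmf.expectation (binomial_pmf m a) (\<lambda>t. h (Suc t) / real (Suc t))"
    using a by (simp add: expectation_binomial_pmf' sum_distrib_left)
  finally show ?thesis ..
qed

lemma expectation_binomial_le_1:
  assumes a: "a \<in> {0..1}" and h: "\<And>t. h t \<le> (1::real)"
  shows "measure_pmf.expectation (binomial_pmf m a) h \<le> 1"
proof -
  have "measure_pmf.expectation (binomial_pmf m a) h \<le> measure_pmf.expectation (binomial_pmf m a) (\<lambda>_. 1)"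
    using a h by (intro integral_mono) auto
  then show ?thesis by simp
qed

lemma expectation_binomial_powr_le:
  fixes z :: "nat \<Rightarrow> real"
  assumes a: "0 < a" "a \<le> 1" and z: "\<And>t. 0 \<le> z t" and z0: "z0 > 0" and s: "0 < s" "s \<le> 1"
    and le: "measure_pmf.expectation (binomial_pmf m a) z \<le> z0"
  shows "measure_pmf.expectation (binomial_pmf m a) (\<lambda>t. z t powr s) \<le> z0 powr s"
proof -
  have a': "a \<in> {0..1}" using a by auto
  have "measure_pmf.expectation (binomial_pmf m a) (\<lambda>t. z t powr s) \<le>
     measure_pmf.expectation (binomial_pmf m a) (\<lambda>t. z0 powr s + s * z0 powr (s - 1) * (z t - z0))"
  proof (rule integral_mono)
    show "z t powr s \<le> z0 powr s + s * z0 powr (s - 1) * (z t - z0)" for t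
      by (rule powr_le_tangent[OF z z0 s])
  qed (use a' in auto)
  also have "\<dots> = z0 powr s + s * z0 powr (s - 1) * (measure_pmf.expectation (binomial_pmf m a) z - z0)"
    using a' by simp
  also have "\<dots> \<le> z0 powr s" using s le by (simp add: mult_nonneg_nonpos)
  finally show ?thesis .
qed

text \<open>Both terms come from Jensen's inequality for a concave power, applied to \<open>1 / (T + 1)\<close> and to
  \<open>1 / ((T + 1) * (T + 2))\<close>, whose binomial means have closed forms.\<close>

lemma binomial_risk_le:
  fixes w :: "nat \<Rightarrow> real"
  assumes a: "0 \<le> a" "a \<le> 1" and p: "1 \<le> p" "p \<le> 2" and m: "m \<ge> 1" and cB: "0 \<le> c" "0 \<le> B"
    and w: "\<And>t. w t \<le> c * (1 / real (Suc t)) powr (p/2) + B * of_bool (t < t0)"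
  shows "a powr p * measure_pmf.expectation (binomial_pmf m a) w \<le>
    c * a powr (p/2) * real m powr (-(p/2)) + B * (real t0 * real (Suc t0)) powr (p/2) * real m powr (-p)"
proof (cases "a = 0")
  case True
  then show ?thesis using cB p by simp
next
  case False
  then have a0: "0 < a" and a01: "a \<in> {0..1}" using a by auto
  let ?E = "measure_pmf.expectation (binomial_pmf m a)"
  \<comment> \<open>If t < t0 then (t + 1) * (t + 2) <= K, so the indicator is at most a power of K
    / ((t + 1) * (t + 2)). Its mean is of order (a * m) powr (-p), and the weight a powr p cancels
    the dependence on \<open>a\<close>: small counts cost m powr (-p) uniformly.\<close>
  define K where "K = real t0 * real (Suc t0)"
  have "a * real (Suc m) * ?E (\<lambda>t. 1 / real (Suc t)) \<le> 1"
    unfolding expectation_binomial_inverse_Suc[OF a01, of m "\<lambda>_. 1"] using a01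
    by (intro expectation_binomial_le_1) auto
  then have "?E (\<lambda>t. 1 / real (Suc t)) \<le> 1 / (a * real (Suc m))"
    using a0 by (simp add: pos_le_divide_eq mult.commute del: of_nat_Suc)
  also have "\<dots> \<le> 1 / (a * real m)" using a0 m by (simp add: divide_left_mono)
  finally have E1: "?E (\<lambda>t. (1 / real (Suc t)) powr (p/2)) \<le> (1 / (a * real m)) powr (p/2)"
    using a0 a m p by (intro expectation_binomial_powr_le) auto
  have "a * real (Suc (Suc m)) * (a * real (Suc m) * ?E (\<lambda>t. 1 / (real (Suc t) * real (Suc (Suc t))))) \<le> 1"
  proof -
    have "a * real (Suc m) * ?E (\<lambda>t. (1 / real (Suc (Suc t))) / real (Suc t)) \<le>
        measure_pmf.expectation (binomial_pmf (Suc m) a) (\<lambda>t. 1 / real (Suc t))"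
      unfolding expectation_binomial_inverse_Suc[OF a01, of m "\<lambda>t. 1 / real (Suc t)"] using a01
      by (intro integral_mono) auto
    then have "a * real (Suc (Suc m)) * (a * real (Suc m) * ?E (\<lambda>t. (1 / real (Suc (Suc t))) / real (Suc t))) \<le>
        a * real (Suc (Suc m)) * measure_pmf.expectation (binomial_pmf (Suc m) a) (\<lambda>t. 1 / real (Suc t))"
      using a0 by (intro mult_left_mono) auto
    also have "\<dots> \<le> 1"
      unfolding expectation_binomial_inverse_Suc[OF a01, of "Suc m" "\<lambda>_. 1"] using a01
      by (intro expectation_binomial_le_1) auto
    finally show ?thesis by (simp add: mult.commute)
  qed
  moreover have "(a * real m) * (a * real m) * ?E (\<lambda>t. 1 / (real (Suc t) * real (Suc (Suc t)))) \<le>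
     (a * real (Suc (Suc m))) * (a * real (Suc m)) * ?E (\<lambda>t. 1 / (real (Suc t) * real (Suc (Suc t))))"
    using a0 by (intro mult_right_mono mult_mono integral_nonneg_AE) auto
  ultimately have "(a * real m)^2 * ?E (\<lambda>t. 1 / (real (Suc t) * real (Suc (Suc t)))) \<le> 1"
    by (simp add: power2_eq_square mult.assoc)
  then have "K * ?E (\<lambda>t. 1 / (real (Suc t) * real (Suc (Suc t)))) \<le> K * (1 / (a * real m)^2)"
    using a0 m by (intro mult_left_mono) (auto simp: K_def pos_le_divide_eq mult.commute)
  moreover have "?E (\<lambda>t. K / (real (Suc t) * real (Suc (Suc t)))) = K * ?E (\<lambda>t. 1 / (real (Suc t) * real (Suc (Suc t))))"
    unfolding divide_inverse mult_1 by (rule integral_mult_right_zero)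
  ultimately have E2': "?E (\<lambda>t. K / (real (Suc t) * real (Suc (Suc t)))) \<le> K / (a * real m)^2"
    by (simp only: times_divide_eq_right mult_1_right)
  have E2: "?E (\<lambda>t. of_bool (t < t0)) \<le> (K / (a * real m)^2) powr (p/2)"
  proof (cases "t0 = 0")
    case False
    have "?E (\<lambda>t. of_bool (t < t0)) \<le> ?E (\<lambda>t. (K / (real (Suc t) * real (Suc (Suc t)))) powr (p/2))"
    proof (rule integral_mono)
      fix t
      show "of_bool (t < t0) \<le> (K / (real (Suc t) * real (Suc (Suc t)))) powr (p/2)"
      proof (cases "t < t0")
        case True
        then have "real (Suc t) * real (Suc (Suc t)) \<le> K" unfolding K_def by (intro mult_mono) auto
        then have "1 \<le> K / (real (Suc t) * real (Suc (Suc t)))" by (simp add: le_divide_eq del: of_nat_Suc)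
        then show ?thesis using p True by (simp add: ge_one_powr_ge_zero)
      qed simp
    qed (use a01 in auto)
    also have "\<dots> \<le> (K / (a * real m)^2) powr (p/2)"
      using E2' a0 a m p False by (intro expectation_binomial_powr_le) (auto simp: K_def)
    finally show ?thesis .
  qed simp
  have "?E w \<le> ?E (\<lambda>t. c * (1 / real (Suc t)) powr (p/2) + B * of_bool (t < t0))"
    using a01 w by (intro integral_mono) auto
  also have "\<dots> = c * ?E (\<lambda>t. (1 / real (Suc t)) powr (p/2)) + B * ?E (\<lambda>t. of_bool (t < t0))"
    using a01 by (simp del: of_nat_Suc)
  also have "\<dots> \<le> c * (1 / (a * real m)) powr (p/2) + B * (K / (a * real m)^2) powr (p/2)"
    using E1 E2 cB by (intro add_mono mult_left_mono)
  finally have "a powr p * ?E w \<le> a powr p * (c * (1 / (a * real m)) powr (p/2) + B * (K / (a * real m)^2) powr (p/2))"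
    by (intro mult_left_mono) auto
  also have "\<dots> = c * (a powr p * (1 / (a * real m)) powr (p/2)) + B * (a powr p * (K / (a * real m)^2) powr (p/2))"
    by (simp add: algebra_simps)
  also have "a powr p * (1 / (a * real m)) powr (p/2) = a powr (p/2) * real m powr (-(p/2))"
  proof -
    have "a powr p = a powr (p/2) * a powr (p/2)" using powr_add[of a "p/2" "p/2"] by simp
    then show ?thesis using a0 m by (simp add: powr_divide powr_mult powr_minus_divide)
  qed
  also have "a powr p * (K / (a * real m)^2) powr (p/2) = K powr (p/2) * real m powr (-p)"
  proof -
    have "((a * real m)^2) powr (p/2) = (a * real m) powr p"
      using a0 m powr_powr[of "a * real m" 2 "p/2"] by simp
    then show ?thesis using a0 m by (simp add: powr_divide powr_mult powr_minus_divide K_def)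
  qed
  finally show ?thesis by (simp add: K_def mult_ac)
qed

text \<open>Convexity with weights \<open>1 - s\<close> and \<open>s\<close>. For small
  \<open>s\<close> the factor on \<open>u\<close>, the main term, is close to 1; the factor on
  \<open>v\<close> may be large, but meets a term of smaller order.\<close>

lemma abs_add_powr_le:
  fixes u v s p :: real
  assumes p: "1 \<le> p" and s: "0 < s" "s < 1"
  shows "\<bar>u + v\<bar> powr p \<le> (1 - s) powr (1 - p) * \<bar>u\<bar> powr p + s powr (1 - p) * \<bar>v\<bar> powr p"
proof -
  have ge1: "z \<le> r powr (1 - p) * z" if "0 < r" "r < 1" "0 \<le> z" for r z :: real
  proof -
    have "r powr 0 \<le> r powr (1 - p)" using that p by (intro powr_mono') auto
    then show ?thesis using that by (simp add: mult_le_cancel_right1)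
  qed
  consider "u = 0" | "v = 0" | "u \<noteq> 0" "v \<noteq> 0" by blast
  then show ?thesis
  proof cases
    case 1
    then show ?thesis using ge1[of s "\<bar>v\<bar> powr p"] s by simp
  next
    case 2
    then show ?thesis using ge1[of "1 - s" "\<bar>u\<bar> powr p"] s by simp
  next
    case 3
    have w: "r * (\<bar>z\<bar> / r) powr p = r powr (1 - p) * \<bar>z\<bar> powr p" if "r > 0" for r z :: real
      using that by (simp add: powr_divide powr_diff)
    have "\<bar>u + v\<bar> powr p \<le> (\<bar>u\<bar> + \<bar>v\<bar>) powr p"
      using p by (intro powr_mono2) auto
    also have "\<dots> = ((1 - s) *\<^sub>R (\<bar>u\<bar> / (1 - s)) + s *\<^sub>R (\<bar>v\<bar> / s)) powr p"
      using s by simp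
    also have "\<dots> \<le> (1 - s) * (\<bar>u\<bar> / (1 - s)) powr p + s * (\<bar>v\<bar> / s) powr p"
      using s 3 by (intro convex_onD[OF powr_convex[OF p]]) auto
    finally show ?thesis using s by (simp add: w)
  qed
qed

lemma integrable_pair_replicate_pmf [simp]:
  fixes h :: "'a::finite list \<times> 'b::finite list \<Rightarrow> real"
  shows "integrable (measure_pmf (pair_pmf (replicate_pmf n P) (replicate_pmf m Q))) h"
  by (rule integrable_measure_pmf_finite) simp

lemma joint_risk_nonneg: "0 \<le> joint_risk p m n P q"
  unfolding joint_risk_def by (intro integral_nonneg_AE) (auto simp: lp_loss_nonneg)

lemma joint_risk_le_card:
  fixes P :: "('x::finite \<times> 'y::finite) pmf"
  assumes "0 \<le> p"
  shows "joint_risk p m n P q \<le> real CARD('x \<times> 'y)"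
proof -
  have "joint_risk p m n P q \<le>
      measure_pmf.expectation (pair_pmf (replicate_pmf n (map_pmf fst P)) (replicate_pmf m P)) (\<lambda>_. real CARD('x \<times> 'y))"
    unfolding joint_risk_def case_prod_beta by (rule integral_mono) (simp_all only: integrable_pair_replicate_pmf lp_loss_le_card assms)
  then show ?thesis by simp
qed

lemma joint_risk_le_joint_worst_risk:
  assumes "0 \<le> p"
  shows "joint_risk p m n P q \<le> joint_worst_risk p m n q"
  unfolding joint_worst_risk_def using joint_risk_le_card[OF assms]
  by (intro cSUP_upper) (auto intro!: bdd_aboveI2)

lemma joint_worst_risk_nonneg: "0 \<le> p \<Longrightarrow> 0 \<le> joint_worst_risk p m n q"
  using joint_risk_nonneg joint_risk_le_joint_worst_risk by (rule order.trans)

lemma joint_minimax_risk_le_joint_worst_risk: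
  fixes q :: "'x::finite list \<Rightarrow> ('x \<times> 'y::finite) list \<Rightarrow> ('x \<times> 'y) pmf"
  assumes "0 \<le> p"
  shows "joint_minimax_risk TYPE('x) TYPE('y) p m n \<le> joint_worst_risk p m n q"
  unfolding joint_minimax_risk_def using joint_worst_risk_nonneg[OF assms]
  by (intro cINF_lower) (auto intro!: bdd_belowI2)

lemma lp_loss_joint_composition_le:
  fixes P :: "('x::finite \<times> 'y::finite) pmf"
  assumes p: "1 \<le> p" and s: "0 < s" "s < 1"
  shows "lp_loss p P (joint_composition qX qY n u l) \<le>
    (1 - s) powr (1 - p) * (\<Sum>x\<in>UNIV. pmf (map_pmf fst P) x powr p * lp_loss p (cond_row P x) (conditional_composition qY l x))
    + s powr (1 - p) * lp_loss p (map_pmf fst P) (qX n u)"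
proof -
  let ?a = "pmf (map_pmf fst P)" and ?r = "\<lambda>x. pmf (conditional_composition qY l x)"
  let ?S = "(1 - s) powr (1 - p)" and ?T = "s powr (1 - p)"
  have "lp_loss p P (joint_composition qX qY n u l) =
     (\<Sum>x\<in>UNIV. \<Sum>y\<in>UNIV. \<bar>pmf P (x, y) - pmf (joint_composition qX qY n u l) (x, y)\<bar> powr p)"
    unfolding lp_loss_def by (simp add: sum.cartesian_product)
  also have "\<dots> \<le> (\<Sum>x\<in>UNIV. \<Sum>y\<in>UNIV. ?S * (?a x powr p * \<bar>pmf (cond_row P x) y - ?r x y\<bar> powr p)
      + ?T * (\<bar>?a x - pmf (qX n u) x\<bar> powr p * ?r x y))"
  proof (intro sum_mono)
    fix x y
    have "pmf P (x, y) - pmf (joint_composition qX qY n u l) (x, y) =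
        ?a x * (pmf (cond_row P x) y - ?r x y) + ?r x y * (?a x - pmf (qX n u) x)"
      unfolding pmf_joint_composition by (simp add: pmf_fst_times_cond_row[of P x y] algebra_simps)
    then have "\<bar>pmf P (x, y) - pmf (joint_composition qX qY n u l) (x, y)\<bar> powr p \<le>
        ?S * \<bar>?a x * (pmf (cond_row P x) y - ?r x y)\<bar> powr p + ?T * \<bar>?r x y * (?a x - pmf (qX n u) x)\<bar> powr p"
      using abs_add_powr_le[OF p s] by simp
    also have "\<dots> = ?S * (?a x powr p * \<bar>pmf (cond_row P x) y - ?r x y\<bar> powr p) + ?T * (\<bar>?a x - pmf (qX n u) x\<bar> powr p * ?r x y powr p)"
      by (simp add: abs_mult powr_mult mult_ac)
    also have "\<dots> \<le> ?S * (?a x powr p * \<bar>pmf (cond_row P x) y - ?r x y\<bar> powr p) + ?T * (\<bar>?a x - pmf (qX n u) x\<bar> powr p * ?r x y)"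
    proof -
      \<comment> \<open>Without the power the factor sums to 1 over \<open>y\<close>, so the second
        part reduces to the loss of the marginal estimate.\<close>
      have "?r x y powr p \<le> ?r x y powr 1" using p pmf_le_1 by (intro powr_mono') auto
      then show ?thesis by (intro add_left_mono mult_left_mono) auto
    qed
    finally show "\<bar>pmf P (x, y) - pmf (joint_composition qX qY n u l) (x, y)\<bar> powr p \<le>
       ?S * (?a x powr p * \<bar>pmf (cond_row P x) y - ?r x y\<bar> powr p) + ?T * (\<bar>?a x - pmf (qX n u) x\<bar> powr p * ?r x y)" .
  qed
  also have "\<dots> = ?S * (\<Sum>x\<in>UNIV. ?a x powr p * lp_loss p (cond_row P x) (conditional_composition qY l x))
      + ?T * (\<Sum>x\<in>UNIV. \<bar>?a x - pmf (qX n u) x\<bar> powr p * (\<Sum>y\<in>UNIV. ?r x y))"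
    by (simp add: sum.distrib lp_loss_def sum_distrib_left)
  also have "(\<Sum>x\<in>UNIV. \<bar>?a x - pmf (qX n u) x\<bar> powr p * (\<Sum>y\<in>UNIV. ?r x y)) = lp_loss p (map_pmf fst P) (qX n u)"
    unfolding lp_loss_def by (intro sum.cong refl) (simp add: sum_pmf_eq_1)
  finally show ?thesis .
qed

text \<open>Each part of the loss depends on one sample only. In the first part, conditioning on the
  number of labels turns the loss of a row into a univariate risk at that sample size.\<close>

lemma joint_risk_joint_composition_le:
  fixes P :: "('x::finite \<times> 'y::finite) pmf"
  assumes p: "1 \<le> p" and s: "0 < s" "s < 1"
  shows "joint_risk p m n P (joint_composition qX qY n) \<le>
    (1 - s) powr (1 - p) * (\<Sum>x\<in>UNIV. pmf (map_pmf fst P) x powr p *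
        measure_pmf.expectation (binomial_pmf m (pmf (map_pmf fst P) x)) (\<lambda>t. worst_risk p t (qY t)))
    + s powr (1 - p) * worst_risk p n (qX n)"
proof -
  let ?a = "pmf (map_pmf fst P)"
  let ?S = "(1 - s) powr (1 - p)" and ?T = "s powr (1 - p)"
  let ?U = "replicate_pmf n (map_pmf fst P)" and ?L = "replicate_pmf m P"
  let ?F = "\<lambda>l. \<Sum>x\<in>UNIV. ?a x powr p * lp_loss p (cond_row P x) (conditional_composition qY l x)"
  let ?G = "\<lambda>u. lp_loss p (map_pmf fst P) (qX n u)"
  have "joint_risk p m n P (joint_composition qX qY n) \<le>
      measure_pmf.expectation (pair_pmf ?U ?L) (\<lambda>z. ?S * ?F (snd z) + ?T * ?G (fst z))"
    unfolding joint_risk_def case_prod_beta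
    by (rule integral_mono) (simp_all only: integrable_pair_replicate_pmf lp_loss_joint_composition_le[OF p s])
  also have "\<dots> = ?S * measure_pmf.expectation (pair_pmf ?U ?L) (\<lambda>z. ?F (snd z)) + ?T * measure_pmf.expectation (pair_pmf ?U ?L) (\<lambda>z. ?G (fst z))"
    by simp
  also have "measure_pmf.expectation (pair_pmf ?U ?L) (\<lambda>z. ?G (fst z)) = measure_pmf.expectation ?U ?G"
    by (rule expectation_pair_pmf_fst)
  also have "\<dots> = risk p n (map_pmf fst P) (qX n)" by (simp add: risk_def)
  also have "measure_pmf.expectation (pair_pmf ?U ?L) (\<lambda>z. ?F (snd z)) = measure_pmf.expectation ?L ?F"
    by (rule expectation_pair_pmf_snd)
  also have "\<dots> = (\<Sum>x\<in>UNIV. ?a x powr p * measure_pmf.expectation ?L (\<lambda>l. lp_loss p (cond_row P x) (conditional_composition qY l x)))"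
    by simp
  also have "\<dots> \<le> (\<Sum>x\<in>UNIV. ?a x powr p * measure_pmf.expectation (binomial_pmf m (?a x)) (\<lambda>t. worst_risk p t (qY t)))"
  proof (intro sum_mono mult_left_mono)
    fix x
    have a01: "?a x \<in> {0..1}" by (simp add: pmf_le_1)
    have "measure_pmf.expectation ?L (\<lambda>l. lp_loss p (cond_row P x) (conditional_composition qY l x)) =
      measure_pmf.expectation (binomial_pmf m (?a x)) (\<lambda>t. measure_pmf.expectation (replicate_pmf t (cond_row P x)) (\<lambda>s. lp_loss p (cond_row P x) (qY (length s) s)))"
      unfolding conditional_composition_def by (rule expectation_labels_of)
    also have "\<dots> = measure_pmf.expectation (binomial_pmf m (?a x)) (\<lambda>t. risk p t (cond_row P x) (qY t))"
      unfolding risk_def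
      by (intro Bochner_Integration.integral_cong refl integral_cong_AE AE_pmfI) (auto simp: set_replicate_pmf)
    also have "\<dots> \<le> measure_pmf.expectation (binomial_pmf m (?a x)) (\<lambda>t. worst_risk p t (qY t))"
      using a01 p by (intro integral_mono risk_le_worst_risk) auto
    finally show "measure_pmf.expectation ?L (\<lambda>l. lp_loss p (cond_row P x) (conditional_composition qY l x)) \<le>
       measure_pmf.expectation (binomial_pmf m (?a x)) (\<lambda>t. worst_risk p t (qY t))" .
  qed simp
  finally have "joint_risk p m n P (joint_composition qX qY n) \<le>
      ?S * (\<Sum>x\<in>UNIV. ?a x powr p * measure_pmf.expectation (binomial_pmf m (?a x)) (\<lambda>t. worst_risk p t (qY t))) + ?T * risk p n (map_pmf fst P) (qX n)"
    by (simp add: mult_left_mono)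
  also have "\<dots> \<le> ?S * (\<Sum>x\<in>UNIV. ?a x powr p * measure_pmf.expectation (binomial_pmf m (?a x)) (\<lambda>t. worst_risk p t (qY t))) + ?T * worst_risk p n (qX n)"
    using p by (intro add_left_mono mult_left_mono risk_le_worst_risk) auto
  finally show ?thesis .
qed

text \<open>In an asymptotic equivalence the quotient counts as 1 if both sides vanish, but is 0 if
  only the denominator does; its limit 1 therefore forces \<open>f n\<close> to vanish with
  \<open>g n\<close> eventually.\<close>

lemma asymp_equiv_eventually_le:
  fixes f g :: "nat \<Rightarrow> real"
  assumes "f \<sim>[at_top] g" "\<And>n. 0 \<le> g n" "0 < \<delta>"
  shows "eventually (\<lambda>n. f n \<le> (1 + \<delta>) * g n) at_top"
proof -
  have lim: "((\<lambda>x. if f x = 0 \<and> g x = 0 then 1 else f x / g x) \<longlongrightarrow> 1) at_top"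
    using assms(1) by (rule asymp_equivD)
  have "eventually (\<lambda>x. (if f x = 0 \<and> g x = 0 then 1 else f x / g x) < 1 + \<delta>) at_top"
    using assms(3) by (intro order_tendstoD(2)[OF lim]) auto
  moreover have "eventually (\<lambda>x. (if f x = 0 \<and> g x = 0 then 1 else f x / g x) > 0) at_top"
    by (intro order_tendstoD(1)[OF lim]) auto
  ultimately show ?thesis
  proof eventually_elim
    case (elim n)
    show ?case
    proof (cases "g n = 0")
      case False
      then have "g n > 0" using assms(2)[of n] by simp
      then show ?thesis using elim(1) False by (simp add: divide_less_eq)
    qed (use elim in \<open>auto split: if_splits\<close>)
  qed
qed

theorem joint_composition_upper:
  fixes qX :: "nat \<Rightarrow> 'x::finite list \<Rightarrow> 'x pmf" and qY :: "nat \<Rightarrow> 'y::finite list \<Rightarrow> 'y pmf"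
  assumes cX: "CARD('x) \<ge> 2" and p: "1 \<le> p" "p \<le> 2"
    and qX: "first_order_minimax_optimal p qX" and qY: "first_order_minimax_optimal p qY"
    and C: "C > 0" and mm: "minimax_risk TYPE('y) p \<sim>[at_top] (\<lambda>t. C / real t powr (p / 2))"
    and n: "(\<lambda>m. real m) \<in> o(\<lambda>m. real (n m))"
    and c': "real CARD('x) powr (1 - p / 2) * C < c'"
  shows "eventually (\<lambda>m. real m powr (p/2) * joint_worst_risk p m (n m) (joint_composition qX qY (n m)) < c') at_top"
proof -
  let ?k = "real CARD('x)" and ?d = "real CARD('y)"
  define W where "W = (\<lambda>m. joint_worst_risk p m (n m) (joint_composition qX qY (n m)))"
  \<comment> \<open>In (1 + s)^2 one factor pays for the asymptotic equivalence of the worst risk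
    with C / t powr (p/2), the other for replacing \<open>t\<close> by \<open>Suc t\<close>, which
    makes the bound meaningful at t = 0.\<close>
  have "((\<lambda>s. (1 - s) powr (1 - p) * (C * (1 + s)^2 * ?k powr (1 - p/2))) \<longlongrightarrow>
      (1 - 0) powr (1 - p) * (C * (1 + 0)^2 * ?k powr (1 - p/2))) (at_right 0)"
    by (intro tendsto_intros) auto
  then have A: "eventually (\<lambda>s. (1 - s) powr (1 - p) * (C * (1 + s)^2 * ?k powr (1 - p/2)) < c') (at_right 0)"
    using c' by (intro order_tendstoD(2)) (auto simp: mult.commute)
  have B: "eventually (\<lambda>s::real. s \<in> {0<..<1}) (at_right 0)"
    by (rule eventually_at_right_real) simp
  obtain s where s: "0 < s" "s < 1" and sc: "(1 - s) powr (1 - p) * (C * (1 + s)^2 * ?k powr (1 - p/2)) < c'"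
    using eventually_happens'[OF trivial_limit_at_right_real eventually_conj[OF A B]] by auto
  define c where "c = C * (1 + s)^2"
  have c0: "c > 0" using C s by (simp add: c_def)
  let ?w = "\<lambda>t. worst_risk p t (qY t)"
  have "?w \<sim>[at_top] (\<lambda>t. C / real t powr (p / 2))"
    using qY mm unfolding first_order_minimax_optimal_def by (rule asymp_equiv_trans)
  then have "eventually (\<lambda>t. ?w t \<le> (1 + s) * (C / real t powr (p / 2))) at_top"
    using C s by (intro asymp_equiv_eventually_le) auto
  moreover have "eventually (\<lambda>t. real t \<ge> 1 / s) at_top"
    using filterlim_real_sequentially by (simp add: filterlim_at_top)
  ultimately have "eventually (\<lambda>t. ?w t \<le> c * (1 / real (Suc t)) powr (p/2)) at_top"
    using eventually_gt_at_top[of 0]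
  proof eventually_elim
    case (elim t)
    have st: "1 + 1 / real t \<le> 1 + s" using elim s by (simp add: field_simps)
    have "(1 / real t) powr (p/2) = ((1 + 1 / real t) * (1 / real (Suc t))) powr (p/2)"
      using elim by (intro arg_cong[where f="\<lambda>z. z powr _"]) (simp add: field_simps)
    also have "\<dots> = (1 + 1 / real t) powr (p/2) * (1 / real (Suc t)) powr (p/2)"
      by (rule powr_mult)
    also have "(1 + 1 / real t) powr (p/2) \<le> (1 + s) powr (p/2)"
      using st p by (intro powr_mono2) auto
    also have "(1 + s) powr (p/2) \<le> (1 + s) powr 1"
      using p s by (intro powr_mono) auto
    finally have "(1 / real t) powr (p/2) \<le> (1 + s) * (1 / real (Suc t)) powr (p/2)"
      using s by (simp add: mult_right_mono)
    then have "(1 + s) * (C * (1 / real t) powr (p/2)) \<le> (1 + s) * (C * ((1 + s) * (1 / real (Suc t)) powr (p/2)))"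
      using C s by (intro mult_left_mono) auto
    then show ?case using elim by (simp add: powr_divide c_def power2_eq_square mult_ac)
  qed
  then obtain t0 where t0: "\<And>t. t \<ge> t0 \<Longrightarrow> ?w t \<le> c * (1 / real (Suc t)) powr (p/2)"
    by (auto simp: eventually_at_top_linorder)
  \<comment> \<open>Below \<open>t0\<close> the asymptotics say nothing, and the trivial bound by
    the number of letters takes over.\<close>
  have w: "?w t \<le> c * (1 / real (Suc t)) powr (p/2) + ?d * of_bool (t < t0)" for t
  proof (cases "t < t0")
    case True
    have "?w t \<le> ?d" using p by (intro worst_risk_le_card) auto
    then show ?thesis using True c0 by (simp add: add_increasing)
  qed (use t0[of t] in simp)
  define B where "B = ?d * (real t0 * real (Suc t0)) powr (p/2)"
  have joint: "W m \<le> (1 - s) powr (1 - p) * (c * ?k powr (1 - p/2) * real m powr (-(p/2)) + ?k * (B * real m powr (-p)))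
      + s powr (1 - p) * worst_risk p (n m) (qX (n m))" if m: "m \<ge> 1" for m
    unfolding W_def joint_worst_risk_def
  proof (intro cSUP_least)
    fix P :: "('x \<times> 'y) pmf"
    let ?a = "pmf (map_pmf fst P)"
    have "(\<Sum>x\<in>UNIV. ?a x powr p * measure_pmf.expectation (binomial_pmf m (?a x)) ?w) \<le>
        (\<Sum>x\<in>UNIV. c * ?a x powr (p/2) * real m powr (-(p/2)) + B * real m powr (-p))"
      unfolding B_def using w p m c0 by (intro sum_mono binomial_risk_le) (auto simp: pmf_le_1)
    also have "\<dots> = c * (\<Sum>x\<in>UNIV. ?a x powr (p/2)) * real m powr (-(p/2)) + ?k * (B * real m powr (-p))"
      by (simp add: sum.distrib sum_distrib_left sum_distrib_right mult.assoc)
    also have "(\<Sum>x\<in>UNIV. ?a x powr (p/2)) \<le> ?k * (1 / ?k) powr (p/2)"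
      using p cX by (intro sum_powr_le) (auto simp: sum_pmf_eq_1)
    also have "?k * (1 / ?k) powr (p/2) = ?k powr (1 - p/2)"
      using cX by (simp add: powr_divide powr_diff)
    finally have "(\<Sum>x\<in>UNIV. ?a x powr p * measure_pmf.expectation (binomial_pmf m (?a x)) ?w) \<le>
       c * ?k powr (1 - p/2) * real m powr (-(p/2)) + ?k * (B * real m powr (-p))"
      using c0 by (simp add: mult_right_mono mult_left_mono)
    then have "(1 - s) powr (1 - p) * (\<Sum>x\<in>UNIV. ?a x powr p * measure_pmf.expectation (binomial_pmf m (?a x)) ?w) \<le>
      (1 - s) powr (1 - p) * (c * ?k powr (1 - p/2) * real m powr (-(p/2)) + ?k * (B * real m powr (-p)))"
      by (rule mult_left_mono) simp
    then show "joint_risk p m (n m) P (joint_composition qX qY (n m)) \<le>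
      (1 - s) powr (1 - p) * (c * ?k powr (1 - p/2) * real m powr (-(p/2)) + ?k * (B * real m powr (-p)))
      + s powr (1 - p) * worst_risk p (n m) (qX (n m))"
      using joint_risk_joint_composition_le[OF p(1) s, of m "n m" P qX qY] by linarith
  qed simp
  have n_top: "filterlim n at_top at_top"
  proof -
    have "filterlim (\<lambda>m. real (n m)) at_top at_top"
    proof (rule filterlim_at_top_mono[OF filterlim_real_sequentially])
      show "eventually (\<lambda>m. real m \<le> real (n m)) at_top"
        using landau_o.smallD[OF n, of 1] by simp
    qed
    then have "eventually (\<lambda>m. real Z \<le> real (n m)) at_top" for Z :: nat
      by (simp only: filterlim_at_top)
    then show ?thesis by (simp add: filterlim_at_top)
  qed
  define M where "M = gauss_risk TYPE('x) p + ?k"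
  have worstX: "eventually (\<lambda>N. worst_risk p N (qX N) \<le> 2 * (real N powr (-(p/2)) * M)) at_top"
  proof -
    have "eventually (\<lambda>N. worst_risk p N (qX N) \<le> (1 + 1) * minimax_risk TYPE('x) p N) at_top"
    proof (rule asymp_equiv_eventually_le)
      show "0 \<le> minimax_risk TYPE('x) p N" for N
        unfolding minimax_risk_def using p by (intro cINF_greatest worst_risk_nonneg) auto
    qed (use qX in \<open>auto simp: first_order_minimax_optimal_def\<close>)
    moreover have "eventually (\<lambda>N. clt_error p N < 1) at_top"
      using clt_error_tendsto_0[OF p] by (intro order_tendstoD(2)) auto
    ultimately show ?thesis using eventually_ge_at_top[of 1]
    proof eventually_elim
      case (elim N)
      have "minimax_risk TYPE('x) p N \<le> real N powr (-(p/2)) * (gauss_risk TYPE('x) p + ?k * clt_error p N)"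
        using p elim cX by (intro minimax_risk_le_gauss) auto
      also have "\<dots> \<le> real N powr (-(p/2)) * M"
        unfolding M_def using elim by (intro mult_left_mono add_left_mono) auto
      finally show ?case using elim(1) by simp
    qed
  qed
  have worstXn: "eventually (\<lambda>m. worst_risk p (n m) (qX (n m)) \<le> 2 * (real (n m) powr (-(p/2)) * M)) at_top"
    using n_top worstX by (rule eventually_compose_filterlim[rotated])
  \<comment> \<open>The risk bound rescaled by m powr (p/2). The contribution of small counts decays
    like m powr (-(p/2)), that of the marginal like (m / n) powr (p/2), which vanishes because m =
    o(n).\<close>
  define V where "V m = (1 - s) powr (1 - p) * (c * ?k powr (1 - p/2) + ?k * (B * real m powr (-(p/2))))
      + s powr (1 - p) * (2 * M * (real m / real (n m)) powr (p/2))" for m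
  have "V \<longlonglongrightarrow> (1 - s) powr (1 - p) * (c * ?k powr (1 - p/2) + ?k * (B * 0)) + s powr (1 - p) * (2 * M * 0)"
  proof -
    have "(\<lambda>m. real m / real (n m)) \<longlonglongrightarrow> 0" using smalloD_tendsto[OF n] .
    then have "(\<lambda>m. (real m / real (n m)) powr (p/2)) \<longlonglongrightarrow> 0 powr (p/2)"
      using p by (intro tendsto_powr') auto
    moreover have "(\<lambda>m. real m powr (-(p/2))) \<longlonglongrightarrow> 0"
      using p by (intro tendsto_neg_powr filterlim_real_sequentially) auto
    ultimately show ?thesis unfolding V_def[abs_def] using p by (intro tendsto_intros) auto
  qed
  then have "eventually (\<lambda>m. V m < c') at_top"
    using sc by (intro order_tendstoD(2)) (auto simp: c_def)
  then show ?thesis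
    using worstXn eventually_ge_at_top[of 1] unfolding W_def[symmetric]
  proof eventually_elim
    case (elim m)
    have "real m powr (p/2) * W m \<le> real m powr (p/2) * ((1 - s) powr (1 - p) * (c * ?k powr (1 - p/2) * real m powr (-(p/2)) + ?k * (B * real m powr (-p)))
      + s powr (1 - p) * (2 * (real (n m) powr (-(p/2)) * M)))"
      using joint[OF elim(3)] mult_left_mono[OF elim(2), of "s powr (1 - p)"] by (intro mult_left_mono) auto
    also have "\<dots> = (1 - s) powr (1 - p) * (c * ?k powr (1 - p/2) * (real m powr (p/2) * real m powr (-(p/2))) + ?k * (B * (real m powr (p/2) * real m powr (-p))))
      + s powr (1 - p) * (2 * M * (real m powr (p/2) * real (n m) powr (-(p/2))))"
      by (simp add: algebra_simps)
    also have "\<dots> = V m"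
    proof -
      have "real m powr (p/2) * real m powr (-(p/2)) = 1" "real m powr (p/2) * real m powr (-p) = real m powr (-(p/2))"
        using elim(3) by (simp_all add: powr_add[symmetric])
      moreover have "real m powr (p/2) * real (n m) powr (-(p/2)) = (real m / real (n m)) powr (p/2)"
        by (simp add: powr_divide powr_minus_divide)
      ultimately show ?thesis by (simp add: V_def)
    qed
    finally show ?case using elim(1) by (simp add: W_def)
  qed
qed

section \<open>The Bayes lower bound\<close>

text \<open>The uniform default makes this a probability vector for every \<open>g\<close>; the
  prior density vanishes where the default applies.\<close>

definition row_weight :: "('y::finite \<Rightarrow> real) \<Rightarrow> 'y \<Rightarrow> real" where
  "row_weight g y = (if \<forall>b. 0 < g b then g y / coord_sum g else 1 / real CARD('y))"

lemma coord_sum_pos: "(\<And>b. 0 < g b) \<Longrightarrow> 0 < coord_sum g"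
  unfolding coord_sum_def by (intro sum_pos) auto

lemma row_weight_nonneg: "0 \<le> row_weight g y"
  using coord_sum_pos[of g] by (auto simp: row_weight_def less_imp_le)

lemma sum_row_weight: "(\<Sum>y\<in>UNIV. row_weight g y) = 1" for g :: "'a::finite \<Rightarrow> real"
proof (cases "\<forall>b. 0 < g b")
  case True
  then have "row_weight g = (\<lambda>y. g y / coord_sum g)" by (simp add: row_weight_def fun_eq_iff)
  then show ?thesis
    using coord_sum_pos[of g] True by (simp add: sum_divide_distrib[symmetric] coord_sum_def)
next
  case False
  then have "row_weight g = (\<lambda>y. 1 / real CARD('a))" by (auto simp: row_weight_def fun_eq_iff)
  then show ?thesis by simp
qed

lemma row_weight_le_1: "row_weight g y \<le> 1"
  using member_le_sum[of y UNIV "row_weight g"] by (simp add: row_weight_nonneg sum_row_weight)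

lemma measurable_row_weight: "(\<lambda>g. row_weight g y) \<in> borel_measurable gvol"
  using measurable_gvol_component [measurable] unfolding row_weight_def by measurable

lemma edens_row_weight_cong:
  assumes "\<And>b. a b \<ge> 1"
  shows "edens a g * f (row_weight g) = edens a g * f (\<lambda>y. g y / coord_sum g)"
proof (cases "edens a g = 0")
  case False
  then have "0 < g b" for b using edens_zero[of a g b] assms by force
  then have "row_weight g = (\<lambda>y. g y / coord_sum g)" by (simp add: row_weight_def fun_eq_iff)
  then show ?thesis by simp
qed simp

text \<open>The prior lives on unnormalised gamma vectors; the induced law of
  \<open>row_weight\<close> is the symmetric Dirichlet law with parameter \<alpha> + 1.\<close>

definition row_prior :: "nat \<Rightarrow> ('y::finite \<Rightarrow> real) measure" where
  "row_prior \<alpha> = density gvol (\<lambda>g. ennreal (edens (\<lambda>_. \<alpha>) g))"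

lemma sets_row_prior [measurable_cong, simp]: "sets (row_prior \<alpha>) = sets gvol"
  by (simp add: row_prior_def)

lemma space_row_prior [simp]: "space (row_prior \<alpha>) = UNIV"
  by (simp add: row_prior_def)

lemma prob_space_row_prior: "prob_space (row_prior \<alpha>)"
  unfolding row_prior_def by (rule prob_space_edens)

lemma nn_integral_row_prior:
  assumes [measurable]: "f \<in> borel_measurable gvol" and "\<And>g. 0 \<le> f g"
  shows "(\<integral>\<^sup>+g. ennreal (f g) \<partial>row_prior \<alpha>) = (\<integral>\<^sup>+g. ennreal (edens (\<lambda>_. \<alpha>) g * f g) \<partial>gvol)"
  unfolding row_prior_def using assms(2)
  by (subst nn_integral_density) (auto simp: ennreal_mult edens_nonneg)

text \<open>A lower bound for the posterior \<open>p\<close>-th absolute deviation of the weight of \<open>y\<close>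
  from any point; the shapes of the posterior are \<open>a b + 1\<close>.\<close>

definition post_bound :: "real \<Rightarrow> real \<Rightarrow> real \<Rightarrow> ('y::finite \<Rightarrow> nat) \<Rightarrow> 'y \<Rightarrow> real" where
  "post_bound p \<epsilon> v0 a y = (if v0 \<le> post_var a y
     then (shape_sum a + p) powr (-p) * ((1 - \<epsilon>) * gauss_moment p * post_var a y powr (p/2)) else 0)"

lemma post_bound_nonneg: "1 \<le> p \<Longrightarrow> p \<le> 2 \<Longrightarrow> \<epsilon> < 1 \<Longrightarrow> 0 \<le> post_bound p \<epsilon> v0 a y"
  using gauss_moment_pos[of p] by (simp add: post_bound_def)

text \<open>The bound on the posterior deviation, multiplied through by the marginal likelihood. The
  constant of the conjugacy lemma appears as a factor on both sides.\<close>

lemma row_prior_bayes: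
  fixes N :: "'y::finite \<Rightarrow> nat"
  assumes p: "1 \<le> p" "p \<le> 2" and \<epsilon>: "\<epsilon> < 1" and \<alpha>: "\<alpha> \<ge> 1" and q: "0 \<le> q"
    and v0: "moment_threshold TYPE('y) p \<epsilon> v0"
  shows "ennreal (post_bound p \<epsilon> v0 (\<lambda>b. \<alpha> + N b) y) * (\<integral>\<^sup>+g. ennreal (\<Prod>b\<in>UNIV. row_weight g b ^ N b) \<partial>row_prior \<alpha>)
    \<le> (\<integral>\<^sup>+g. ennreal ((\<Prod>b\<in>UNIV. row_weight g b ^ N b) * \<bar>row_weight g y - q\<bar> powr p) \<partial>row_prior \<alpha>)"
proof -
  note measurable_row_weight[measurable] measurable_gvol_component[measurable]
  define a where "a = (\<lambda>b :: 'y. \<alpha> + N b)"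
  \<comment> \<open>the weights are at most 1, so truncating the estimate at 1 does not increase the loss\<close>
  define q' where "q' = min q 1"
  let ?\<alpha> = "\<lambda>_ :: 'y. \<alpha>"
  have q': "0 \<le> q'" "q' \<le> 1" using q by (auto simp: q'_def)
  have a1: "a b \<ge> 1" for b using \<alpha> by (simp add: a_def)
  let ?F = "\<lambda>g :: 'y \<Rightarrow> real. ennreal (\<bar>g y / coord_sum g - q'\<bar> powr p)"
  have scale: "coord_sum (\<lambda>b. c * g b) = c * coord_sum g" for c and g :: "'y \<Rightarrow> real"
    by (simp add: coord_sum_def sum_distrib_left)
  have homF: "homogeneous 0 ?F" by (simp add: homogeneous_def scale)
  have hom1: "homogeneous 0 (\<lambda>_. 1 :: ennreal)" by (simp add: homogeneous_def)
  obtain \<zeta> where \<zeta>: "\<And>F. F \<in> borel_measurable gvol \<Longrightarrow> homogeneous 0 F \<Longrightarrow>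
    (\<integral>\<^sup>+g. ennreal (edens ?\<alpha> g * (\<Prod>b\<in>UNIV. (g b / coord_sum g) ^ N b)) * F g \<partial>gvol) =
    \<zeta> * (\<integral>\<^sup>+g. ennreal (edens a g) * F g \<partial>gvol)"
    using nn_integral_edens_posterior[of ?\<alpha> N] \<alpha> unfolding a_def by blast
  have post: "ennreal (post_bound p \<epsilon> v0 a y) \<le> (\<integral>\<^sup>+g. ennreal (edens a g) * ?F g \<partial>gvol)"
  proof (cases "v0 \<le> post_var a y")
    case True
    have "ennreal (post_bound p \<epsilon> v0 a y) =
        ennreal ((shape_sum a + p) powr (-p)) * ennreal ((1 - \<epsilon>) * gauss_moment p * post_var a y powr (p/2))"
      using True p \<epsilon> gauss_moment_pos[OF p] by (simp add: post_bound_def ennreal_mult)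
    also have "\<dots> \<le> ennreal ((shape_sum a + p) powr (-p)) * (\<integral>\<^sup>+g. ennreal (edens a g * \<bar>g y - q' * coord_sum g\<bar> powr p) \<partial>gvol)"
      using v0[unfolded moment_threshold_def, rule_format, OF q' True] by (intro mult_left_mono) auto
    also have "\<dots> \<le> (\<integral>\<^sup>+g. ennreal (edens a g * \<bar>g y / coord_sum g - q'\<bar> powr p) \<partial>gvol)"
      using p a1 by (intro nn_integral_edens_ratio_ge) auto
    finally show ?thesis by (simp add: ennreal_mult edens_nonneg)
  qed (simp add: post_bound_def)
  have "ennreal (post_bound p \<epsilon> v0 a y) * (\<integral>\<^sup>+g. ennreal (\<Prod>b\<in>UNIV. row_weight g b ^ N b) \<partial>row_prior \<alpha>) =
     ennreal (post_bound p \<epsilon> v0 a y) * (\<integral>\<^sup>+g. ennreal (edens ?\<alpha> g * (\<Prod>b\<in>UNIV. (g b / coord_sum g) ^ N b)) * 1 \<partial>gvol)"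
  proof -
    have "edens ?\<alpha> g * (\<Prod>b\<in>UNIV. row_weight g b ^ N b) = edens ?\<alpha> g * (\<Prod>b\<in>UNIV. (g b / coord_sum g) ^ N b)" for g
      using \<alpha> by (intro edens_row_weight_cong) auto
    note eq = this
    have "(\<integral>\<^sup>+g. ennreal (\<Prod>b\<in>UNIV. row_weight g b ^ N b) \<partial>row_prior \<alpha>) =
       (\<integral>\<^sup>+g. ennreal (edens ?\<alpha> g * (\<Prod>b\<in>UNIV. row_weight g b ^ N b)) \<partial>gvol)"
      by (rule nn_integral_row_prior) (auto intro!: prod_nonneg simp: row_weight_nonneg)
    then show ?thesis by (simp only: eq mult_1_right)
  qed
  \<comment> \<open>The constant function 1 in place of \<open>F\<close> identifies \<zeta> as the
    marginal likelihood of the counts.\<close>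
  also have "\<dots> = ennreal (post_bound p \<epsilon> v0 a y) * \<zeta>"
    by (subst \<zeta>[OF _ hom1]) (simp_all add: nn_integral_edens)
  also have "\<dots> \<le> \<zeta> * (\<integral>\<^sup>+g. ennreal (edens a g) * ?F g \<partial>gvol)"
    using post by (subst mult.commute) (intro mult_left_mono, auto)
  also have "\<dots> = (\<integral>\<^sup>+g. ennreal (edens ?\<alpha> g * (\<Prod>b\<in>UNIV. (g b / coord_sum g) ^ N b)) * ?F g \<partial>gvol)"
    by (rule \<zeta>[OF _ homF, symmetric]) measurable
  also have "\<dots> \<le> (\<integral>\<^sup>+g. ennreal (edens ?\<alpha> g * ((\<Prod>b\<in>UNIV. row_weight g b ^ N b) * \<bar>row_weight g y - q\<bar> powr p)) \<partial>gvol)"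
  proof (intro nn_integral_mono)
    fix g :: "'y \<Rightarrow> real"
    have "edens ?\<alpha> g * ((\<Prod>b\<in>UNIV. (g b / coord_sum g) ^ N b) * \<bar>g y / coord_sum g - q'\<bar> powr p) =
       edens ?\<alpha> g * ((\<Prod>b\<in>UNIV. row_weight g b ^ N b) * \<bar>row_weight g y - q'\<bar> powr p)"
      using \<alpha> by (intro edens_row_weight_cong[symmetric]) auto
    also have "\<dots> \<le> edens ?\<alpha> g * ((\<Prod>b\<in>UNIV. row_weight g b ^ N b) * \<bar>row_weight g y - q\<bar> powr p)"
      using p row_weight_le_1[of g y] by (intro mult_left_mono powr_mono2) (auto simp: edens_nonneg q'_def row_weight_nonneg intro!: prod_nonneg)
    finally have le: "edens ?\<alpha> g * ((\<Prod>b\<in>UNIV. (g b / coord_sum g) ^ N b) * \<bar>g y / coord_sum g - q'\<bar> powr p) \<le>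
       edens ?\<alpha> g * ((\<Prod>b\<in>UNIV. row_weight g b ^ N b) * \<bar>row_weight g y - q\<bar> powr p)" .
    have "edens ?\<alpha> g * (\<Prod>b\<in>UNIV. row_weight g b ^ N b) = edens ?\<alpha> g * (\<Prod>b\<in>UNIV. (g b / coord_sum g) ^ N b)"
      using \<alpha> by (intro edens_row_weight_cong) auto
    moreover have "0 \<le> edens ?\<alpha> g * (\<Prod>b\<in>UNIV. row_weight g b ^ N b)"
      by (auto intro!: mult_nonneg_nonneg prod_nonneg simp: edens_nonneg row_weight_nonneg)
    ultimately have nn: "0 \<le> edens ?\<alpha> g * (\<Prod>b\<in>UNIV. (g b / coord_sum g) ^ N b)" by (simp only:)
    show "ennreal (edens ?\<alpha> g * (\<Prod>b\<in>UNIV. (g b / coord_sum g) ^ N b)) * ?F g \<le>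
       ennreal (edens ?\<alpha> g * ((\<Prod>b\<in>UNIV. row_weight g b ^ N b) * \<bar>row_weight g y - q\<bar> powr p))"
      using le nn by (simp add: ennreal_mult[symmetric] mult.assoc ennreal_leI)
  qed
  also have "\<dots> = (\<integral>\<^sup>+g. ennreal ((\<Prod>b\<in>UNIV. row_weight g b ^ N b) * \<bar>row_weight g y - q\<bar> powr p) \<partial>row_prior \<alpha>)"
    by (rule nn_integral_row_prior[symmetric]) (auto intro!: mult_nonneg_nonneg prod_nonneg simp: row_weight_nonneg)
  finally show ?thesis by (simp add: a_def)
qed

section \<open>Concentration of the prior at the uniform row\<close>

lemma erlang_central_second_moment:
  "(\<integral>\<^sup>+x. ennreal (erlang_density k 1 x * (x - (real k + 1))^2) \<partial>lborel) = ennreal (real k + 1)"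
proof -
  define s where "s = real k + 1"
  let ?e = "erlang_density k 1"
  have m: "(\<integral>\<^sup>+x. ennreal (?e x * x ^ i) \<partial>lborel) = ennreal (fact (k + i) / fact k)" for i
    using nn_integral_erlang_ith_moment[of 1 k i] by simp
  \<comment> \<open>The cross term of the square is added on both sides instead of being subtracted,
    so that all integrals stay in \<open>ennreal\<close>.\<close>
  have "(\<integral>\<^sup>+x. ennreal (?e x * (x - s)^2) \<partial>lborel) + ennreal (2 * s) * (\<integral>\<^sup>+x. ennreal (?e x * x ^ 1) \<partial>lborel)
    = (\<integral>\<^sup>+x. ennreal (?e x * (x - s)^2) + ennreal (2 * s) * ennreal (?e x * x ^ 1) \<partial>lborel)"
    by (subst nn_integral_add) (auto simp: nn_integral_cmult)
  also have "\<dots> = (\<integral>\<^sup>+x. ennreal (?e x * x ^ 2) + ennreal (s^2) * ennreal (?e x * x ^ 0) \<partial>lborel)"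
  proof (intro nn_integral_cong)
    fix x :: real
    show "ennreal (?e x * (x - s)^2) + ennreal (2 * s) * ennreal (?e x * x ^ 1) = ennreal (?e x * x ^ 2) + ennreal (s^2) * ennreal (?e x * x ^ 0)"
    proof (cases "x \<ge> 0")
      case True
      have "?e x * (x - s)^2 + 2 * s * (?e x * x) = ?e x * x^2 + s^2 * ?e x"
        by (simp add: power2_eq_square algebra_simps)
      then show ?thesis using True
        by (simp add: s_def ennreal_mult[symmetric] ennreal_plus[symmetric] del: ennreal_plus)
    qed (simp add: erlang_density_def)
  qed
  also have "\<dots> = ennreal (fact (k + 2) / fact k) + ennreal (s^2) * ennreal (fact (k + 0) / fact k)"
    by (subst nn_integral_add) (auto simp: nn_integral_cmult m simp del: power_0)
  also have "\<dots> = ennreal (s + 2 * s * s)"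
  proof -
    have "fact (k + 2) / fact k = (s + 1) * s" by (simp add: s_def field_simps)
    then show ?thesis
      by (simp add: s_def ennreal_mult[symmetric] ennreal_plus[symmetric] power2_eq_square algebra_simps del: ennreal_plus)
  qed
  also have "ennreal (2 * s) * (\<integral>\<^sup>+x. ennreal (?e x * x ^ 1) \<partial>lborel) = ennreal (2 * s * s)"
  proof -
    have "fact (k + 1) / fact k = s" by (simp add: s_def)
    then show ?thesis unfolding m by (simp add: s_def ennreal_mult[symmetric] del: ennreal_plus)
  qed
  finally have "(\<integral>\<^sup>+x. ennreal (?e x * (x - s)^2) \<partial>lborel) + ennreal (2 * s * s) = ennreal s + ennreal (2 * s * s)"
    by (simp add: s_def)
  then show ?thesis by (simp add: s_def)
qed

lemma nn_integral_edens_component: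
  assumes [measurable]: "f \<in> borel_measurable borel" and f: "\<And>x. 0 \<le> f x"
  shows "(\<integral>\<^sup>+g. ennreal (edens a g * f (g y)) \<partial>gvol) = (\<integral>\<^sup>+x. ennreal (erlang_density (a y) 1 x * f x) \<partial>lborel)"
proof -
  interpret product_sigma_finite "\<lambda>_. lborel :: real measure" ..
  let ?h = "\<lambda>b x. if b = y then ennreal (erlang_density (a b) 1 x * f x) else ennreal (erlang_density (a b) 1 x)"
  have "(\<integral>\<^sup>+g. ennreal (edens a g * f (g y)) \<partial>gvol) = (\<integral>\<^sup>+g. (\<Prod>b\<in>UNIV. ?h b (g b)) \<partial>gvol)"
  proof (intro nn_integral_cong)
    fix g
    have "edens a g * f (g y) = (\<Prod>b\<in>UNIV. erlang_density (a b) 1 (g b) * (if b = y then f (g b) else 1))"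
      by (simp add: edens_def prod.distrib)
    also have "ennreal \<dots> = (\<Prod>b\<in>UNIV. ennreal (erlang_density (a b) 1 (g b) * (if b = y then f (g b) else 1)))"
      using f by (intro prod_ennreal[symmetric]) auto
    also have "\<dots> = (\<Prod>b\<in>UNIV. ?h b (g b))" by (intro prod.cong) auto
    finally show "ennreal (edens a g * f (g y)) = (\<Prod>b\<in>UNIV. ?h b (g b))" .
  qed
  also have "\<dots> = (\<Prod>b\<in>UNIV. \<integral>\<^sup>+x. ?h b x \<partial>lborel)"
    unfolding gvol_def by (rule product_nn_integral_prod) auto
  also have "\<dots> = (\<Prod>b\<in>UNIV. if b = y then (\<integral>\<^sup>+x. ennreal (erlang_density (a b) 1 x * f x) \<partial>lborel) else 1)"
    using nn_integral_erlang_ith_moment[of 1 "a b" 0 for b] by (intro prod.cong) auto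
  finally show ?thesis by simp
qed

text \<open>If the right side is below 1, the distance e of \<open>g\<close> from the constant
  vector \<open>s\<close> satisfies 4 * e <= s. The sum is then at least 3/4 * s, and the weight
  deviates by at most 2 * e / (3/4 * s). The constant 20 exceeds 16, which gives the first
  inequality, and 64/9, the square of 8/3.\<close>

lemma row_weight_dev_le:
  fixes g :: "'y::finite \<Rightarrow> real"
  assumes g: "\<And>b. 0 < g b" and s: "s > 0"
  shows "(row_weight g y - 1 / real CARD('y))^2 \<le> 20 / s^2 * (\<Sum>b\<in>UNIV. (g b - s)^2)"
proof (cases "20 / s^2 * (\<Sum>b\<in>UNIV. (g b - s)^2) \<ge> 1")
  case True
  have "\<bar>row_weight g y - 1 / real CARD('y)\<bar> \<le> 1"
  proof -
    have "0 \<le> 1 / real CARD('y)" "1 / real CARD('y) \<le> 1" by (simp_all add: divide_le_eq Suc_le_eq)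
    then show ?thesis using row_weight_le_1[of g y] row_weight_nonneg[of g y] unfolding abs_le_iff by linarith
  qed
  then have "(row_weight g y - 1 / real CARD('y))^2 \<le> 1" by (simp add: abs_square_le_1)
  then show ?thesis using True by linarith
next
  case False
  define d where "d = real CARD('y)"
  have d: "d \<ge> 1" by (simp add: d_def Suc_le_eq)
  define e where "e = sqrt (\<Sum>b\<in>UNIV. (g b - s)^2)"
  have e2: "e^2 = (\<Sum>b\<in>UNIV. (g b - s)^2)" by (simp add: e_def sum_nonneg)
  have e0: "e \<ge> 0" by (simp add: e_def sum_nonneg)
  have dev: "\<bar>g b - s\<bar> \<le> e" for b
  proof -
    have "(g b - s)^2 \<le> e^2" unfolding e2 by (rule member_le_sum) auto
    then show ?thesis using e0 by (simp add: abs_le_square_iff[symmetric])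
  qed
  have "20 * e^2 < s^2" using False s by (simp add: e2[symmetric] divide_less_eq not_le)
  moreover have "(4 * e)^2 = 16 * e^2" by (simp add: power_mult_distrib)
  ultimately have "(4 * e)^2 \<le> s^2" using zero_le_power2[of e] by linarith
  then have es: "4 * e \<le> s" by (rule power2_le_imp_le) (use s in simp)
  have "\<bar>coord_sum g - d * s\<bar> \<le> d * e"
  proof -
    have "coord_sum g - d * s = (\<Sum>b\<in>UNIV. g b - s)" by (simp add: coord_sum_def d_def sum_subtractf)
    also have "\<bar>\<dots>\<bar> \<le> (\<Sum>b\<in>(UNIV :: 'y set). e)" by (intro order.trans[OF sum_abs] sum_mono dev)
    finally show ?thesis by (simp add: d_def)
  qed
  moreover have "d * (3 / 4 * s) \<le> d * (s - e)" using es d by (intro mult_left_mono) auto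
  ultimately have S: "d * (3 / 4 * s) \<le> coord_sum g" by (simp add: algebra_simps abs_le_iff)
  have "1 * (3 / 4 * s) \<le> d * (3 / 4 * s)" using d s by (intro mult_right_mono) auto
  then have S': "3 / 4 * s \<le> coord_sum g" using S by simp
  have "\<bar>row_weight g y - 1 / d\<bar> * coord_sum g = \<bar>g y - coord_sum g / d\<bar>"
  proof -
    have "(row_weight g y - 1 / d) * coord_sum g = g y - coord_sum g / d"
      using g coord_sum_pos[of g] by (simp add: row_weight_def left_diff_distrib)
    then show ?thesis using coord_sum_pos[of g] g by (metis abs_mult abs_of_pos)
  qed
  also have "\<dots> \<le> \<bar>g y - s\<bar> + \<bar>coord_sum g - d * s\<bar> / d"
  proof -
    have "g y - coord_sum g / d = (g y - s) - (coord_sum g - d * s) / d" using d by (simp add: field_simps)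
    then show ?thesis using d abs_triangle_ineq4[of "g y - s" "(coord_sum g - d * s) / d"] by simp
  qed
  also have "\<dots> \<le> e + e"
    using dev[of y] \<open>\<bar>coord_sum g - d * s\<bar> \<le> d * e\<close> d by (intro add_mono) (auto simp: divide_le_eq mult.commute)
  finally have "\<bar>row_weight g y - 1 / d\<bar> * coord_sum g \<le> 2 * e" by simp
  moreover have "\<bar>row_weight g y - 1 / d\<bar> * (3 / 4 * s) \<le> \<bar>row_weight g y - 1 / d\<bar> * coord_sum g"
    using S' by (intro mult_left_mono) auto
  ultimately have "\<bar>row_weight g y - 1 / d\<bar> \<le> 8 / 3 * e / s" using s by (simp add: field_simps)
  then have "\<bar>row_weight g y - 1 / d\<bar>^2 \<le> (8 / 3 * e / s)^2" by (intro power_mono) auto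
  also have "\<dots> = 64 / 9 * (e^2 / s^2)" by (simp add: power_mult_distrib power_divide)
  also have "\<dots> \<le> 20 * (e^2 / s^2)" by (intro mult_right_mono) auto
  finally show ?thesis by (simp add: e2 d_def)
qed

text \<open>Every gamma coordinate has mean and variance \<alpha> + 1, so its relative variance, and
  with it the spread of the weights, is of order 1 / \<alpha>.\<close>

lemma row_prior_dev_le:
  assumes \<alpha>: "\<alpha> \<ge> 1"
  shows "(\<integral>\<^sup>+g. ennreal ((row_weight g (y :: 'y::finite) - 1 / real CARD('y))^2) \<partial>row_prior \<alpha>) \<le> ennreal (20 * real CARD('y) / real \<alpha>)"
proof -
  note measurable_row_weight[measurable] measurable_gvol_component[measurable]
  define s where "s = real \<alpha> + 1"
  have s: "s > 0" by (simp add: s_def)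
  let ?\<alpha> = "\<lambda>_ :: 'y. \<alpha>"
  have "(\<integral>\<^sup>+g. ennreal ((row_weight g y - 1 / real CARD('y))^2) \<partial>row_prior \<alpha>) =
      (\<integral>\<^sup>+g. ennreal (edens ?\<alpha> g * (row_weight g y - 1 / real CARD('y))^2) \<partial>gvol)"
    by (rule nn_integral_row_prior) auto
  also have "\<dots> \<le> (\<integral>\<^sup>+g. (\<Sum>b\<in>UNIV. ennreal (20 / s^2) * ennreal (edens ?\<alpha> g * (g b - s)^2)) \<partial>gvol)"
  proof (intro nn_integral_mono)
    fix g :: "'y \<Rightarrow> real"
    have "edens ?\<alpha> g * (row_weight g y - 1 / real CARD('y))^2 \<le> (\<Sum>b\<in>UNIV. 20 / s^2 * (edens ?\<alpha> g * (g b - s)^2))"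
    proof (cases "edens ?\<alpha> g = 0")
      case False
      then have "0 < g b" for b using edens_zero[of ?\<alpha> g b] \<alpha> by force
      then have "edens ?\<alpha> g * (row_weight g y - 1 / real CARD('y))^2 \<le> edens ?\<alpha> g * (20 / s^2 * (\<Sum>b\<in>UNIV. (g b - s)^2))"
        by (intro mult_left_mono row_weight_dev_le s) (auto simp: edens_nonneg)
      then show ?thesis by (simp add: sum_distrib_left sum_divide_distrib mult_ac)
    qed simp
    then have "ennreal (edens ?\<alpha> g * (row_weight g y - 1 / real CARD('y))^2) \<le> ennreal (\<Sum>b\<in>UNIV. 20 / s^2 * (edens ?\<alpha> g * (g b - s)^2))"
      by (rule ennreal_leI)
    also have "\<dots> = (\<Sum>b\<in>UNIV. ennreal (20 / s^2 * (edens ?\<alpha> g * (g b - s)^2)))"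
      by (intro sum_ennreal[symmetric]) (simp add: edens_nonneg)
    also have "\<dots> = (\<Sum>b\<in>UNIV. ennreal (20 / s^2) * ennreal (edens ?\<alpha> g * (g b - s)^2))"
      by (intro sum.cong refl ennreal_mult) (auto simp: edens_nonneg)
    finally show "ennreal (edens ?\<alpha> g * (row_weight g y - 1 / real CARD('y))^2) \<le> (\<Sum>b\<in>UNIV. ennreal (20 / s^2) * ennreal (edens ?\<alpha> g * (g b - s)^2))" .
  qed
  also have "\<dots> = (\<Sum>b\<in>(UNIV :: 'y set). ennreal (20 / s^2) * (\<integral>\<^sup>+g. ennreal (edens ?\<alpha> g * (g b - s)^2) \<partial>gvol))"
    by (subst nn_integral_sum) (auto intro!: sum.cong nn_integral_cmult)
  also have "\<dots> = (\<Sum>b\<in>(UNIV :: 'y set). ennreal (20 / s^2) * ennreal s)"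
  proof (intro sum.cong refl arg_cong[where f="\<lambda>z. _ * z"])
    fix b :: 'y
    have "(\<integral>\<^sup>+g. ennreal (edens ?\<alpha> g * (g b - s)^2) \<partial>gvol) = (\<integral>\<^sup>+x. ennreal (erlang_density \<alpha> 1 x * (x - s)^2) \<partial>lborel)"
      by (rule nn_integral_edens_component) auto
    then show "(\<integral>\<^sup>+g. ennreal (edens ?\<alpha> g * (g b - s)^2) \<partial>gvol) = ennreal s"
      unfolding s_def erlang_central_second_moment .
  qed
  also have "\<dots> = ennreal (20 * real CARD('y) / s)"
    using s by (simp add: ennreal_of_nat_eq_real_of_nat ennreal_mult[symmetric] power2_eq_square)
  also have "\<dots> \<le> ennreal (20 * real CARD('y) / real \<alpha>)"
    using \<alpha> by (intro ennreal_leI divide_left_mono) (auto simp: s_def)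
  finally show ?thesis .
qed

section \<open>The prior on joint distributions and its likelihood\<close>

lemma pmf_bind_Pair:
  fixes A :: "'x::finite pmf"
  shows "pmf (bind_pmf A (\<lambda>x. map_pmf (Pair x) (B x))) (x, y) = pmf A x * pmf (B x) y"
proof -
  have *: "pmf (map_pmf (Pair x') (B x')) (x, y) = (if x' = x then pmf (B x) y else 0)" for x'
  proof (cases "x' = x")
    case True
    then show ?thesis
      using pmf_map_inj'[of "Pair x" "B x" y] by (simp add: inj_on_def)
  qed (auto simp: pmf_eq_0_set_pmf)
  show ?thesis
    unfolding pmf_bind *
    by (subst integral_measure_pmf[of UNIV]) (auto simp: if_distrib sum.delta cong: if_cong)
qed

lemma pmf_replicate_pmf:
  "pmf (replicate_pmf m P) l = (if length l = m then prod_list (map (pmf P) l) else 0)"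
proof (induction m arbitrary: l)
  case 0
  then show ?case by (auto simp: pmf_return)
next
  case (Suc m)
  have eq: "replicate_pmf (Suc m) P = map_pmf (\<lambda>(z, l). z # l) (pair_pmf P (replicate_pmf m P))"
    by (simp add: pair_pmf_def map_pmf_def bind_assoc_pmf bind_return_pmf)
  show ?case
  proof (cases l)
    case Nil
    have "[] \<notin> set_pmf (replicate_pmf (Suc m) P)" by (auto simp: set_replicate_pmf)
    then show ?thesis using Nil by (simp add: pmf_eq_0_set_pmf del: replicate_pmf.simps)
  next
    case (Cons z l')
    have "pmf (replicate_pmf (Suc m) P) ((\<lambda>(z, l). z # l) (z, l')) = pmf (pair_pmf P (replicate_pmf m P)) (z, l')"
      unfolding eq by (rule pmf_map_inj') (auto simp: inj_on_def)
    then show ?thesis using Cons by (simp add: pmf_pair Suc.IH del: replicate_pmf.simps)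
  qed
qed

lemma finite_lists_of_length [simp]: "finite {l :: 'a::finite list. length l = m}"
  using finite_lists_length_eq[of "UNIV :: 'a set" m] by simp

lemma expectation_replicate_pmf_eq_sum:
  fixes f :: "'a::finite list \<Rightarrow> real"
  shows "measure_pmf.expectation (replicate_pmf m P) f = (\<Sum>l | length l = m. prod_list (map (pmf P) l) * f l)"
  by (subst integral_measure_pmf[of "{l. length l = m}"])
    (auto simp: set_replicate_pmf pmf_replicate_pmf intro!: sum.cong)

lemma expectation_pair_replicate_pmf_eq_sum:
  fixes f :: "'a::finite list \<times> 'b::finite list \<Rightarrow> real"
  shows "measure_pmf.expectation (pair_pmf (replicate_pmf n P) (replicate_pmf m Q)) f =
    (\<Sum>u | length u = n. pmf (replicate_pmf n P) u * (\<Sum>l | length l = m. prod_list (map (pmf Q) l) * f (u, l)))"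
proof -
  have "measure_pmf.expectation (pair_pmf (replicate_pmf n P) (replicate_pmf m Q)) f =
     (\<Sum>z\<in>{u. length u = n} \<times> {l. length l = m}. pmf (pair_pmf (replicate_pmf n P) (replicate_pmf m Q)) z * f z)"
    by (subst integral_measure_pmf[of "{u. length u = n} \<times> {l. length l = m}"]) (auto simp: set_replicate_pmf)
  also have "\<dots> = (\<Sum>u | length u = n. \<Sum>l | length l = m. pmf (replicate_pmf n P) u * pmf (replicate_pmf m Q) l * f (u, l))"
    unfolding sum.cartesian_product by (intro sum.cong refl) (auto simp: pmf_pair)
  also have "\<dots> = (\<Sum>u | length u = n. pmf (replicate_pmf n P) u * (\<Sum>l | length l = m. prod_list (map (pmf Q) l) * f (u, l)))"
    by (auto intro!: sum.cong simp: sum_distrib_left pmf_replicate_pmf[of m] mult.assoc)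
  finally show ?thesis .
qed

lemma prod_list_map_eq_prod_count:
  fixes f :: "'a::finite \<Rightarrow> 'b::comm_monoid_mult"
  shows "prod_list (map f l) = (\<Prod>z\<in>UNIV. f z ^ count (mset l) z)"
proof (induction l)
  case (Cons a l)
  have "(\<Prod>z\<in>UNIV. f z ^ count (mset (a # l)) z) = (\<Prod>z\<in>UNIV. (if z = a then f z else 1) * f z ^ count (mset l) z)"
    by (intro prod.cong) auto
  then show ?case by (simp add: prod.distrib Cons.IH)
qed simp

definition row_pmf :: "('y::finite \<Rightarrow> real) \<Rightarrow> 'y pmf" where
  "row_pmf g = embed_pmf (row_weight g)"

lemma pmf_row_pmf: "pmf (row_pmf g) y = row_weight g y"
  unfolding row_pmf_def
  by (rule pmf_embed_pmf)
    (auto simp: row_weight_nonneg nn_integral_count_space_finite sum_ennreal sum_row_weight)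

definition uniform_joint :: "('x::finite \<Rightarrow> 'y::finite \<Rightarrow> real) \<Rightarrow> ('x \<times> 'y) pmf" where
  "uniform_joint G = bind_pmf (pmf_of_set UNIV) (\<lambda>x. map_pmf (Pair x) (row_pmf (G x)))"

lemma pmf_uniform_joint:
  "pmf (uniform_joint G) (x :: 'x::finite, y) = row_weight (G x) y / real CARD('x)"
  by (simp add: uniform_joint_def pmf_bind_Pair pmf_row_pmf)

text \<open>The unlabelled sample has the same law for all \<open>G\<close>, hence carries no
  information about the rows; for this reason the lower bound is the same for every
  \<open>n\<close>.\<close>

lemma map_fst_uniform_joint: "map_pmf fst (uniform_joint G) = pmf_of_set UNIV"
  by (simp add: uniform_joint_def map_bind_pmf pmf.map_comp o_def bind_return_pmf')

definition joint_prior :: "nat \<Rightarrow> ('x::finite \<Rightarrow> 'y::finite \<Rightarrow> real) measure" where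
  "joint_prior \<alpha> = Pi\<^sub>M UNIV (\<lambda>_. row_prior \<alpha>)"

lemma prob_space_joint_prior: "prob_space (joint_prior \<alpha>)"
proof -
  interpret product_prob_space "\<lambda>_. row_prior \<alpha>" UNIV
    by (intro product_prob_spaceI prob_space_row_prior)
  show ?thesis unfolding joint_prior_def by (rule prob_space_axioms)
qed

lemma measurable_joint_prior_row:
  "(\<lambda>G. row_weight (G x) y) \<in> borel_measurable (joint_prior \<alpha>)"
proof -
  have "(\<lambda>G. G x) \<in> joint_prior \<alpha> \<rightarrow>\<^sub>M row_prior \<alpha>"
    unfolding joint_prior_def by measurable
  then have "(\<lambda>G. G x) \<in> joint_prior \<alpha> \<rightarrow>\<^sub>M gvol"
    by (simp cong: measurable_cong_sets)
  then show ?thesis by (rule measurable_compose[OF _ measurable_row_weight])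
qed

definition likelihood :: "('x::finite \<Rightarrow> 'y::finite \<Rightarrow> real) \<Rightarrow> ('x \<times> 'y) list \<Rightarrow> real" where
  "likelihood G l = prod_list (map (pmf (uniform_joint G)) l)"

lemma likelihood_nonneg: "0 \<le> likelihood G l"
  unfolding likelihood_def by (intro prod_list_nonneg) auto

text \<open>As the marginal is known, the likelihood is a constant times a product over rows. Under
  the product prior the rows therefore stay independent a posteriori, each with its own Dirichlet
  law.\<close>

lemma likelihood_eq:
  fixes G :: "'x::finite \<Rightarrow> 'y::finite \<Rightarrow> real"
  shows "likelihood G l = (1 / real CARD('x)) ^ length l *
     (\<Prod>x\<in>UNIV. \<Prod>y\<in>UNIV. row_weight (G x) y ^ count (mset l) (x, y))"
proof -
  have "likelihood G l = prod_list (map (\<lambda>z. 1 / real CARD('x) * row_weight (G (fst z)) (snd z)) l)"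
    unfolding likelihood_def
    by (intro arg_cong[where f=prod_list] map_cong refl) (auto simp: pmf_uniform_joint)
  also have "\<dots> = (1 / real CARD('x)) ^ length l * prod_list (map (\<lambda>z. row_weight (G (fst z)) (snd z)) l)"
    by (induction l) auto
  also have "prod_list (map (\<lambda>z. row_weight (G (fst z)) (snd z)) l) =
     (\<Prod>x\<in>UNIV. \<Prod>y\<in>UNIV. row_weight (G x) y ^ count (mset l) (x, y))"
    unfolding prod_list_map_eq_prod_count
    by (simp add: prod.cartesian_product case_prod_beta)
  finally show ?thesis .
qed

lemma measurable_likelihood: "(\<lambda>G. likelihood G l) \<in> borel_measurable (joint_prior \<alpha>)"
  using measurable_joint_prior_row [measurable] unfolding likelihood_eq by measurable

lemma ennreal_sum_sum_sum:
  assumes "\<And>i j k. 0 \<le> w i j k"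
  shows "ennreal (\<Sum>i\<in>A. \<Sum>j\<in>B. \<Sum>k\<in>C. w i j k) = (\<Sum>i\<in>A. \<Sum>j\<in>B. \<Sum>k\<in>C. ennreal (w i j k))"
  by (simp add: assms sum_nonneg)

definition row_counts :: "('x \<times> 'y) list \<Rightarrow> 'x \<Rightarrow> 'y \<Rightarrow> nat" where
  "row_counts l x y = count (mset l) (x, y)"

text \<open>The factor with exponent -p arises because an entry is its row weight divided by the
  number of rows.\<close>

definition bayes_bound :: "real \<Rightarrow> real \<Rightarrow> real \<Rightarrow> nat \<Rightarrow> ('x::finite \<times> 'y::finite) list \<Rightarrow> real" where
  "bayes_bound p \<epsilon> v0 \<alpha> l = (\<Sum>x\<in>UNIV. \<Sum>y\<in>UNIV.
     real CARD('x) powr (-p) * post_bound p \<epsilon> v0 (\<lambda>b. \<alpha> + row_counts l x b) y)"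

section \<open>From posterior losses to the joint minimax risk\<close>

context
  fixes p \<epsilon> v0 :: real and \<alpha> :: nat and ty :: "'y::finite itself"
  assumes p: "1 \<le> p" "p \<le> 2" and \<epsilon>: "\<epsilon> < 1" and \<alpha>: "\<alpha> \<ge> 1"
    and v0: "moment_threshold TYPE('y) p \<epsilon> v0"
begin

text \<open>The integrals factor over rows, and only row \<open>x\<close> meets the loss; the other
  rows contribute the same factors to both sides. With k rows, \<open>q\<close> becomes the estimate
  k * q of the row weight, an arbitrary nonnegative number, so the argument covers estimators with
  unnormalised rows.\<close>

lemma posterior_loss_ge:
  fixes l :: "('x::finite \<times> 'y) list"
  assumes q: "0 \<le> q"
  shows "ennreal (real CARD('x) powr (-p) * post_bound p \<epsilon> v0 (\<lambda>b. \<alpha> + row_counts l x b) y) *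
      (\<integral>\<^sup>+G. ennreal (likelihood G l) \<partial>joint_prior \<alpha>)
    \<le> (\<integral>\<^sup>+G. ennreal (likelihood G l * \<bar>row_weight (G x) y / real CARD('x) - q\<bar> powr p) \<partial>joint_prior \<alpha>)"
proof -
  interpret R: prob_space "row_prior \<alpha> :: ('y \<Rightarrow> real) measure" by (rule prob_space_row_prior)
  interpret product_sigma_finite "\<lambda>_ :: 'x. row_prior \<alpha> :: ('y \<Rightarrow> real) measure" ..
  note measurable_row_weight[measurable]
  let ?k = "real CARD('x)"
  define c where "c = (1 / ?k) ^ length l"
  define \<phi> where "\<phi> x' g = (\<Prod>y\<in>UNIV. row_weight g y ^ row_counts l x' y)" for x' and g :: "'y \<Rightarrow> real"
  define \<beta> where "\<beta> = post_bound p \<epsilon> v0 (\<lambda>b. \<alpha> + row_counts l x b) y"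
  have \<beta>: "0 \<le> \<beta>" unfolding \<beta>_def by (rule post_bound_nonneg[OF p \<epsilon>])
  have \<phi>0: "0 \<le> \<phi> x' g" for x' g unfolding \<phi>_def by (intro prod_nonneg) (simp add: row_weight_nonneg)
  have \<phi>m [measurable]: "\<phi> x' \<in> borel_measurable gvol" for x' unfolding \<phi>_def by measurable
  have c0: "0 \<le> c" by (simp add: c_def)
  have lik: "likelihood G l = c * (\<Prod>x'\<in>UNIV. \<phi> x' (G x'))" for G :: "'x \<Rightarrow> 'y \<Rightarrow> real"
    by (simp add: likelihood_eq c_def \<phi>_def row_counts_def)
  define I where "I x' = (\<integral>\<^sup>+g. ennreal (\<phi> x' g) \<partial>row_prior \<alpha>)" for x'
  define \<psi> where "\<psi> g = \<bar>row_weight g y - ?k * q\<bar> powr p" for g :: "'y \<Rightarrow> real"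
  define J where "J = (\<integral>\<^sup>+g. ennreal (\<phi> x g * \<psi> g) \<partial>row_prior \<alpha>)"
  have \<psi>0: "0 \<le> \<psi> g" for g by (simp add: \<psi>_def)
  have \<psi>m [measurable]: "\<psi> \<in> borel_measurable gvol" unfolding \<psi>_def by measurable
  have IJ: "ennreal \<beta> * I x \<le> J"
    unfolding \<beta>_def I_def J_def \<phi>_def \<psi>_def
    by (rule row_prior_bayes[OF p \<epsilon> \<alpha> _ v0]) (use q in auto)
  have int1: "(\<integral>\<^sup>+G. ennreal (likelihood G l) \<partial>joint_prior \<alpha>) = ennreal c * (\<Prod>x'\<in>UNIV. I x')"
  proof -
    have "(\<integral>\<^sup>+G. ennreal (likelihood G l) \<partial>joint_prior \<alpha>) = (\<integral>\<^sup>+G. ennreal c * (\<Prod>x'\<in>UNIV. ennreal (\<phi> x' (G x'))) \<partial>joint_prior \<alpha>)"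
      using c0 by (intro nn_integral_cong) (simp add: lik ennreal_mult prod_nonneg \<phi>0 prod_ennreal)
    also have "\<dots> = ennreal c * (\<integral>\<^sup>+G. (\<Prod>x'\<in>UNIV. ennreal (\<phi> x' (G x'))) \<partial>joint_prior \<alpha>)"
      unfolding joint_prior_def by (rule nn_integral_cmult) measurable
    also have "(\<integral>\<^sup>+G. (\<Prod>x'\<in>UNIV. ennreal (\<phi> x' (G x'))) \<partial>joint_prior \<alpha>) = (\<Prod>x'\<in>UNIV. I x')"
      unfolding joint_prior_def I_def by (rule product_nn_integral_prod) auto
    finally show ?thesis .
  qed
  have int2: "(\<integral>\<^sup>+G. ennreal (likelihood G l * \<psi> (G x)) \<partial>joint_prior \<alpha>) = ennreal c * (J * (\<Prod>x'\<in>UNIV - {x}. I x'))"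
  proof -
    let ?h = "\<lambda>x' g. if x' = x then ennreal (\<phi> x g * \<psi> g) else ennreal (\<phi> x' g)"
    have "(\<integral>\<^sup>+G. ennreal (likelihood G l * \<psi> (G x)) \<partial>joint_prior \<alpha>) = (\<integral>\<^sup>+G. ennreal c * (\<Prod>x'\<in>UNIV. ?h x' (G x')) \<partial>joint_prior \<alpha>)"
    proof (intro nn_integral_cong)
      fix G :: "'x \<Rightarrow> 'y \<Rightarrow> real"
      have "(\<Prod>x'\<in>UNIV. \<phi> x' (G x')) * \<psi> (G x) = (\<Prod>x'\<in>UNIV. \<phi> x' (G x') * (if x' = x then \<psi> (G x') else 1))"
        by (simp add: prod.distrib)
      also have "ennreal \<dots> = (\<Prod>x'\<in>UNIV. ennreal (\<phi> x' (G x') * (if x' = x then \<psi> (G x') else 1)))"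
        by (intro prod_ennreal[symmetric]) (auto simp: \<phi>0 \<psi>0)
      also have "\<dots> = (\<Prod>x'\<in>UNIV. ?h x' (G x'))" by (intro prod.cong) auto
      finally show "ennreal (likelihood G l * \<psi> (G x)) = ennreal c * (\<Prod>x'\<in>UNIV. ?h x' (G x'))"
        using c0 by (simp add: lik mult.assoc ennreal_mult')
    qed
    also have "\<dots> = ennreal c * (\<integral>\<^sup>+G. (\<Prod>x'\<in>UNIV. ?h x' (G x')) \<partial>joint_prior \<alpha>)"
      unfolding joint_prior_def by (rule nn_integral_cmult) measurable
    also have "(\<integral>\<^sup>+G. (\<Prod>x'\<in>UNIV. ?h x' (G x')) \<partial>joint_prior \<alpha>) = (\<Prod>x'\<in>UNIV. \<integral>\<^sup>+g. ?h x' g \<partial>row_prior \<alpha>)"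
      unfolding joint_prior_def by (rule product_nn_integral_prod) auto
    also have "\<dots> = J * (\<Prod>x'\<in>UNIV - {x}. I x')"
      by (subst prod.remove[of _ x]) (auto simp: J_def I_def intro!: prod.cong)
    finally show ?thesis .
  qed
  have "ennreal (?k powr (-p) * \<beta>) * (\<integral>\<^sup>+G. ennreal (likelihood G l) \<partial>joint_prior \<alpha>) =
     ennreal (?k powr (-p)) * (ennreal c * ((ennreal \<beta> * I x) * (\<Prod>x'\<in>UNIV - {x}. I x')))"
    unfolding int1 using \<beta> by (subst prod.remove[of _ x]) (simp_all add: ennreal_mult mult_ac)
  also have "\<dots> \<le> ennreal (?k powr (-p)) * (ennreal c * (J * (\<Prod>x'\<in>UNIV - {x}. I x')))"
    by (intro mult_left_mono mult_right_mono IJ) auto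
  also have "\<dots> = (\<integral>\<^sup>+G. ennreal (?k powr (-p)) * ennreal (likelihood G l * \<psi> (G x)) \<partial>joint_prior \<alpha>)"
  proof (subst nn_integral_cmult)
    show "(\<lambda>G. ennreal (likelihood G l * \<psi> (G x))) \<in> borel_measurable (joint_prior \<alpha>)"
      using measurable_likelihood[measurable] measurable_joint_prior_row[measurable] unfolding \<psi>_def by measurable
  qed (simp add: int2)
  also have "\<dots> = (\<integral>\<^sup>+G. ennreal (likelihood G l * \<bar>row_weight (G x) y / ?k - q\<bar> powr p) \<partial>joint_prior \<alpha>)"
  proof (intro nn_integral_cong)
    fix G :: "'x \<Rightarrow> 'y \<Rightarrow> real"
    have "row_weight (G x) y / ?k - q = (row_weight (G x) y - ?k * q) / ?k" by (simp add: diff_divide_distrib)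
    then have "\<bar>row_weight (G x) y / ?k - q\<bar> powr p = ?k powr (-p) * \<psi> (G x)"
      by (simp add: \<psi>_def powr_divide powr_minus_divide)
    then show "ennreal (?k powr (-p)) * ennreal (likelihood G l * \<psi> (G x)) = ennreal (likelihood G l * \<bar>row_weight (G x) y / ?k - q\<bar> powr p)"
      by (simp add: ennreal_mult[symmetric] likelihood_nonneg \<psi>0 mult_ac)
  qed
  finally show ?thesis by (simp add: \<beta>_def)
qed

text \<open>The maximum over joint distributions dominates the average over the prior. All sums over
  samples and entries are finite, so the posterior bound can be applied to each term
  separately.\<close>

lemma bayes_risk_le_joint_worst_risk:
  fixes q :: "'x::finite list \<Rightarrow> ('x \<times> 'y) list \<Rightarrow> ('x \<times> 'y) pmf"
  shows "(\<integral>\<^sup>+(G :: 'x \<Rightarrow> 'y \<Rightarrow> real). ennreal (measure_pmf.expectation (replicate_pmf m (uniform_joint G)) (bayes_bound p \<epsilon> v0 \<alpha>)) \<partial>joint_prior \<alpha>)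
    \<le> ennreal (joint_worst_risk p m n q)"
proof -
  interpret prob_space "joint_prior \<alpha> :: ('x \<Rightarrow> 'y \<Rightarrow> real) measure" by (rule prob_space_joint_prior)
  note measurable_likelihood[measurable] measurable_joint_prior_row[measurable]
  let ?k = "real CARD('x)"
  let ?\<beta> = "\<lambda>l x y. ?k powr (-p) * post_bound p \<epsilon> v0 (\<lambda>b. \<alpha> + row_counts l x b) y"
  let ?c = "\<lambda>u. pmf (replicate_pmf n (pmf_of_set (UNIV :: 'x set))) u"
  let ?loss = "\<lambda>G u l x y. \<bar>row_weight (G x) y / ?k - pmf (q u l) (x, y)\<bar> powr p"
  have \<beta>0: "0 \<le> ?\<beta> l x y" for l :: "('x \<times> 'y) list" and x y
    by (intro mult_nonneg_nonneg post_bound_nonneg p \<epsilon>) simp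
  have c1: "(\<Sum>u | length u = n. ennreal (?c u)) = 1"
  proof -
    have "(\<Sum>u | length u = n. ?c u) = 1"
      by (rule sum_pmf_eq_1) (auto simp: set_replicate_pmf)
    then show ?thesis by (simp add: sum_ennreal)
  qed
  have "(\<integral>\<^sup>+(G :: 'x \<Rightarrow> 'y \<Rightarrow> real). ennreal (measure_pmf.expectation (replicate_pmf m (uniform_joint G)) (bayes_bound p \<epsilon> v0 \<alpha>)) \<partial>joint_prior \<alpha>)
     = (\<integral>\<^sup>+(G :: 'x \<Rightarrow> 'y \<Rightarrow> real). (\<Sum>l | length l = m. \<Sum>x\<in>UNIV. \<Sum>y\<in>UNIV. ennreal (?\<beta> l x y) * ennreal (likelihood G l)) \<partial>joint_prior \<alpha>)"
  proof (intro nn_integral_cong)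
    fix G :: "'x \<Rightarrow> 'y \<Rightarrow> real"
    have "measure_pmf.expectation (replicate_pmf m (uniform_joint G)) (bayes_bound p \<epsilon> v0 \<alpha>) =
       (\<Sum>l | length l = m. \<Sum>x\<in>UNIV. \<Sum>y\<in>UNIV. ?\<beta> l x y * likelihood G l)"
      unfolding expectation_replicate_pmf_eq_sum likelihood_def[symmetric] bayes_bound_def
      by (simp add: sum_distrib_left mult_ac)
    also have "ennreal \<dots> = (\<Sum>l | length l = m. \<Sum>x\<in>UNIV. \<Sum>y\<in>UNIV. ennreal (?\<beta> l x y * likelihood G l))"
      by (rule ennreal_sum_sum_sum) (intro mult_nonneg_nonneg[OF \<beta>0 likelihood_nonneg])
    finally show "ennreal (measure_pmf.expectation (replicate_pmf m (uniform_joint G)) (bayes_bound p \<epsilon> v0 \<alpha>)) =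
       (\<Sum>l | length l = m. \<Sum>x\<in>UNIV. \<Sum>y\<in>UNIV. ennreal (?\<beta> l x y) * ennreal (likelihood G l))"
      by (simp only: ennreal_mult[OF \<beta>0 likelihood_nonneg])
  qed
  also have "\<dots> = (\<Sum>l | length l = m. \<Sum>x\<in>(UNIV :: 'x set). \<Sum>y\<in>(UNIV :: 'y set). ennreal (?\<beta> l x y) * (\<integral>\<^sup>+G. ennreal (likelihood G l) \<partial>joint_prior \<alpha>))"
    by (simp add: nn_integral_sum nn_integral_cmult)
  \<comment> \<open>The unlabelled sample is inserted with its fixed law, whose weights sum to 1;
    for each \<open>u\<close> the estimate \<open>q u l\<close> is then just another choice of
    centres.\<close>
  also have "\<dots> = (\<Sum>u | length u = n. ennreal (?c u) * (\<Sum>l | length l = m. \<Sum>x\<in>(UNIV :: 'x set). \<Sum>y\<in>(UNIV :: 'y set). ennreal (?\<beta> l x y) * (\<integral>\<^sup>+G. ennreal (likelihood G l) \<partial>joint_prior \<alpha>)))"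
    unfolding sum_distrib_right[symmetric] c1 by simp
  also have "\<dots> \<le> (\<Sum>u | length u = n. ennreal (?c u) * (\<Sum>l | length l = m. \<Sum>x\<in>(UNIV :: 'x set). \<Sum>y\<in>(UNIV :: 'y set). (\<integral>\<^sup>+G. ennreal (likelihood G l * ?loss G u l x y) \<partial>joint_prior \<alpha>)))"
    by (intro sum_mono mult_left_mono posterior_loss_ge) auto
  also have "\<dots> = (\<integral>\<^sup>+G. (\<Sum>u | length u = n. ennreal (?c u) * (\<Sum>l | length l = m. \<Sum>x\<in>(UNIV :: 'x set). \<Sum>y\<in>(UNIV :: 'y set). ennreal (likelihood G l * ?loss G u l x y))) \<partial>joint_prior \<alpha>)"
    by (simp add: nn_integral_sum nn_integral_cmult)
  also have "\<dots> \<le> (\<integral>\<^sup>+(G :: 'x \<Rightarrow> 'y \<Rightarrow> real). ennreal (joint_worst_risk p m n q) \<partial>joint_prior \<alpha>)"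
  proof (intro nn_integral_mono)
    fix G :: "'x \<Rightarrow> 'y \<Rightarrow> real"
    have "joint_risk p m n (uniform_joint G) q =
       (\<Sum>u | length u = n. ?c u * (\<Sum>l | length l = m. likelihood G l * lp_loss p (uniform_joint G) (q u l)))"
      unfolding joint_risk_def expectation_pair_replicate_pmf_eq_sum map_fst_uniform_joint likelihood_def by simp
    also have "\<dots> = (\<Sum>u | length u = n. ?c u * (\<Sum>l | length l = m. \<Sum>x\<in>UNIV. \<Sum>y\<in>UNIV. likelihood G l * ?loss G u l x y))"
    proof -
      have "lp_loss p (uniform_joint G) Q = (\<Sum>x\<in>UNIV. \<Sum>y\<in>UNIV. \<bar>row_weight (G x) y / ?k - pmf Q (x, y)\<bar> powr p)" for Q
        unfolding lp_loss_def by (simp add: sum.cartesian_product pmf_uniform_joint[symmetric])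
      then show ?thesis by (simp add: sum_distrib_left)
    qed
    finally have "(\<Sum>u | length u = n. ennreal (?c u) * (\<Sum>l | length l = m. \<Sum>x\<in>(UNIV :: 'x set). \<Sum>y\<in>(UNIV :: 'y set). ennreal (likelihood G l * ?loss G u l x y))) =
      ennreal (joint_risk p m n (uniform_joint G) q)"
      by (simp add: sum_nonneg ennreal_mult ennreal_sum_sum_sum[symmetric] likelihood_nonneg flip: sum_ennreal)
    also have "\<dots> \<le> ennreal (joint_worst_risk p m n q)"
      using p by (intro ennreal_leI joint_risk_le_joint_worst_risk) auto
    finally show "(\<Sum>u | length u = n. ennreal (?c u) * (\<Sum>l | length l = m. \<Sum>x\<in>(UNIV :: 'x set). \<Sum>y\<in>(UNIV :: 'y set). ennreal (likelihood G l * ?loss G u l x y)))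
      \<le> ennreal (joint_worst_risk p m n q)" .
  qed
  also have "\<dots> = ennreal (joint_worst_risk p m n q)"
    by (simp add: emeasure_space_1)
  finally show ?thesis .
qed

end

text \<open>Splits the deviation into sampling noise of variance at most \<open>m\<close> and the
  bias m * (pmf P a - c). The centre is fixed in advance because \<open>P\<close> itself is random
  under the prior.\<close>

lemma expectation_count_dev_le:
  fixes P :: "'a::finite pmf"
  shows "measure_pmf.expectation (replicate_pmf m P) (\<lambda>l. (real (count (mset l) a) - real m * c)^2) \<le>
    2 * real m + 2 * (real m)^2 * (pmf P a - c)^2"
proof -
  let ?w = "pmf P a"
  define f where "f z = of_bool (z = a) - ?w" for z
  note E = expectation_pmf_eq_sum[of P]
  note P1 = sum_pmf_UNIV[of P]
  have mean: "measure_pmf.expectation P f = 0"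
    by (simp add: E f_def right_diff_distrib sum_subtractf sum_distrib_right[symmetric] P1)
  have "\<bar>f z\<bar> \<le> 1" for z
    using pmf_le_1[of P a] pmf_nonneg[of P a] by (simp add: f_def)
  then have "(f z)^2 \<le> 1" for z by (simp add: abs_square_le_1)
  then have "measure_pmf.expectation P (\<lambda>z. (f z)^2) \<le> measure_pmf.expectation P (\<lambda>z. 1)"
    by (intro integral_mono integrable_measure_pmf_finite) auto
  then have var: "measure_pmf.expectation P (\<lambda>z. (f z)^2) \<le> 1" by simp
  have "measure_pmf.expectation (replicate_pmf m P) (\<lambda>l. (real (count (mset l) a) - real m * c)^2) \<le>
     measure_pmf.expectation (replicate_pmf m P) (\<lambda>l. 2 * (\<Sum>z\<leftarrow>l. f z)^2 + 2 * (real m)^2 * (?w - c)^2)"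
  proof (rule integral_mono_AE)
    show "AE l in measure_pmf (replicate_pmf m P). (real (count (mset l) a) - real m * c)^2 \<le>
        2 * (\<Sum>z\<leftarrow>l. f z)^2 + 2 * (real m)^2 * (?w - c)^2"
    proof (rule AE_pmfI)
      fix l assume "l \<in> set_pmf (replicate_pmf m P)"
      then have "length l = m" by (simp add: set_replicate_pmf)
      then have "real (count (mset l) a) - real m * c = (\<Sum>z\<leftarrow>l. f z) + real m * (?w - c)"
        unfolding f_def sum_list_map_diff_const by (simp add: algebra_simps)
      moreover have "(u + v)^2 \<le> 2 * u^2 + 2 * v^2" for u v :: real
        using zero_le_power2[of "u - v"] by (simp add: power2_eq_square algebra_simps)
      ultimately show "(real (count (mset l) a) - real m * c)^2 \<le> 2 * (\<Sum>z\<leftarrow>l. f z)^2 + 2 * (real m)^2 * (?w - c)^2"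
        by (metis (no_types, lifting) power_mult_distrib mult.assoc)
    qed
  qed auto
  also have "\<dots> = 2 * (real m * measure_pmf.expectation P (\<lambda>z. (f z)^2)) + 2 * (real m)^2 * (?w - c)^2"
    using expectation_sum_list_power2[OF mean refl, of m] by simp
  also have "\<dots> \<le> 2 * real m + 2 * (real m)^2 * (?w - c)^2"
    using var by (simp add: mult_left_le)
  finally show ?thesis .
qed

text \<open>Reduces the bound to one number when all shapes lie between \<open>lo\<close> and
  \<open>hi\<close>: the numerator of \<open>post_var\<close> is at least lo * ((d - 1) * lo), the
  second factor collecting the other shapes, and \<open>shape_sum\<close> is at most d * hi.\<close>

lemma post_bound_ge:
  fixes a :: "'y::finite \<Rightarrow> nat"
  defines "d \<equiv> real CARD('y)"
  assumes p: "1 \<le> p" "p \<le> 2" and \<epsilon>: "\<epsilon> < 1"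
    and lo: "0 < lo" "\<And>b. lo \<le> real (a b) + 1" and hi: "\<And>b. real (a b) + 1 \<le> hi"
    and v0: "v0 \<le> (d - 1) * lo^2 / (d * hi)"
  shows "(d * hi + p) powr (-p) * ((1 - \<epsilon>) * gauss_moment p * ((d - 1) * lo^2 / (d * hi)) powr (p/2)) \<le> post_bound p \<epsilon> v0 a y"
proof -
  have d: "d \<ge> 1" by (simp add: d_def Suc_le_eq)
  have hi0: "hi > 0" using lo(1) lo(2)[of y] hi[of y] by linarith
  have Dle: "shape_sum a \<le> d * hi"
    unfolding shape_sum_def d_def using sum_bounded_above[of UNIV "\<lambda>b. real (a b) + 1" hi] hi by simp
  have rest: "(d - 1) * lo \<le> shape_sum a - (real (a y) + 1)"
  proof -
    have "shape_sum a = (real (a y) + 1) + (\<Sum>b\<in>UNIV - {y}. real (a b) + 1)"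
      unfolding shape_sum_def by (rule sum.remove) auto
    moreover have "real (card (UNIV - {y})) * lo \<le> (\<Sum>b\<in>UNIV - {y}. real (a b) + 1)"
      using sum_bounded_below[of "UNIV - {y}" lo "\<lambda>b. real (a b) + 1"] lo(2) by simp
    moreover have "real (card (UNIV - {y})) = d - 1"
      by (simp add: d_def card_Diff_singleton of_nat_diff Suc_le_eq)
    ultimately show ?thesis by simp
  qed
  define V where "V = (d - 1) * lo^2 / (d * hi)"
  have V0: "V \<ge> 0" using d hi0 by (simp add: V_def)
  have "lo * ((d - 1) * lo) \<le> (real (a y) + 1) * (shape_sum a - (real (a y) + 1))"
    using lo d rest by (intro mult_mono) auto
  then have V: "V \<le> post_var a y"
    unfolding V_def post_var_def using Dle shape_sum_pos[of a] lo d shape_le_shape_sum[of a y]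
    by (intro frac_le) (auto simp: power2_eq_square mult_ac)
  have "(d * hi + p) powr (-p) \<le> (shape_sum a + p) powr (-p)"
    using Dle shape_sum_pos[of a] p by (intro powr_mono2') auto
  moreover have "V powr (p/2) \<le> post_var a y powr (p/2)" using V V0 p by (intro powr_mono2) auto
  ultimately have "(d * hi + p) powr (-p) * ((1 - \<epsilon>) * gauss_moment p * V powr (p/2)) \<le>
     (shape_sum a + p) powr (-p) * ((1 - \<epsilon>) * gauss_moment p * post_var a y powr (p/2))"
    using gauss_moment_pos[OF p] \<epsilon> by (intro mult_mono mult_nonneg_nonneg) auto
  then show ?thesis using V v0 by (simp add: post_bound_def V_def)
qed

context
  fixes p \<epsilon> v0 :: real and \<alpha> :: nat and ty :: "'y::finite itself"
  assumes p: "1 \<le> p" "p \<le> 2" and \<epsilon>: "\<epsilon> < 1" and \<alpha>: "\<alpha> \<ge> 1"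
    and v0: "moment_threshold TYPE('y) p \<epsilon> v0"
begin

text \<open>If all cell counts are within \<eta> * m of m / (k * d), the Bayes bound is at least
  \<open>H\<close>. Chebyshev's inequality treats the other samples: each of the k * d cells
  contributes the sampling noise 2 / m and the prior spread 40 * d / \<alpha>, relative to
  \<eta>^2.\<close>

lemma joint_minimax_risk_ge:
  fixes \<eta> :: real and m n :: nat
  defines "k \<equiv> real CARD('x::finite)" and "d \<equiv> real CARD('y)"
  defines "lo \<equiv> (1 / (k * d) - \<eta>) * real m" and "hi \<equiv> (1 / (k * d) + \<eta>) * real m + real \<alpha> + 1"
  defines "V \<equiv> (d - 1) * lo^2 / (d * hi)"
  defines "H \<equiv> k * d * (k powr (-p) * ((d * hi + p) powr (-p) * ((1 - \<epsilon>) * gauss_moment p * V powr (p/2))))"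
  assumes \<eta>: "0 < \<eta>" "\<eta> < 1 / (k * d)" and m: "m \<ge> 1" and vV: "v0 \<le> V"
  shows "H * (1 - k * d * (2 / real m + 40 * d / real \<alpha>) / \<eta>^2) \<le> joint_minimax_risk TYPE('x) TYPE('y) p m n"
  unfolding joint_minimax_risk_def
proof (rule cINF_greatest)
  fix q :: "'x list \<Rightarrow> ('x \<times> 'y) list \<Rightarrow> ('x \<times> 'y) pmf"
  interpret prob_space "joint_prior \<alpha> :: ('x \<Rightarrow> 'y \<Rightarrow> real) measure" by (rule prob_space_joint_prior)
  note measurable_joint_prior_row[measurable] measurable_likelihood[measurable]
  define c where "c = 1 / (k * d)"
  have k: "k \<ge> 1" and d: "d \<ge> 1" by (simp_all add: k_def d_def Suc_le_eq)
  have lo0: "lo > 0" using \<eta> m by (simp add: lo_def)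
  have lo_eq: "lo = (c - \<eta>) * real m" and hi_eq: "hi = (c + \<eta>) * real m + real \<alpha> + 1"
    by (simp_all only: lo_def hi_def c_def)
  define J where "J = joint_worst_risk p m n q"
  have J0: "J \<ge> 0" unfolding J_def using p by (intro joint_worst_risk_nonneg) auto
  have H0: "H \<ge> 0" unfolding H_def using k d \<epsilon> gauss_moment_pos[OF p] by (intro mult_nonneg_nonneg) auto
  define s where "s = (\<eta> * real m)^2"
  have s: "s > 0" using \<eta> m by (simp add: s_def)
  define dev where "dev l x y = (real (row_counts l x y) - real m * c)^2" for l :: "('x \<times> 'y) list" and x y
  have dev0: "dev l x y \<ge> 0" for l x y by (simp add: dev_def)
  have bb0: "bayes_bound p \<epsilon> v0 \<alpha> l \<ge> 0" for l :: "('x \<times> 'y) list"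
    unfolding bayes_bound_def by (intro sum_nonneg mult_nonneg_nonneg post_bound_nonneg p \<epsilon>) auto
  \<comment> \<open>Chebyshev's inequality before integration: where some count deviates too far,
    the second term alone is at least \<open>H\<close>.\<close>
  have pw: "H \<le> bayes_bound p \<epsilon> v0 \<alpha> l + H / s * (\<Sum>x\<in>UNIV. \<Sum>y\<in>UNIV. dev l x y)" for l :: "('x \<times> 'y) list"
  proof (cases "\<forall>x y. dev l x y \<le> s")
    case True
    have near: "\<bar>real (row_counts l x y) - real m * c\<bar> \<le> \<eta> * real m" for x y
    proof -
      have "(real (row_counts l x y) - real m * c)^2 \<le> (\<eta> * real m)^2" using True by (simp add: dev_def s_def)
      then show ?thesis using \<eta> m by (simp add: abs_le_square_iff[symmetric])
    qed
    have post: "(d * hi + p) powr (-p) * ((1 - \<epsilon>) * gauss_moment p * V powr (p/2)) \<le>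
        post_bound p \<epsilon> v0 (\<lambda>b. \<alpha> + row_counts l x b) y" for x y
      unfolding V_def d_def
    proof (rule post_bound_ge[OF p \<epsilon> lo0])
      fix b
      have "\<bar>real (row_counts l x b) - real m * c\<bar> \<le> \<eta> * real m" by (rule near)
      then show "lo \<le> real (\<alpha> + row_counts l x b) + 1" "real (\<alpha> + row_counts l x b) + 1 \<le> hi"
        by (simp_all add: lo_eq hi_eq abs_le_iff algebra_simps)
    qed (use vV in \<open>simp add: V_def d_def\<close>)
    have "H = (\<Sum>x\<in>(UNIV :: 'x set). \<Sum>y\<in>(UNIV :: 'y set). k powr (-p) * ((d * hi + p) powr (-p) * ((1 - \<epsilon>) * gauss_moment p * V powr (p/2))))"
      by (simp add: H_def k_def d_def)
    also have "\<dots> \<le> bayes_bound p \<epsilon> v0 \<alpha> l"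
      unfolding bayes_bound_def k_def[symmetric] by (intro sum_mono mult_left_mono post) simp
    finally show ?thesis using H0 s by (simp add: add_increasing2 sum_nonneg dev0)
  next
    case False
    then obtain x y where "dev l x y > s" by (auto simp: not_le)
    moreover have "dev l x y \<le> (\<Sum>y\<in>UNIV. dev l x y)" by (rule member_le_sum) (auto simp: dev0)
    moreover have "(\<Sum>y\<in>UNIV. dev l x y) \<le> (\<Sum>x\<in>UNIV. \<Sum>y\<in>UNIV. dev l x y)"
      by (rule member_le_sum[of x UNIV "\<lambda>x. \<Sum>y\<in>UNIV. dev l x y"]) (auto simp: dev0 sum_nonneg)
    ultimately have "s \<le> (\<Sum>x\<in>UNIV. \<Sum>y\<in>UNIV. dev l x y)" by linarith
    then have "H / s * s \<le> H / s * (\<Sum>x\<in>UNIV. \<Sum>y\<in>UNIV. dev l x y)"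
      using H0 s by (intro mult_left_mono) auto
    then show ?thesis using s bb0[of l] by simp
  qed
  \<comment> \<open>Bounds the mean squared deviation of a count given \<open>G\<close>; the factor
    1 / k^2 in the bias is estimated by 1.\<close>
  define D where "D x y G = 2 * real m + 2 * (real m)^2 * (row_weight (G x) y - 1 / d)^2"
    for x y and G :: "'x \<Rightarrow> 'y \<Rightarrow> real"
  have D0: "D x y G \<ge> 0" for x y G by (simp add: D_def)
  have Dm [measurable]: "D x y \<in> borel_measurable (joint_prior \<alpha>)" for x y
    unfolding D_def by measurable
  have EG: "H \<le> measure_pmf.expectation (replicate_pmf m (uniform_joint G)) (bayes_bound p \<epsilon> v0 \<alpha>) +
      H / s * (\<Sum>x\<in>UNIV. \<Sum>y\<in>UNIV. D x y G)" for G :: "'x \<Rightarrow> 'y \<Rightarrow> real"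
  proof -
    have "H = measure_pmf.expectation (replicate_pmf m (uniform_joint G)) (\<lambda>_. H)" by simp
    also have "\<dots> \<le> measure_pmf.expectation (replicate_pmf m (uniform_joint G))
        (\<lambda>l. bayes_bound p \<epsilon> v0 \<alpha> l + H / s * (\<Sum>x\<in>UNIV. \<Sum>y\<in>UNIV. dev l x y))"
      by (intro integral_mono integrable_replicate_pmf pw)
    also have "\<dots> = measure_pmf.expectation (replicate_pmf m (uniform_joint G)) (bayes_bound p \<epsilon> v0 \<alpha>) +
        H / s * (\<Sum>x\<in>UNIV. \<Sum>y\<in>UNIV. measure_pmf.expectation (replicate_pmf m (uniform_joint G)) (\<lambda>l. dev l x y))"
      by (simp add: sum_distrib_left)
    also have "\<dots> \<le> measure_pmf.expectation (replicate_pmf m (uniform_joint G)) (bayes_bound p \<epsilon> v0 \<alpha>) +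
        H / s * (\<Sum>x\<in>UNIV. \<Sum>y\<in>UNIV. D x y G)"
    proof (intro add_left_mono mult_left_mono sum_mono)
      fix x y
      let ?w = "row_weight (G x) y"
      have "measure_pmf.expectation (replicate_pmf m (uniform_joint G)) (\<lambda>l. dev l x y) \<le>
         2 * real m + 2 * (real m)^2 * (?w / k - c)^2"
        unfolding dev_def row_counts_def
        using expectation_count_dev_le[of m "uniform_joint G" "(x, y)" c] by (simp add: pmf_uniform_joint k_def)
      also have "(?w / k - c)^2 = ((?w - 1 / d) / k)^2" using k d by (simp add: c_def diff_divide_distrib mult.commute)
      also have "\<dots> = (?w - 1 / d)^2 / k^2" by (rule power_divide)
      also have "\<dots> \<le> (?w - 1 / d)^2 / 1"
        using k by (intro divide_left_mono) (auto simp: one_le_power)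
      finally show "measure_pmf.expectation (replicate_pmf m (uniform_joint G)) (\<lambda>l. dev l x y) \<le> D x y G"
        by (simp add: D_def mult_left_mono)
    qed (use H0 s in auto)
    finally show ?thesis .
  qed
  have intD: "(\<integral>\<^sup>+G. ennreal (D x y G) \<partial>joint_prior \<alpha>) \<le> ennreal (2 * real m + 2 * (real m)^2 * (20 * d / real \<alpha>))"
    for x :: 'x and y :: 'y
  proof -
    let ?f = "\<lambda>g. ennreal ((row_weight g y - 1 / d)^2)"
    interpret P: product_prob_space "\<lambda>_ :: 'x. row_prior \<alpha> :: ('y \<Rightarrow> real) measure" UNIV
      by (intro product_prob_spaceI prob_space_row_prior)
    have proj: "distr (joint_prior \<alpha>) (row_prior \<alpha>) (\<lambda>G. G x) = (row_prior \<alpha> :: ('y \<Rightarrow> real) measure)"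
      unfolding joint_prior_def by (rule P.PiM_component) simp
    have [measurable]: "(\<lambda>G. G x) \<in> joint_prior \<alpha> \<rightarrow>\<^sub>M (row_prior \<alpha> :: ('y \<Rightarrow> real) measure)"
      unfolding joint_prior_def by measurable
    have [measurable]: "?f \<in> borel_measurable gvol" using measurable_row_weight[measurable] by measurable
    have "(\<integral>\<^sup>+G. ?f (G x) \<partial>joint_prior \<alpha>) = (\<integral>\<^sup>+g. ?f g \<partial>distr (joint_prior \<alpha>) (row_prior \<alpha>) (\<lambda>G. G x))"
      by (rule nn_integral_distr[symmetric]) measurable
    then have row: "(\<integral>\<^sup>+G. ?f (G x) \<partial>joint_prior \<alpha>) \<le> ennreal (20 * d / real \<alpha>)"
      unfolding proj d_def using row_prior_dev_le[OF \<alpha>, where 'y='y] by simp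
    have "(\<integral>\<^sup>+G. ennreal (D x y G) \<partial>joint_prior \<alpha>) =
        (\<integral>\<^sup>+G. ennreal (2 * real m) + ennreal (2 * (real m)^2) * ?f (G x) \<partial>joint_prior \<alpha>)"
      by (intro nn_integral_cong) (simp add: D_def ennreal_plus ennreal_mult)
    also have "\<dots> = ennreal (2 * real m) + ennreal (2 * (real m)^2) * (\<integral>\<^sup>+G. ?f (G x) \<partial>joint_prior \<alpha>)"
      by (subst nn_integral_add) (auto simp: nn_integral_cmult emeasure_space_1)
    also have "\<dots> \<le> ennreal (2 * real m) + ennreal (2 * (real m)^2) * ennreal (20 * d / real \<alpha>)"
      by (intro add_left_mono mult_left_mono row) auto
    also have "\<dots> = ennreal (2 * real m + 2 * (real m)^2 * (20 * d / real \<alpha>))"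
      using d by (subst ennreal_mult[symmetric]) (simp_all del: ennreal_plus add: ennreal_plus[symmetric])
    finally show ?thesis .
  qed
  define B where "B = k * d * (2 * real m + 2 * (real m)^2 * (20 * d / real \<alpha>))"
  have B0: "B \<ge> 0" using k d by (simp add: B_def)
  let ?X = "\<lambda>G :: 'x \<Rightarrow> 'y \<Rightarrow> real. measure_pmf.expectation (replicate_pmf m (uniform_joint G)) (bayes_bound p \<epsilon> v0 \<alpha>)"
  have X0: "0 \<le> ?X G" for G by (intro integral_nonneg_AE) (simp add: bb0)
  have Xm: "?X \<in> borel_measurable (joint_prior \<alpha>)"
    unfolding expectation_replicate_pmf_eq_sum likelihood_def[symmetric] by measurable
  have "ennreal H = (\<integral>\<^sup>+(G :: 'x \<Rightarrow> 'y \<Rightarrow> real). ennreal H \<partial>joint_prior \<alpha>)" by (simp add: emeasure_space_1)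
  also have "\<dots> \<le> (\<integral>\<^sup>+G. ennreal (?X G) + ennreal (H / s) * (\<Sum>x\<in>UNIV. \<Sum>y\<in>UNIV. ennreal (D x y G)) \<partial>joint_prior \<alpha>)"
  proof (intro nn_integral_mono)
    fix G :: "'x \<Rightarrow> 'y \<Rightarrow> real"
    have "ennreal H \<le> ennreal (?X G + H / s * (\<Sum>x\<in>UNIV. \<Sum>y\<in>UNIV. D x y G))" by (rule ennreal_leI[OF EG])
    also have "\<dots> = ennreal (?X G) + ennreal (H / s * (\<Sum>x\<in>UNIV. \<Sum>y\<in>UNIV. D x y G))"
      using X0 H0 s by (intro ennreal_plus mult_nonneg_nonneg sum_nonneg D0) auto
    also have "ennreal (H / s * (\<Sum>x\<in>UNIV. \<Sum>y\<in>UNIV. D x y G)) = ennreal (H / s) * (\<Sum>x\<in>UNIV. \<Sum>y\<in>UNIV. ennreal (D x y G))"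
      using H0 s by (subst ennreal_mult) (auto intro!: sum_nonneg simp: D0 sum_nonneg)
    finally show "ennreal H \<le> ennreal (?X G) + ennreal (H / s) * (\<Sum>x\<in>UNIV. \<Sum>y\<in>UNIV. ennreal (D x y G))" .
  qed
  also have "\<dots> = (\<integral>\<^sup>+G. ennreal (?X G) \<partial>joint_prior \<alpha>) + (\<integral>\<^sup>+G. ennreal (H / s) * (\<Sum>x\<in>UNIV. \<Sum>y\<in>UNIV. ennreal (D x y G)) \<partial>joint_prior \<alpha>)"
    by (rule nn_integral_add) (use Xm in measurable)
  also have "(\<integral>\<^sup>+G. ennreal (H / s) * (\<Sum>x\<in>UNIV. \<Sum>y\<in>UNIV. ennreal (D x y G)) \<partial>joint_prior \<alpha>) =
      ennreal (H / s) * (\<Sum>x\<in>(UNIV :: 'x set). \<Sum>y\<in>(UNIV :: 'y set). (\<integral>\<^sup>+G. ennreal (D x y G) \<partial>joint_prior \<alpha>))"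
    by (simp add: nn_integral_cmult nn_integral_sum)
  also have "(\<integral>\<^sup>+G. ennreal (?X G) \<partial>joint_prior \<alpha>) + \<dots> \<le> ennreal J + ennreal (H / s) *
      (\<Sum>x\<in>(UNIV :: 'x set). \<Sum>y\<in>(UNIV :: 'y set). ennreal (2 * real m + 2 * (real m)^2 * (20 * d / real \<alpha>)))"
    unfolding J_def
    by (intro add_mono mult_left_mono sum_mono intD bayes_risk_le_joint_worst_risk[OF p \<epsilon> \<alpha> v0]) auto
  also have "\<dots> = ennreal (J + H / s * B)"
  proof -
    have "(\<Sum>x\<in>(UNIV :: 'x set). \<Sum>y\<in>(UNIV :: 'y set). ennreal (2 * real m + 2 * (real m)^2 * (20 * d / real \<alpha>))) = ennreal B"
      using d by (simp add: B_def k_def d_def ennreal_of_nat_eq_real_of_nat ennreal_mult[symmetric] mult.assoc del: ennreal_plus)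
    then show ?thesis using J0 H0 s B0 by (simp add: ennreal_plus ennreal_mult[symmetric])
  qed
  finally have "H \<le> J + H / s * B"
    using J0 H0 s B0 by (subst (asm) ennreal_le_iff) auto
  moreover have "H / s * B = H * (k * d * (2 / real m + 40 * d / real \<alpha>) / \<eta>^2)"
    using m \<eta> \<alpha> by (simp add: s_def B_def field_simps power2_eq_square)
  ultimately show "H * (1 - k * d * (2 / real m + 40 * d / real \<alpha>) / \<eta>^2) \<le> joint_worst_risk p m n q"
    by (simp add: J_def right_diff_distrib)
qed simp

end

text \<open>A single margin \<eta> is both the width of the window for the counts and the relative
  loss in the moment bound. It is fixed before the limit in \<open>m\<close>, small enough for the
  limit of the bound to exceed \<open>c'\<close>.\<close>

theorem joint_minimax_lower:
  fixes n :: "nat \<Rightarrow> nat"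
  assumes cY: "CARD('y::finite) \<ge> 2" and p: "1 \<le> p" "p \<le> 2"
    and c': "c' < real CARD('x::finite) powr (1 - p / 2) * gauss_risk TYPE('y) p"
  shows "eventually (\<lambda>m. c' < real m powr (p/2) * joint_minimax_risk TYPE('x) TYPE('y) p m (n m)) at_top"
proof -
  define k d where "k = real CARD('x)" and "d = real CARD('y)"
  have k: "k \<ge> 1" and d: "d \<ge> 2" using cY by (simp_all add: k_def d_def Suc_le_eq)
  define c where "c = 1 / (k * d)"
  have c0: "c > 0" using k d by (simp add: c_def)
  \<comment> \<open>The limit in \<open>m\<close> of m powr (p/2) times the bound \<open>H\<close>.
    At \<eta> = 0 all cells hold m / (k * d) observations, and the target constant results.\<close>
  define \<Phi> where "\<Phi> \<eta> = k * d * (k powr (-p) * ((d * (c + \<eta>)) powr (-p) * ((1 - \<eta>) * gauss_moment p *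
      ((d - 1) * (c - \<eta>)^2 / (d * (c + \<eta>))) powr (p/2))))" for \<eta>
  have \<Phi>0: "\<Phi> 0 = k powr (1 - p/2) * gauss_risk TYPE('y) p"
  proof -
    have "(d - 1) * c^2 / (d * c) = (1 / k) * ((1 / d) * (1 - 1 / d))"
    proof -
      have "(d - 1) * c^2 / (d * c) = (d - 1) / d * c" using c0 by (simp add: power2_eq_square)
      also have "(d - 1) / d = 1 - 1 / d" using d by (simp add: diff_divide_distrib)
      finally show ?thesis by (simp add: c_def)
    qed
    moreover have "d * c = 1 / k" using d by (simp add: c_def)
    moreover have "(1 / k) powr (-p) = k powr p" using k by (simp add: powr_divide powr_minus_divide)
    ultimately have "\<Phi> 0 = k * d * (k powr (-p) * (k powr p * (gauss_moment p * ((1 / k) * ((1 / d) * (1 - 1 / d))) powr (p/2))))"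
      by (simp add: \<Phi>_def)
    also have "((1 / k) * ((1 / d) * (1 - 1 / d))) powr (p/2) = (1 / k) powr (p/2) * ((1 / d) * (1 - 1 / d)) powr (p/2)"
      by (rule powr_mult)
    also have "k * d * (k powr (-p) * (k powr p * (gauss_moment p * \<dots>))) =
       (k powr (-p) * k powr p) * (k * (1 / k) powr (p/2)) * (gauss_moment p * (d * ((1 / d) * (1 - 1 / d)) powr (p/2)))"
      by (simp only: mult_ac)
    also have "k powr (-p) * k powr p = 1" using k by (simp add: powr_minus_divide)
    also have "k * (1 / k) powr (p/2) = k powr (1 - p/2)" using k by (simp add: powr_divide powr_diff)
    finally show ?thesis by (simp add: gauss_risk_def d_def)
  qed
  have "(\<Phi> \<longlongrightarrow> \<Phi> 0) (at_right 0)"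
    unfolding \<Phi>_def[abs_def] using c0 d by (intro tendsto_intros) auto
  then have A: "eventually (\<lambda>\<eta>. c' < \<Phi> \<eta>) (at_right 0)"
    using c' \<Phi>0 by (intro order_tendstoD(1)) (auto simp: k_def)
  have B: "eventually (\<lambda>\<eta>::real. \<eta> \<in> {0<..<min 1 c}) (at_right 0)"
    by (rule eventually_at_right_real) (use c0 in simp)
  obtain \<eta> where \<eta>: "0 < \<eta>" "\<eta> < 1" "\<eta> < c" and \<eta>c: "c' < \<Phi> \<eta>"
    using eventually_happens'[OF trivial_limit_at_right_real eventually_conj[OF A B]] by auto
  obtain v0 where v0: "moment_threshold TYPE('y) p \<eta> v0"
    by (rule edens_abs_moment_ge[OF p \<eta>(1,2)])
  \<comment> \<open>the prior concentrates, but its weight is negligible against that of the sample\<close>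
  define \<alpha> where "\<alpha> m = nat \<lfloor>sqrt (real m)\<rfloor> + 1" for m
  have \<alpha>1: "\<alpha> m \<ge> 1" for m by (simp add: \<alpha>_def)
  have \<alpha>: "sqrt (real m) \<le> real (\<alpha> m)" "real (\<alpha> m) \<le> sqrt (real m) + 1" for m
  proof -
    have "real (nat \<lfloor>sqrt (real m)\<rfloor>) = of_int \<lfloor>sqrt (real m)\<rfloor>" by simp
    then show "sqrt (real m) \<le> real (\<alpha> m)" "real (\<alpha> m) \<le> sqrt (real m) + 1"
      unfolding \<alpha>_def of_nat_add of_nat_1 by linarith+
  qed
  have inv_sqrt: "(\<lambda>m. 1 / sqrt (real m)) \<longlonglongrightarrow> 0"
    by (intro real_tendsto_divide_at_top[OF tendsto_const] filterlim_compose[OF sqrt_at_top] filterlim_real_sequentially)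
  have inv: "(\<lambda>m. 1 / real m) \<longlonglongrightarrow> 0"
    by (intro real_tendsto_divide_at_top[OF tendsto_const] filterlim_real_sequentially)
  have \<alpha>_inv: "(\<lambda>m. 1 / real (\<alpha> m)) \<longlonglongrightarrow> 0"
  proof (rule tendsto_sandwich[OF _ _ tendsto_const inv_sqrt])
    show "eventually (\<lambda>m. 1 / real (\<alpha> m) \<le> 1 / sqrt (real m)) sequentially"
      using eventually_gt_at_top[of 0]
    proof eventually_elim
      case (elim m)
      then show ?case using \<alpha>(1)[of m] by (intro frac_le) auto
    qed
  qed simp
  have \<alpha>_m: "(\<lambda>m. real (\<alpha> m) / real m) \<longlonglongrightarrow> 0"
  proof (rule tendsto_sandwich[OF _ _ tendsto_const])
    show "eventually (\<lambda>m. real (\<alpha> m) / real m \<le> 1 / sqrt (real m) + 1 / real m) sequentially"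
      using eventually_gt_at_top[of 0]
    proof eventually_elim
      case (elim m)
      have "real (\<alpha> m) / real m \<le> (sqrt (real m) + 1) / real m" using \<alpha>(2) by (intro divide_right_mono) auto
      also have "\<dots> = 1 / sqrt (real m) + 1 / real m" by (simp add: add_divide_distrib sqrt_divide_self_eq inverse_eq_divide)
      finally show ?case .
    qed
    show "(\<lambda>m. 1 / sqrt (real m) + 1 / real m) \<longlonglongrightarrow> 0" using tendsto_add[OF inv_sqrt inv] by simp
  qed simp
  define lo where "lo m = (c - \<eta>) * real m" for m :: nat
  define hi where "hi m = (c + \<eta>) * real m + real (\<alpha> m) + 1" for m
  define V where "V m = (d - 1) * (lo m)^2 / (d * hi m)" for m
  define H where "H m = k * d * (k powr (-p) * ((d * hi m + p) powr (-p) * ((1 - \<eta>) * gauss_moment p * V m powr (p/2))))" for m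
  \<comment> \<open>The Chebyshev loss; for fixed \<eta> it vanishes because both \<open>m\<close>
    and \<alpha> tend to infinity.\<close>
  define \<delta> where "\<delta> m = k * d * (2 * (1 / real m) + 40 * d * (1 / real (\<alpha> m))) / \<eta>^2" for m
  \<comment> \<open>This is \<open>hi\<close> divided by \<open>m\<close>; the prior enters as
    \<alpha> / m, which vanishes because \<alpha> grows only like sqrt m.\<close>
  define h where "h m = (c + \<eta>) + real (\<alpha> m) / real m + 1 / real m" for m
  have hi_h: "hi m = h m * real m" if "m \<ge> 1" for m
    using that by (simp add: hi_def h_def field_simps)
  have h: "h \<longlonglongrightarrow> c + \<eta>"
    unfolding h_def[abs_def] using tendsto_add[OF tendsto_add[OF tendsto_const \<alpha>_m] inv, of "c + \<eta>"] by simp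
  have h0: "h m > 0" for m using c0 \<eta> by (simp add: h_def add_pos_nonneg)
  have V_h: "V m = (d - 1) * (c - \<eta>)^2 / (d * h m) * real m" if "m \<ge> 1" for m
    using that h0[of m] d by (simp add: V_def lo_def hi_h power_mult_distrib power2_eq_square)
  have V_lim: "(\<lambda>m. (d - 1) * (c - \<eta>)^2 / (d * h m)) \<longlonglongrightarrow> (d - 1) * (c - \<eta>)^2 / (d * (c + \<eta>))"
    using d c0 \<eta> by (intro tendsto_intros h) auto
  have V_pos: "(d - 1) * (c - \<eta>)^2 / (d * (c + \<eta>)) > 0" using d c0 \<eta> by simp
  \<comment> \<open>The bound on the posterior variance grows linearly in \<open>m\<close> and so
    passes the fixed threshold \<open>v0\<close>.\<close>
  have "filterlim (\<lambda>m. (d - 1) * (c - \<eta>)^2 / (d * h m) * real m) at_top at_top"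
    using filterlim_tendsto_pos_mult_at_top[OF V_lim V_pos filterlim_real_sequentially] .
  then have "eventually (\<lambda>m. v0 \<le> (d - 1) * (c - \<eta>)^2 / (d * h m) * real m) at_top"
    by (simp add: filterlim_at_top)
  then have v0V: "eventually (\<lambda>m. v0 \<le> V m) at_top"
    using eventually_ge_at_top[of 1] by eventually_elim (simp add: V_h)
  have "\<delta> \<longlonglongrightarrow> k * d * (2 * 0 + 40 * d * 0) / \<eta>^2"
    unfolding \<delta>_def[abs_def] using \<eta> by (intro tendsto_intros inv \<alpha>_inv) auto
  then have \<delta>: "\<delta> \<longlonglongrightarrow> 0" by simp
  have "(\<lambda>m. k * d * (k powr (-p) * ((d * h m + p * (1 / real m)) powr (-p) * ((1 - \<eta>) * gauss_moment p *
      ((d - 1) * (c - \<eta>)^2 / (d * h m)) powr (p/2)))) * (1 - \<delta> m)) \<longlonglongrightarrow>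
     k * d * (k powr (-p) * ((d * (c + \<eta>) + p * 0) powr (-p) * ((1 - \<eta>) * gauss_moment p *
      ((d - 1) * (c - \<eta>)^2 / (d * (c + \<eta>))) powr (p/2)))) * (1 - 0)"
    using d c0 \<eta> V_pos by (intro tendsto_intros h \<delta> inv V_lim) auto
  then have "eventually (\<lambda>m. c' < k * d * (k powr (-p) * ((d * h m + p * (1 / real m)) powr (-p) * ((1 - \<eta>) * gauss_moment p *
      ((d - 1) * (c - \<eta>)^2 / (d * h m)) powr (p/2)))) * (1 - \<delta> m)) at_top"
    using \<eta>c by (intro order_tendstoD(1)) (auto simp: \<Phi>_def)
  then show ?thesis
    using v0V eventually_ge_at_top[of 1]
  proof eventually_elim
    case (elim m)
    have "H m * (1 - \<delta> m) \<le> joint_minimax_risk TYPE('x) TYPE('y) p m (n m)"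
    proof -
      have lo': "(1 / (k * d) - \<eta>) * real m = lo m" and hi': "(1 / (k * d) + \<eta>) * real m + real (\<alpha> m) + 1 = hi m"
        by (simp_all only: lo_def hi_def c_def)
      have V': "(d - 1) * (lo m)^2 / (d * hi m) = V m" by (simp only: V_def)
      have H': "k * d * (k powr (-p) * ((d * hi m + p) powr (-p) * ((1 - \<eta>) * gauss_moment p * V m powr (p/2)))) = H m"
        by (simp only: H_def)
      have \<delta>': "\<delta> m = k * d * (2 / real m + 40 * d / real (\<alpha> m)) / \<eta>^2" by (simp add: \<delta>_def)
      note ge = joint_minimax_risk_ge[OF p \<eta>(2) \<alpha>1[of m] v0,
        where 'x='x and \<eta>=\<eta> and m=m and n="n m", folded k_def d_def, unfolded lo' hi', unfolded V', unfolded H']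
      show ?thesis unfolding \<delta>' using elim \<eta> by (intro ge) (simp_all add: c_def)
    qed
    then have "real m powr (p/2) * (H m * (1 - \<delta> m)) \<le> real m powr (p/2) * joint_minimax_risk TYPE('x) TYPE('y) p m (n m)"
      by (rule mult_left_mono) simp
    moreover have "real m powr (p/2) * (H m * (1 - \<delta> m)) =
      k * d * (k powr (-p) * ((d * h m + p * (1 / real m)) powr (-p) * ((1 - \<eta>) * gauss_moment p *
      ((d - 1) * (c - \<eta>)^2 / (d * h m)) powr (p/2)))) * (1 - \<delta> m)"
    proof -
      have "d * hi m + p = (d * h m + p * (1 / real m)) * real m" using elim by (simp add: hi_h ring_distribs)
      then have 1: "(d * hi m + p) powr (-p) = (d * h m + p * (1 / real m)) powr (-p) * real m powr (-p)"
        by (simp only: powr_mult)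
      have 2: "V m powr (p/2) = ((d - 1) * (c - \<eta>)^2 / (d * h m)) powr (p/2) * real m powr (p/2)"
        using elim by (simp only: V_h powr_mult)
      have 3: "real m powr (p/2) * (real m powr (-p) * real m powr (p/2)) = 1"
        using elim powr_add[of "real m" "p/2" "p/2"] by (simp add: powr_minus_divide)
      have "real m powr (p/2) * (H m * (1 - \<delta> m)) = k * d * (k powr (-p) * ((d * h m + p * (1 / real m)) powr (-p) * ((1 - \<eta>) * gauss_moment p *
      ((d - 1) * (c - \<eta>)^2 / (d * h m)) powr (p/2)))) * (1 - \<delta> m) * (real m powr (p/2) * (real m powr (-p) * real m powr (p/2)))"
        unfolding H_def 1 2 by (simp only: mult_ac)
      then show ?thesis unfolding 3 by simp
    qed
    ultimately show ?case using elim(1) by linarith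
  qed
qed

theorem theorem4:
  fixes p C :: real
    and qX :: "nat \<Rightarrow> 'x::finite list \<Rightarrow> 'x pmf"
    and qY :: "nat \<Rightarrow> 'y::finite list \<Rightarrow> 'y pmf"
    and n :: "nat \<Rightarrow> nat"
  assumes "CARD('x) \<ge> 2" and "CARD('y) \<ge> 2"
    and "1 \<le> p" and "p \<le> 2"
    and "first_order_minimax_optimal p qX"
    and "first_order_minimax_optimal p qY"
    and "C > 0"
    and "minimax_risk TYPE('y) p \<sim>[at_top] (\<lambda>t. C / real t powr (p / 2))"
    and "(\<lambda>m. real m) \<in> o(\<lambda>m. real (n m))"
  shows "(\<lambda>m. joint_worst_risk p m (n m) (joint_composition qX qY (n m))
              - joint_minimax_risk TYPE('x) TYPE('y) p m (n m))
           \<in> o(\<lambda>m. joint_minimax_risk TYPE('x) TYPE('y) p m (n m))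
       \<and> (\<lambda>m. joint_minimax_risk TYPE('x) TYPE('y) p m (n m)
              - real CARD('x) powr (1 - p / 2) * (C / real m powr (p / 2)))
           \<in> o(\<lambda>m. 1 / real m powr (p / 2))"
proof -
  let ?k = "real CARD('x)"
  let ?s = "\<lambda>m. real m powr (p/2)"
  define W where "W = (\<lambda>m. joint_worst_risk p m (n m) (joint_composition qX qY (n m)))"
  define R where "R = (\<lambda>m. joint_minimax_risk TYPE('x) TYPE('y) p m (n m))"
  define L where "L = ?k powr (1 - p / 2) * C"
  have p0: "0 \<le> p" using assms by simp
  have L: "L > 0" using assms by (simp add: L_def)
  have RW: "R m \<le> W m" for m
    unfolding R_def W_def by (rule joint_minimax_risk_le_joint_worst_risk[OF p0])
  \<comment> \<open>The empirical distribution competes in the univariate problem, so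
    \<open>C\<close> cannot exceed its worst Gaussian risk. This turns the lower bound, proved with
    \<open>gauss_risk\<close>, into one with \<open>L\<close>.\<close>
  have C_le: "C \<le> gauss_risk TYPE('y) p"
  proof (rule field_le_epsilon)
    fix e :: real assume e: "e > 0"
    have "(\<lambda>t. minimax_risk TYPE('y) p t / (C / real t powr (p/2))) \<longlonglongrightarrow> 1"
    proof (rule asymp_equivD_strong[OF assms(8)])
      show "eventually (\<lambda>t. minimax_risk TYPE('y) p t \<noteq> 0 \<or> C / real t powr (p/2) \<noteq> 0) at_top"
        using eventually_gt_at_top[of 0] by eventually_elim (use assms in auto)
    qed
    from tendsto_mult_left[OF this, of C]
    have lim: "(\<lambda>t. C * (minimax_risk TYPE('y) p t / (C / real t powr (p/2)))) \<longlonglongrightarrow> C" by simp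
    have "(\<lambda>t. gauss_risk TYPE('y) p + real CARD('y) * clt_error p t) \<longlonglongrightarrow> gauss_risk TYPE('y) p + real CARD('y) * 0"
      using assms by (intro tendsto_intros clt_error_tendsto_0)
    moreover have "eventually (\<lambda>t. C * (minimax_risk TYPE('y) p t / (C / real t powr (p/2))) \<le>
        gauss_risk TYPE('y) p + real CARD('y) * clt_error p t) at_top"
      using eventually_ge_at_top[of 1]
    proof eventually_elim
      case (elim t)
      have "real t powr (p/2) * minimax_risk TYPE('y) p t \<le>
          real t powr (p/2) * (real t powr (-(p/2)) * (gauss_risk TYPE('y) p + real CARD('y) * clt_error p t))"
        using assms elim by (intro mult_left_mono minimax_risk_le_gauss) auto
      also have "\<dots> = gauss_risk TYPE('y) p + real CARD('y) * clt_error p t"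
        using elim by (simp add: powr_minus_divide)
      finally show ?case using assms by (simp add: mult.commute)
    qed
    ultimately have "C \<le> gauss_risk TYPE('y) p + real CARD('y) * 0"
      using lim by (intro tendsto_le[OF sequentially_bot])
    then show "C \<le> gauss_risk TYPE('y) p + e" using e by simp
  qed
  have up: "eventually (\<lambda>m. ?s m * W m < c') at_top" if "L < c'" for c'
    unfolding W_def using that assms by (intro joint_composition_upper) (auto simp: L_def)
  have low: "eventually (\<lambda>m. c' < ?s m * R m) at_top" if "c' < L" for c'
  proof -
    have "L \<le> ?k powr (1 - p / 2) * gauss_risk TYPE('y) p"
      unfolding L_def using C_le by (intro mult_left_mono) auto
    then show ?thesis unfolding R_def using that assms by (intro joint_minimax_lower) auto
  qed
  have sRW: "?s m * R m \<le> ?s m * W m" for m using RW by (intro mult_left_mono) auto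
  \<comment> \<open>The upper bound concerns \<open>W\<close> and the lower bound \<open>R\<close>;
    as R <= W, each transfers to the other sequence, and both rescaled sequences converge to
    \<open>L\<close>.\<close>
  have limR: "(\<lambda>m. ?s m * R m) \<longlonglongrightarrow> L"
  proof (rule order_tendstoI)
    fix c' assume "L < c'"
    from up[OF this] show "eventually (\<lambda>m. ?s m * R m < c') at_top"
      by (rule eventually_mono) (rule le_less_trans[OF sRW])
  qed (rule low)
  have limW: "(\<lambda>m. ?s m * W m) \<longlonglongrightarrow> L"
  proof (rule order_tendstoI)
    fix c' assume "c' < L"
    from low[OF this] show "eventually (\<lambda>m. c' < ?s m * W m) at_top"
      by (rule eventually_mono) (rule less_le_trans[OF _ sRW])
  qed (rule up)
  have "(\<lambda>m. W m - R m) \<in> o(R)"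
  proof (rule smalloI_tendsto)
    have "(\<lambda>m. (?s m * W m - ?s m * R m) / (?s m * R m)) \<longlonglongrightarrow> (L - L) / L"
      using L by (intro tendsto_intros limR limW) auto
    moreover have "eventually (\<lambda>m. (?s m * W m - ?s m * R m) / (?s m * R m) = (W m - R m) / R m) at_top"
      using eventually_gt_at_top[of 0] by eventually_elim (simp add: right_diff_distrib[symmetric])
    ultimately show "(\<lambda>m. (W m - R m) / R m) \<longlonglongrightarrow> 0"
      by (auto elim: Lim_transform_eventually)
    show "eventually (\<lambda>m. R m \<noteq> 0) at_top"
      using low[OF L] by eventually_elim auto
  qed
  moreover have "(\<lambda>m. R m - ?k powr (1 - p / 2) * (C / ?s m)) \<in> o(\<lambda>m. 1 / ?s m)"
  proof (rule smalloI_tendsto)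
    have "(\<lambda>m. ?s m * R m - L) \<longlonglongrightarrow> L - L" by (intro tendsto_intros limR)
    moreover have "eventually (\<lambda>m. ?s m * R m - L = (R m - ?k powr (1 - p / 2) * (C / ?s m)) / (1 / ?s m)) at_top"
      using eventually_gt_at_top[of 0] by eventually_elim (simp add: L_def field_simps)
    ultimately show "(\<lambda>m. (R m - ?k powr (1 - p / 2) * (C / ?s m)) / (1 / ?s m)) \<longlonglongrightarrow> 0"
      by (auto elim: Lim_transform_eventually)
    show "eventually (\<lambda>m. 1 / ?s m \<noteq> 0) at_top"
      using eventually_gt_at_top[of 0] by eventually_elim auto
  qed
  ultimately show ?thesis unfolding W_def R_def by blast
qed

end
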